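(* For $x\in[x_0,x_1]$ let $B(x)$ be the triangular model depending on $x$ described in the context, let $A(x)=bB^3(x)$ ($b\in\mathbb R$, $b\ne0$), and let $A(x),B(x)$ be embedded in the strict colligation $X=(A(x),B(x);H,\widetilde\Phi(x),\mathbb C^{3m};\sigma_A,\sigma_B,\psi(x),\widetilde\psi(x))$ of the context, where $$\psi=\begin{pmatrix}bL\psi_{11}L&ibL\psi_{12}L&ibL\psi_{13}L\\-ibL\psi_{12}^*L&0&bL\\-ibL\psi_{13}L&bL&0\end{pmatrix},\qquad \psi_{11}^*=\psi_{11},\ \psi_{13}^*=\psi_{13},$$ and $\widetilde\psi$ has the same form with $m\times m$ blocks $\widetilde\psi_{11}=\widetilde\psi_{11}^*,\widetilde\psi_{12},\widetilde\psi_{13}=\widetilde\psi_{13}^*$. For a triple $\theta=(\theta_{11},\theta_{12},\theta_{13})$ of $m\times m$ matrix functions of $x$ (with $'=d/dx$) define $$p_1[\theta]=iL\theta_{12}-iL\theta_{12}^*+2L\theta_{13}'-(L\theta_{13})^2,\qquad p_2[\theta]=p_3[\theta]=iL\theta_{12}-iL\theta_{12}^*-L\theta_{13}'-(L\theta_{13})^2,$$ $$q_1[\theta]=L\theta_{13}''+iL\theta_{12}'+iL\theta_{11}-iL\theta_{12}L\theta_{13}-iL\theta_{13}L\theta_{12}^*-L\theta_{13}'L\theta_{13},$$ $$q_2[\theta]=-iL\theta_{13}L\theta_{12}+iL\theta_{11}+2iL\theta_{12}'-iL(\theta_{12}^* )'-iL\theta_{12}^*L\theta_{13},$$ $$q_3[\theta]=-L\theta_{13}'L\theta_{13}-L\theta_{13}''+iL\theta_{11}-2iL(\theta_{12}^*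 )'-iL\theta_{12}^*L\theta_{13}-L\theta_{13}L\theta_{13}'-iL\theta_{13}L\theta_{12}.$$ Suppose that both $\theta=(\psi_{11},\psi_{12},\psi_{13})$ and $\theta=(\widetilde\psi_{11},\widetilde\psi_{12},\widetilde\psi_{13})$ satisfy $$\theta_{11}L\theta_{13}-\theta_{13}L\theta_{11}+\theta_{13}L\theta_{13}L\theta_{12}-\theta_{12}L\theta_{13}L\theta_{13}-\theta_{13}'L\theta_{12}-\theta_{12}L\theta_{13}'-2\theta_{13}L\theta_{12}'+\theta_{11}'+\theta_{12}''=0,$$ $$\theta_{11}L\theta_{13}-\theta_{13}L\theta_{11}+i\theta_{12}L\theta_{12}^*-i\theta_{12}^*L\theta_{12}-(\theta_{12}^* )'L\theta_{13}-\theta_{12}^*L\theta_{13}'+2\theta_{11}'-(\theta_{12}^* )''=0,$$ $$\theta_{12}L\theta_{12}^*L\theta_{13}-\theta_{13}L\theta_{12}L\theta_{12}^*+i\theta_{13}L\theta_{11}L\theta_{13}-i\theta_{13}L\theta_{13}L\theta_{11}+i\theta_{11}L\theta_{12}-i\theta_{12}L\theta_{11}-i\theta_{11}'L\theta_{13}-i\theta_{11}L\theta_{13}'$$ $$+i\theta_{13}'L\theta_{11}+2i\theta_{13}L\theta_{11}'+2\theta_{12}L(\theta_{12}^* )'+\theta_{12}'L\theta_{12}^*-\theta_{11}''=0.$$ Let $\lambda\in\mathbb C$ lie outside the spectrum of $A(x)$ and let $u(x,t)=e^{i\lambda t}u_\lambda(x)=e^{i\lambda t}(u_1,u_2,u_3)(x)$,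 $f(x,t)=e^{i\lambda t}f_\lambda(x)$, $v(x,t)=e^{i\lambda t}v_\lambda(x)=e^{i\lambda t}(v_1,v_2,v_3)(x)$ be the input, state and output of the open system $$i\frac{\partial f}{\partial t}+A(x)f=\widetilde\Phi^*(x)\sigma_Au,\quad i\frac{\partial f}{\partial x}+B(x)f=\widetilde\Phi^*(x)\sigma_Bu,\quad v=u-i\widetilde\Phi(x)f.$$ Then the input and the output satisfy the compatibility conditions $$\frac{du_\lambda}{dx}-i\sigma_A^{-1}(\lambda\sigma_B+\psi(x))u_\lambda=0,\qquad \frac{dv_\lambda}{dx}-i\sigma_A^{-1}(\lambda\sigma_B+\widetilde\psi(x))v_\lambda=0,$$ and the characteristic operator function $W_A(\lambda)=I-i\widetilde\Phi(A-\lambda I)^{-1}\widetilde\Phi^*\sigma_A$ of $A=bB^3$ maps the input, satisfying $$\frac{d^3u_k}{dx^3}+\frac{du_k}{dx}p_k[\psi]+u_kq_k[\psi]=-\frac{i\lambda}bu_k,\qquad k=1,2,3,$$ to the output ($v_\lambda=W_A(\lambda)u_\lambda$), whose components are solutions of $$\frac{d^3v_k}{dx^3}+\frac{dv_k}{dx}p_k[\widetilde\psi]+v_kq_k[\widetilde\psi]=-\frac{i\lambda}bv_k,\qquad k=1,2,3.$$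
   Context: Conventions. Elements of $\mathbb C^k$ are row vectors and every matrix $K$, including the block matrices $\sigma_A,\sigma_B,\psi(x),\widetilde\psi(x)$ on $\mathbb C^{3m}=(\mathbb C^m)^3$, acts by right multiplication: the operator written $Ku$ is $u\mapsto uK$ (e.g. $\psi u_\lambda$ means $(u_1,u_2,u_3)\psi$). In $p_k,q_k$ and the extra conditions the products are ordinary matrix products. $p_k[\psi]$ means $p_k[(\psi_{11},\psi_{12},\psi_{13})]$, etc. Triangular model. $1\le p\le m$, $\Delta=[-l,l]$, $H=\mathbf L^2(\Delta;\mathbb C^p)$. $L$ is an invertible Hermitian $m\times m$ matrix with $L=J_1-J_2+S_0+S_0^*$, $J_1=\begin{pmatrix}I_r&0\\0&0\end{pmatrix}$, $J_2=\begin{pmatrix}0&0\\0&I_{m-r}\end{pmatrix}$, $S_0=\begin{pmatrix}0&0\\ \widehat S&0\end{pmatrix}$, with $r$, $m-r$ the numbers of positive and negative eigenvalues of $L$. For each $x$, $\Pi(\cdot,x)$ is a measurable $p\times m$ matrix function on $\Delta$ with rows linearly independent at each point of a set of positive measure, and $\widetilde\Pi=\Pi^*\Pi$ satisfies $\operatorname{tr}\widetilde\Pi=1$, $\widetilde\Pi J_1=J_1\widetilde\Pi$ and a Hölder condition in $w$. Then $$(B(x)f)(w)=wf(w)-i\int_{-l}^{w}f(\xi)\Pi(\xi,x)S_0^*\Pi^*(w,x)d\xi+i\int_w^{l}f(\xi)\Pi(\xi,x)S_0\Pi^*(w,x)d\xi+i\int_{-l}^{w}f(\xi)\Pi(\xi,x)L\Pi^*(w,x)d\xi,$$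 $\Phi(x)f=\int_\Delta f(w)\Pi(w,x)dw$, $\widetilde\Phi(x)f=(\Phi(x)f,\Phi(x)B^*(x)f,\Phi(x)B^{*}(x)^2f)$, $$\sigma_A=\begin{pmatrix}0&0&bL\\ 0&bL&0\\ bL&0&0\end{pmatrix},\quad \sigma_B=\begin{pmatrix}L&0&0\\0&0&0\\0&0&0\end{pmatrix}.$$ Colligation depending on $x$. $\psi(x),\widetilde\psi(x)$ are selfadjoint, and $$\tfrac{A-A^*}{i}=\widetilde\Phi^*\sigma_A\widetilde\Phi,\quad \tfrac{B-B^*}{i}=\widetilde\Phi^*\sigma_B\widetilde\Phi,\quad \tfrac1i\sigma_A\tfrac{d\widetilde\Phi}{dx}+\sigma_A\widetilde\Phi B^*-\sigma_B\widetilde\Phi A^*=\psi\widetilde\Phi,$$ $$\tfrac1i\sigma_A\tfrac{d\widetilde\Phi}{dx}+\sigma_A\widetilde\Phi B-\sigma_B\widetilde\Phi A=\widetilde\psi\widetilde\Phi,\quad \widetilde\psi=\psi+i(\sigma_A\widetilde\Phi\widetilde\Phi^*\sigma_B-\sigma_B\widetilde\Phi\widetilde\Phi^*\sigma_A),\quad i\tfrac{dA}{dx}=AB-BA .$$ "Strict" means $\widetilde\Phi(x)H=\mathbb C^{3m}$ and $\ker\sigma_A\cap\ker\sigma_B=\{0\}$. All functions of $x$ are as smooth as the formulas require. *)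

theory Defs
  imports "HOL-Analysis.Analysis" "HOL-Computational_Algebra.Polynomial"
begin

text \<open>
  Elements of \<open>complex ^ 'm\<close> are read as row vectors and a matrix \<open>K\<close> acts by \<open>u v* K\<close>.
  The operator written \<open>S K u\<close> in operator notation is therefore \<open>(u v* K) v* S\<close>, while
  products \<open>**\<close> are ordinary matrix products.
\<close>

type_synonym 'm cmat = "((complex, 'm) vec, 'm) vec"

definition hconj :: "complex ^ 'n ^ 'm \<Rightarrow> complex ^ 'm ^ 'n" where
  "hconj M = (\<chi> i j. cnj (M $ j $ i))"

definition cscale :: "complex \<Rightarrow> complex ^ 'n ^ 'm \<Rightarrow> complex ^ 'n ^ 'm"  (infixr "*\<^sub>m" 75) where
  "c *\<^sub>m M = (\<chi> i j. c * M $ i $ j)"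

definition charpoly :: "('m::finite) cmat \<Rightarrow> complex poly" where
  "charpoly M = det (\<chi> i j. (if i = j then [:0, 1:] else 0) - [:M $ i $ j:])"

text \<open>Numbers of positive and negative eigenvalues, counted with multiplicity.\<close>

definition num_pos_eigs :: "('m::finite) cmat \<Rightarrow> nat" where
  "num_pos_eigs M = (\<Sum>a\<in>{a::real. 0 < a \<and> poly (charpoly M) (complex_of_real a) = 0}.
     order (complex_of_real a) (charpoly M))"

definition num_neg_eigs :: "('m::finite) cmat \<Rightarrow> nat" where
  "num_neg_eigs M = (\<Sum>a\<in>{a::real. a < 0 \<and> poly (charpoly M) (complex_of_real a) = 0}.
     order (complex_of_real a) (charpoly M))"

text \<open>
  The matrix indices form a finite linear order; \<open>pos i\<close> is the 0-based position of \<open>i\<close>, so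
  that the first block of an \<open>r + (m - r)\<close> decomposition consists of the \<open>i\<close> with \<open>pos i < r\<close>.
\<close>

definition pos :: "'m::{finite,linorder} \<Rightarrow> nat" where
  "pos i = card {j. j < i}"

definition J1 :: "nat \<Rightarrow> ('m::{finite,linorder}) cmat" where
  "J1 r = (\<chi> i j. if i = j \<and> pos i < r then 1 else 0)"

definition J2 :: "nat \<Rightarrow> ('m::{finite,linorder}) cmat" where
  "J2 r = (\<chi> i j. if i = j \<and> r \<le> pos i then 1 else 0)"

definition lower_left_block :: "nat \<Rightarrow> ('m::{finite,linorder}) cmat \<Rightarrow> bool" where
  "lower_left_block r S0 \<longleftrightarrow> (\<forall>i j. \<not> (r \<le> pos i \<and> pos j < r) \<longrightarrow> S0 $ i $ j = 0)"

text \<open>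
  \<open>\<complex>\<^sup>3\<^sup>m = (\<complex>\<^sup>m)\<^sup>3\<close> is \<open>complex ^ (3 \<times> 'm)\<close>, the first index being the block number
  (in the type \<open>3\<close> the numeral \<open>3\<close> denotes the third index; it happens to equal \<open>0\<close>).
\<close>

definition triple :: "complex ^ 'm \<Rightarrow> complex ^ 'm \<Rightarrow> complex ^ 'm \<Rightarrow> complex ^ (3 \<times> 'm)" where
  "triple a b c = (\<chi> q. (vector [a, b, c] :: complex ^ 'm ^ 3) $ fst q $ snd q)"

definition comp3 :: "3 \<Rightarrow> complex ^ (3 \<times> 'm) \<Rightarrow> complex ^ 'm" where
  "comp3 k u = (\<chi> i. u $ (k, i))"

definition block3 :: "('m::finite) cmat ^ 3 ^ 3 \<Rightarrow> (3 \<times> 'm) cmat" where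
  "block3 K = (\<chi> q s. K $ fst q $ fst s $ snd q $ snd s)"

definition sigma_A :: "real \<Rightarrow> ('m::finite) cmat \<Rightarrow> (3 \<times> 'm) cmat" where
  "sigma_A b L = (let M = complex_of_real b *\<^sub>m L in block3 (vector
     [vector [0, 0, M],
      vector [0, M, 0],
      vector [M, 0, 0]]))"

definition sigma_B :: "('m::finite) cmat \<Rightarrow> (3 \<times> 'm) cmat" where
  "sigma_B L = block3 (vector
     [vector [L, 0, 0],
      vector [0, 0, 0],
      vector [0, 0, 0]])"

definition psi_block ::
  "real \<Rightarrow> ('m::finite) cmat \<Rightarrow> 'm cmat \<Rightarrow> 'm cmat \<Rightarrow> 'm cmat \<Rightarrow>
   (3 \<times> 'm) cmat" where
  "psi_block b L p11 p12 p13 = (let \<beta> = complex_of_real b in block3 (vector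
     [vector [\<beta> *\<^sub>m L ** p11 ** L, (\<i> * \<beta>) *\<^sub>m L ** p12 ** L, (\<i> * \<beta>) *\<^sub>m L ** p13 ** L],
      vector [(- \<i> * \<beta>) *\<^sub>m L ** hconj p12 ** L, 0, \<beta> *\<^sub>m L],
      vector [(- \<i> * \<beta>) *\<^sub>m L ** p13 ** L, \<beta> *\<^sub>m L, 0]]))"

text \<open>
  Elements of \<open>H = L\<^sup>2([-l,l]; \<complex>\<^sup>p)\<close> are represented by square integrable functions (only
  their values on \<open>[-l,l]\<close> matter), and equality in \<open>H\<close> is \<open>eqH l\<close>. Operators are maps on
  representatives.
\<close>

type_synonym 'p hfun = "real \<Rightarrow> complex ^ 'p"

abbreviation \<Delta> :: "real \<Rightarrow> real measure" where
  "\<Delta> l \<equiv> lebesgue_on {-l..l}"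

definition H :: "real \<Rightarrow> ('p::finite) hfun set" where
  "H l = {f. f \<in> borel_measurable (\<Delta> l) \<and> integrable (\<Delta> l) (\<lambda>w. (norm (f w))\<^sup>2)}"

definition eqH :: "real \<Rightarrow> ('p::finite) hfun \<Rightarrow> 'p hfun \<Rightarrow> bool" where
  "eqH l f g \<longleftrightarrow> (AE w in \<Delta> l. f w = g w)"

definition normH :: "real \<Rightarrow> ('p::finite) hfun \<Rightarrow> real" where
  "normH l f = sqrt (LINT w|\<Delta> l. (norm (f w))\<^sup>2)"

definition cdot :: "complex ^ 'n \<Rightarrow> complex ^ 'n \<Rightarrow> complex" where
  "cdot u v = (\<Sum>i\<in>UNIV. u $ i * cnj (v $ i))"

definition innerH :: "real \<Rightarrow> ('p::finite) hfun \<Rightarrow> 'p hfun \<Rightarrow> complex" where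
  "innerH l f g = (LINT w|\<Delta> l. cdot (f w) (g w))"

text \<open>Adjoints of operators \<open>H \<rightarrow> H\<close> and \<open>H \<rightarrow> \<complex>\<^sup>n\<close>; they are determined up to \<open>eqH l\<close>.\<close>

definition adjH :: "real \<Rightarrow> (('p::finite) hfun \<Rightarrow> 'p hfun) \<Rightarrow> ('p hfun \<Rightarrow> 'p hfun)" where
  "adjH l T = (SOME S. (\<forall>g\<in>H l. S g \<in> H l) \<and>
     (\<forall>f\<in>H l. \<forall>g\<in>H l. innerH l (T f) g = innerH l f (S g)))"

definition adjHC :: "real \<Rightarrow> (('p::finite) hfun \<Rightarrow> complex ^ 'n) \<Rightarrow> (complex ^ 'n \<Rightarrow> 'p hfun)" where
  "adjHC l T = (SOME S. (\<forall>u. S u \<in> H l) \<and>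
     (\<forall>f\<in>H l. \<forall>u. cdot (T f) u = innerH l f (S u)))"

definition bounded_opH :: "real \<Rightarrow> (('p::finite) hfun \<Rightarrow> 'p hfun) \<Rightarrow> bool" where
  "bounded_opH l T \<longleftrightarrow>
     (\<forall>f\<in>H l. T f \<in> H l) \<and>
     (\<forall>f\<in>H l. \<forall>g\<in>H l. \<forall>c d.
        eqH l (T (\<lambda>w. c *s f w + d *s g w)) (\<lambda>w. c *s T f w + d *s T g w)) \<and>
     (\<exists>C. \<forall>f\<in>H l. normH l (T f) \<le> C * normH l f)"

definition inverse_shift ::
  "real \<Rightarrow> (('p::finite) hfun \<Rightarrow> 'p hfun) \<Rightarrow> complex \<Rightarrow> ('p hfun \<Rightarrow> 'p hfun) \<Rightarrow> bool" where
  "inverse_shift l T z R \<longleftrightarrow> bounded_opH l R \<and>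
     (\<forall>f\<in>H l. eqH l (R (\<lambda>w. T f w - z *s f w)) f \<and> eqH l (\<lambda>w. T (R f) w - z *s R f w) f)"

definition spectrumH :: "real \<Rightarrow> (('p::finite) hfun \<Rightarrow> 'p hfun) \<Rightarrow> complex set" where
  "spectrumH l T = {z. \<nexists>R. inverse_shift l T z R}"

definition resolventH ::
  "real \<Rightarrow> (('p::finite) hfun \<Rightarrow> 'p hfun) \<Rightarrow> complex \<Rightarrow> ('p hfun \<Rightarrow> 'p hfun)" where
  "resolventH l T z = (SOME R. inverse_shift l T z R)"

text \<open>Derivative at \<open>x\<close>, within \<open>S\<close>, of an \<open>H\<close>-valued function, in the norm of \<open>H\<close>.\<close>

definition has_derivH ::
  "real \<Rightarrow> real set \<Rightarrow> (real \<Rightarrow> ('p::finite) hfun) \<Rightarrow> 'p hfun \<Rightarrow> real \<Rightarrow> bool" where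
  "has_derivH l S F D x \<longleftrightarrow> (\<forall>y\<in>S. F y \<in> H l) \<and> D \<in> H l \<and>
     ((\<lambda>y. normH l (\<lambda>w. (1 / (y - x)) *\<^sub>R (F y w - F x w) - D w)) \<longlongrightarrow> 0) (at x within S)"

definition model_matrix ::
  "nat \<Rightarrow> ('m::{finite,linorder}) cmat \<Rightarrow> 'm cmat \<Rightarrow> bool" where
  "model_matrix r L S0 \<longleftrightarrow>
     invertible L \<and> hconj L = L \<and>
     r \<le> CARD('m) \<and> num_pos_eigs L = r \<and> num_neg_eigs L = CARD('m) - r \<and>
     lower_left_block r S0 \<and> L = J1 r - J2 r + S0 + hconj S0"

definition model_kernel ::
  "real \<Rightarrow> nat \<Rightarrow> (real \<Rightarrow> complex ^ ('m::{finite,linorder}) ^ ('p::finite)) \<Rightarrow> bool" where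
  "model_kernel l r P \<longleftrightarrow>
     P \<in> borel_measurable (\<Delta> l) \<and>
     (\<exists>E\<in>sets lebesgue. E \<subseteq> {-l..l} \<and> emeasure lebesgue E > 0 \<and>
        (\<forall>w\<in>E. \<forall>c. c v* P w = 0 \<longrightarrow> c = 0)) \<and>
     (\<forall>w\<in>{-l..l}. trace (hconj (P w) ** P w) = 1) \<and>
     (\<forall>w\<in>{-l..l}. hconj (P w) ** P w ** J1 r = J1 r ** (hconj (P w) ** P w)) \<and>
     (\<exists>C \<alpha>. 0 < \<alpha> \<and> \<alpha> \<le> 1 \<and> (\<forall>w\<in>{-l..l}. \<forall>w'\<in>{-l..l}.
        norm (hconj (P w) ** P w - hconj (P w') ** P w') \<le> C * \<bar>w - w'\<bar> powr \<alpha>))"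

definition model_B ::
  "real \<Rightarrow> ('m::finite) cmat \<Rightarrow> 'm cmat \<Rightarrow> (real \<Rightarrow> complex ^ 'm ^ 'p) \<Rightarrow>
   ('p::finite) hfun \<Rightarrow> 'p hfun" where
  "model_B l L S0 P f w =
     complex_of_real w *s f w
     - \<i> *s (LINT \<xi>:{-l..w}|lebesgue. f \<xi> v* (P \<xi> ** hconj S0 ** hconj (P w)))
     + \<i> *s (LINT \<xi>:{w..l}|lebesgue. f \<xi> v* (P \<xi> ** S0 ** hconj (P w)))
     + \<i> *s (LINT \<xi>:{-l..w}|lebesgue. f \<xi> v* (P \<xi> ** L ** hconj (P w)))"

definition model_Phi :: "real \<Rightarrow> (real \<Rightarrow> complex ^ 'm ^ 'p) \<Rightarrow> ('p::finite) hfun \<Rightarrow> complex ^ 'm" where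
  "model_Phi l P f = (LINT w:{-l..l}|lebesgue. f w v* P w)"

definition model_Phit ::
  "real \<Rightarrow> ('m::finite) cmat \<Rightarrow> 'm cmat \<Rightarrow> (real \<Rightarrow> complex ^ 'm ^ 'p) \<Rightarrow>
   ('p::finite) hfun \<Rightarrow> complex ^ (3 \<times> 'm)" where
  "model_Phit l L S0 P f =
     (let Bs = adjH l (model_B l L S0 P)
      in triple (model_Phi l P f) (model_Phi l P (Bs f)) (model_Phi l P (Bs (Bs f))))"

definition model_A ::
  "real \<Rightarrow> real \<Rightarrow> ('m::finite) cmat \<Rightarrow> 'm cmat \<Rightarrow> (real \<Rightarrow> complex ^ 'm ^ 'p) \<Rightarrow>
   ('p::finite) hfun \<Rightarrow> 'p hfun" where
  "model_A b l L S0 P f = (\<lambda>w. complex_of_real b *s (model_B l L S0 P ^^ 3) f w)"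

text \<open>
  Derivatives of operator functions of \<open>x\<close> are taken in the strong sense, on each vector of \<open>H\<close>.
\<close>

definition colligation ::
  "real \<Rightarrow> real set \<Rightarrow> (real \<Rightarrow> ('p::finite) hfun \<Rightarrow> 'p hfun) \<Rightarrow> (real \<Rightarrow> 'p hfun \<Rightarrow> 'p hfun) \<Rightarrow>
   (real \<Rightarrow> 'p hfun \<Rightarrow> complex ^ 'n) \<Rightarrow> ('n::finite) cmat \<Rightarrow> 'n cmat \<Rightarrow>
   (real \<Rightarrow> 'n cmat) \<Rightarrow> (real \<Rightarrow> 'n cmat) \<Rightarrow> bool" where
  "colligation l S A B \<Phi> \<sigma>A \<sigma>B \<psi> \<psi>' \<longleftrightarrow> (\<forall>x\<in>S.
     hconj (\<psi> x) = \<psi> x \<and> hconj (\<psi>' x) = \<psi>' x \<and>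
     (\<forall>f\<in>H l. eqH l (\<lambda>w. (1 / \<i>) *s (A x f w - adjH l (A x) f w))
                      (adjHC l (\<Phi> x) (\<Phi> x f v* \<sigma>A))) \<and>
     (\<forall>f\<in>H l. eqH l (\<lambda>w. (1 / \<i>) *s (B x f w - adjH l (B x) f w))
                      (adjHC l (\<Phi> x) (\<Phi> x f v* \<sigma>B))) \<and>
     (\<forall>f\<in>H l. \<exists>d. ((\<lambda>y. \<Phi> y f) has_vector_derivative d) (at x within S) \<and>
        (1 / \<i>) *s (d v* \<sigma>A) + \<Phi> x (adjH l (B x) f) v* \<sigma>A - \<Phi> x (adjH l (A x) f) v* \<sigma>B
          = \<Phi> x f v* \<psi> x \<and>
        (1 / \<i>) *s (d v* \<sigma>A) + \<Phi> x (B x f) v* \<sigma>A - \<Phi> x (A x f) v* \<sigma>B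
          = \<Phi> x f v* \<psi>' x) \<and>
     (\<forall>u. u v* \<psi>' x = u v* \<psi> x
        + \<i> *s (\<Phi> x (adjHC l (\<Phi> x) (u v* \<sigma>B)) v* \<sigma>A - \<Phi> x (adjHC l (\<Phi> x) (u v* \<sigma>A)) v* \<sigma>B)) \<and>
     (\<forall>f\<in>H l. \<exists>D. has_derivH l S (\<lambda>y. A y f) D x \<and>
        eqH l (\<lambda>w. \<i> *s D w) (\<lambda>w. A x (B x f) w - B x (A x f) w)))"

definition strict_colligation ::
  "real \<Rightarrow> real set \<Rightarrow> (real \<Rightarrow> ('p::finite) hfun \<Rightarrow> complex ^ 'n) \<Rightarrow>
   ('n::finite) cmat \<Rightarrow> 'n cmat \<Rightarrow> bool" where
  "strict_colligation l S \<Phi> \<sigma>A \<sigma>B \<longleftrightarrow>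
     (\<forall>x\<in>S. \<Phi> x ` H l = UNIV) \<and> {u. u v* \<sigma>A = 0} \<inter> {u. u v* \<sigma>B = 0} = {0}"

definition open_system ::
  "real \<Rightarrow> real set \<Rightarrow> (real \<Rightarrow> ('p::finite) hfun \<Rightarrow> 'p hfun) \<Rightarrow> (real \<Rightarrow> 'p hfun \<Rightarrow> 'p hfun) \<Rightarrow>
   (real \<Rightarrow> 'p hfun \<Rightarrow> complex ^ 'n) \<Rightarrow> ('n::finite) cmat \<Rightarrow> 'n cmat \<Rightarrow>
   (real \<Rightarrow> real \<Rightarrow> complex ^ 'n) \<Rightarrow> (real \<Rightarrow> real \<Rightarrow> 'p hfun) \<Rightarrow> (real \<Rightarrow> real \<Rightarrow> complex ^ 'n) \<Rightarrow> bool"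
  where
  "open_system l S A B \<Phi> \<sigma>A \<sigma>B u f v \<longleftrightarrow> (\<forall>x\<in>S. \<forall>t.
     (\<exists>ft. has_derivH l UNIV (\<lambda>s. f x s) ft t \<and>
        eqH l (\<lambda>w. \<i> *s ft w + A x (f x t) w) (adjHC l (\<Phi> x) (u x t v* \<sigma>A))) \<and>
     (\<exists>fx. has_derivH l S (\<lambda>y. f y t) fx x \<and>
        eqH l (\<lambda>w. \<i> *s fx w + B x (f x t) w) (adjHC l (\<Phi> x) (u x t v* \<sigma>B))) \<and>
     v x t = u x t - \<i> *s \<Phi> x (f x t))"

definition char_fun ::
  "real \<Rightarrow> (('p::finite) hfun \<Rightarrow> 'p hfun) \<Rightarrow> ('p hfun \<Rightarrow> complex ^ 'n) \<Rightarrow> ('n::finite) cmat \<Rightarrow>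
   complex \<Rightarrow> complex ^ 'n \<Rightarrow> complex ^ 'n" where
  "char_fun l A \<Phi> \<sigma>A z u = u - \<i> *s \<Phi> (resolventH l A z (adjHC l \<Phi> (u v* \<sigma>A)))"

definition deriv_on :: "real set \<Rightarrow> (real \<Rightarrow> 'v::real_normed_vector) \<Rightarrow> real \<Rightarrow> 'v" where
  "deriv_on S f x = vector_derivative f (at x within S)"

definition times_differentiable_on ::
  "nat \<Rightarrow> real set \<Rightarrow> (real \<Rightarrow> 'v::real_normed_vector) \<Rightarrow> bool" where
  "times_differentiable_on n S f \<longleftrightarrow> (\<forall>k<n. (deriv_on S ^^ k) f differentiable_on S)"

definition p_coef ::
  "real set \<Rightarrow> ('m::finite) cmat \<Rightarrow> (real \<Rightarrow> 'm cmat) \<Rightarrow> (real \<Rightarrow> 'm cmat) \<Rightarrow>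
   (real \<Rightarrow> 'm cmat) \<Rightarrow> 3 \<Rightarrow> real \<Rightarrow> 'm cmat" where
  "p_coef S L \<theta>11 \<theta>12 \<theta>13 k x =
     (let b = \<theta>12 x; c = \<theta>13 x; c' = deriv_on S \<theta>13 x in
      if k = 1
      then \<i> *\<^sub>m L ** b - \<i> *\<^sub>m L ** hconj b + 2 *\<^sub>m L ** c' - (L ** c) ** (L ** c)
      else \<i> *\<^sub>m L ** b - \<i> *\<^sub>m L ** hconj b - L ** c' - (L ** c) ** (L ** c))"

definition q_coef ::
  "real set \<Rightarrow> ('m::finite) cmat \<Rightarrow> (real \<Rightarrow> 'm cmat) \<Rightarrow> (real \<Rightarrow> 'm cmat) \<Rightarrow>
   (real \<Rightarrow> 'm cmat) \<Rightarrow> 3 \<Rightarrow> real \<Rightarrow> 'm cmat" where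
  "q_coef S L \<theta>11 \<theta>12 \<theta>13 k x =
     (let a = \<theta>11 x; b = \<theta>12 x; b' = deriv_on S \<theta>12 x;
          bs = hconj (\<theta>12 x); bs' = deriv_on S (\<lambda>y. hconj (\<theta>12 y)) x;
          c = \<theta>13 x; c' = deriv_on S \<theta>13 x; c'' = deriv_on S (deriv_on S \<theta>13) x in
      if k = 1
      then L ** c'' + \<i> *\<^sub>m L ** b' + \<i> *\<^sub>m L ** a - \<i> *\<^sub>m L ** b ** L ** c
           - \<i> *\<^sub>m L ** c ** L ** bs - L ** c' ** L ** c
      else if k = 2
      then - (\<i> *\<^sub>m L ** c ** L ** b) + \<i> *\<^sub>m L ** a + (2 * \<i>) *\<^sub>m L ** b' - \<i> *\<^sub>m L ** bs'
           - \<i> *\<^sub>m L ** bs ** L ** c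
      else - (L ** c' ** L ** c) - L ** c'' + \<i> *\<^sub>m L ** a - (2 * \<i>) *\<^sub>m L ** bs'
           - \<i> *\<^sub>m L ** bs ** L ** c - L ** c ** L ** c' - \<i> *\<^sub>m L ** c ** L ** b)"

definition extra_conditions ::
  "real set \<Rightarrow> ('m::finite) cmat \<Rightarrow> (real \<Rightarrow> 'm cmat) \<Rightarrow> (real \<Rightarrow> 'm cmat) \<Rightarrow>
   (real \<Rightarrow> 'm cmat) \<Rightarrow> bool" where
  "extra_conditions S L \<theta>11 \<theta>12 \<theta>13 \<longleftrightarrow> (\<forall>x\<in>S.
     let a = \<theta>11 x; a' = deriv_on S \<theta>11 x; a'' = deriv_on S (deriv_on S \<theta>11) x;
         b = \<theta>12 x; b' = deriv_on S \<theta>12 x; b'' = deriv_on S (deriv_on S \<theta>12) x;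
         bs = hconj (\<theta>12 x); bs' = deriv_on S (\<lambda>y. hconj (\<theta>12 y)) x;
         bs'' = deriv_on S (deriv_on S (\<lambda>y. hconj (\<theta>12 y))) x;
         c = \<theta>13 x; c' = deriv_on S \<theta>13 x in
     a ** L ** c - c ** L ** a + c ** L ** c ** L ** b - b ** L ** c ** L ** c
       - c' ** L ** b - b ** L ** c' - 2 *\<^sub>m c ** L ** b' + a' + b'' = 0 \<and>
     a ** L ** c - c ** L ** a + \<i> *\<^sub>m b ** L ** bs - \<i> *\<^sub>m bs ** L ** b
       - bs' ** L ** c - bs ** L ** c' + 2 *\<^sub>m a' - bs'' = 0 \<and>
     b ** L ** bs ** L ** c - c ** L ** b ** L ** bs
       + \<i> *\<^sub>m c ** L ** a ** L ** c - \<i> *\<^sub>m c ** L ** c ** L ** a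
       + \<i> *\<^sub>m a ** L ** b - \<i> *\<^sub>m b ** L ** a - \<i> *\<^sub>m a' ** L ** c - \<i> *\<^sub>m a ** L ** c'
       + \<i> *\<^sub>m c' ** L ** a + (2 * \<i>) *\<^sub>m c ** L ** a' + 2 *\<^sub>m b ** L ** bs' + b' ** L ** bs
       - a'' = 0)"

text \<open>\<open>y\<close> is three times differentiable on \<open>S\<close> and \<open>y''' + y' p + y q = \<mu> y\<close> there.\<close>

definition solves_third_order ::
  "real set \<Rightarrow> (real \<Rightarrow> ('m::finite) cmat) \<Rightarrow> (real \<Rightarrow> 'm cmat) \<Rightarrow> complex \<Rightarrow>
   (real \<Rightarrow> complex ^ 'm) \<Rightarrow> bool" where
  "solves_third_order S p q \<mu> y \<longleftrightarrow> times_differentiable_on 3 S y \<and>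
     (\<forall>x\<in>S. (deriv_on S ^^ 3) y x + deriv_on S y x v* p x + y x v* q x = \<mu> *s y x)"

end

theory Submission
  imports Defs "HOL-Complex_Analysis.Complex_Analysis"
begin

text \<open>
  Since \<open>A = b B\<^sup>3\<close> commutes with \<open>B\<close>, the equation \<open>i dA/dx = AB - BA\<close> makes \<open>A\<close>, hence \<open>B\<^sup>3\<close>,
  independent of \<open>x\<close>. The triangular model determines \<open>B\<close> from \<open>B\<^sup>3\<close>: its resolvent exists off the
  real axis with norm \<open>O(1/|Im z| + 1/|Im z|\<^sup>2)\<close> and \<open>B\<close> has no kernel, so a Liouville argument applies to
  the difference of two resolvents. Hence \<open>B\<close> is constant. As \<open>\<Phi>\<^sup>* L \<Phi>\<close> is then constant while \<open>d\<Phi>/dx\<close> is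
  \<open>\<Phi>\<close> followed by \<open>- L \<psi>\<^sub>1\<^sub>3\<close>, surjectivity gives \<open>\<psi>\<^sub>1\<^sub>3 = 0\<close>, after which all of \<open>\<Phi>\<close> is constant and
  \<open>\<psi>\<^sub>1\<^sub>1 = \<psi>\<^sub>1\<^sub>2 = 0\<close>. The blocks of \<open>\<psi>\<close> with tilde are the constant matrices of \<open>\<Phi>\<Phi>\<^sup>*\<close>, \<open>\<Phi>B\<^sup>*\<Phi>\<^sup>*\<close> and
  \<open>i \<Phi>(B\<^sup>*\<^sup>2 - B\<^sup>2)\<Phi>\<^sup>*\<close>, and \<open>B - B\<^sup>* = i \<Phi>\<^sup>* L \<Phi>\<close> relates them so that all \<open>p\<^sub>k\<close>, \<open>q\<^sub>k\<close> vanish. Both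
  compatibility conditions are then first-order systems with constant coefficients whose generator has
  the cube \<open>- i \<lambda> / b\<close>.
\<close>

text \<open>Operators have many cube roots: a nonzero operator with vanishing cube shares its cube
  with 0, and factors \<omega> on invariant subspaces are invisible in the cube. The first is
  excluded by the trivial kernel, the second by location: the resolvent of B is singular only on the
  real line, and the three lines obtained from it by rotation through \<omega> meet only at 0. The
  partial fractions of 3 z^2 / (t^3 - z^3) over the roots z, \<omega> z, \<omega>^2 z turn equality
  of cubes into a functional equation for the difference F of two resolvents; it defines F on each
  line from its values off that line. The square in the resolvent bound leaves exactly one free
  constant, the value of z^2 F, which the expansion at infinity identifies with the difference of
  the operators up to sign. The obstacle to the resolvent bound is the term of B with S_0: it
  involves the integral of f over all of [-l,l], so B - z is not a Volterra equation. Since S_0 maps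
  the second block to the first, the second block can be solved by itself, and it supplies the
  boundary value for the full equation.\<close>

no_notation fps_nth (infixl \<open>$\<close> 75)

section \<open>Row vectors\<close>

lemma norm_vec_sq: "(norm (x :: complex ^ 'n))\<^sup>2 = (\<Sum>i\<in>UNIV. (norm (x $ i))\<^sup>2)"
  by (simp add: norm_vec_def L2_set_def sum_nonneg)

lemma norm_smult: "norm (c *s (x :: complex ^ 'n)) = norm c * norm x"
proof -
  have "(norm (c *s x))\<^sup>2 = (norm c * norm x)\<^sup>2"
    by (simp add: norm_vec_sq norm_mult power_mult_distrib sum_distrib_left)
  then show ?thesis by (simp add: power2_eq_iff_nonneg)
qed

lemma bounded_bilinear_smult: "bounded_bilinear ((*s) :: complex \<Rightarrow> complex ^ 'n \<Rightarrow> _)"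
proof
  show "\<exists>K. \<forall>a b. norm (a *s (b :: complex ^ 'n)) \<le> norm a * norm b * K"
    by (intro exI[of _ 1]) (simp add: norm_smult)
qed (vector algebra_simps, vector algebra_simps, simp_all add: vec_eq_iff)

lemma norm_vec_le_sum: "norm (x :: complex ^ 'n) \<le> (\<Sum>i\<in>UNIV. norm (x $ i))"
  by (simp add: norm_vec_def L2_set_le_sum)

lemma bounded_bilinear_vector_matrix_mult:
  "bounded_bilinear ((v*) :: complex ^ 'm \<Rightarrow> complex ^ 'n ^ 'm \<Rightarrow> complex ^ 'n)"
proof
  fix r :: real and a :: "complex ^ 'm" and M :: "complex ^ 'n ^ 'm"
  show "(r *\<^sub>R a) v* M = r *\<^sub>R (a v* M)"
    by (simp add: vec_eq_iff vector_matrix_mult_def scaleR_sum_right)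
  show "a v* (r *\<^sub>R M) = r *\<^sub>R (a v* M)"
    by (simp add: vec_eq_iff vector_matrix_mult_def scaleR_sum_right)
next
  have "norm (a v* M) \<le> norm a * norm M * (real CARD('n) * real CARD('m))"
    for a :: "complex ^ 'm" and M :: "complex ^ 'n ^ 'm"
  proof -
    have "norm (a v* M) \<le> (\<Sum>j\<in>UNIV. norm ((a v* M) $ j))" by (rule norm_vec_le_sum)
    also have "\<dots> \<le> (\<Sum>j\<in>(UNIV::'n set). \<Sum>i\<in>(UNIV::'m set). norm a * norm M)"
    proof (rule sum_mono)
      fix j :: 'n
      have "norm ((a v* M) $ j) \<le> (\<Sum>i\<in>UNIV. norm (a $ i * M $ i $ j))"
        by (simp add: vector_matrix_mult_def norm_sum)
      also have "\<dots> \<le> (\<Sum>i\<in>(UNIV::'m set). norm a * norm M)"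
      proof (rule sum_mono)
        fix i :: 'm
        have "norm (M $ i $ j) \<le> norm M"
          by (rule order_trans[OF Finite_Cartesian_Product.norm_nth_le Finite_Cartesian_Product.norm_nth_le])
        then show "norm (a $ i * M $ i $ j) \<le> norm a * norm M"
          by (simp add: norm_mult mult_mono Finite_Cartesian_Product.norm_nth_le)
      qed
      finally show "norm ((a v* M) $ j) \<le> (\<Sum>i\<in>(UNIV::'m set). norm a * norm M)" .
    qed
    finally show ?thesis by (simp add: mult_ac)
  qed
  then show "\<exists>K. \<forall>a b. norm ((a :: complex ^ 'm) v* (b :: complex ^ 'n ^ 'm)) \<le> norm a * norm b * K"
    by blast
qed (simp_all add: algebra_simps)

lemmas bounded_linear_vector_matrix_mult =
  bounded_bilinear.bounded_linear_left[OF bounded_bilinear_vector_matrix_mult]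

lemma borel_measurable_bilinear:
  fixes f :: "'a \<Rightarrow> 'b::{second_countable_topology, real_normed_vector}"
    and g :: "'a \<Rightarrow> 'c::{second_countable_topology, real_normed_vector}"
    and h :: "'b \<Rightarrow> 'c \<Rightarrow> 'd::real_normed_vector"
  assumes "bounded_bilinear h" "f \<in> borel_measurable M" "g \<in> borel_measurable M"
  shows "(\<lambda>w. h (f w) (g w)) \<in> borel_measurable M"
  using assms(2,3)
  by (rule borel_measurable_continuous_Pair)
    (intro bounded_bilinear.continuous_on[OF assms(1)] continuous_intros)

lemmas borel_measurable_smult[measurable] = borel_measurable_bilinear[OF bounded_bilinear_smult]
lemmas borel_measurable_vmult[measurable] =
  borel_measurable_bilinear[OF bounded_bilinear_vector_matrix_mult]

lemma hconj_nth[simp]: "hconj M $ i $ j = cnj (M $ j $ i)"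
  by (simp add: hconj_def)

lemma hconj_hconj[simp]: "hconj (hconj M) = M"
  by (simp add: vec_eq_iff)

lemma hconj_matrix_mult: "hconj (M ** N) = hconj N ** hconj M"
  by (simp add: vec_eq_iff matrix_matrix_mult_def mult.commute)

lemma borel_measurable_hconj[measurable]:
  assumes "f \<in> borel_measurable M"
  shows "(\<lambda>w. hconj (f w :: complex ^ 'n ^ 'm)) \<in> borel_measurable M"
proof -
  have "continuous_on UNIV (hconj :: complex ^ 'n ^ 'm \<Rightarrow> _)"
    unfolding hconj_def by (intro continuous_intros)
  from borel_measurable_continuous_on[OF this assms] show ?thesis .
qed

lemma vmult_smult: "(c *s x) v* (M :: complex ^ 'n ^ 'm) = c *s (x v* M)"
  by (rule scalar_vector_matrix_assoc)

lemma vmult_cscale: "x v* (c *\<^sub>m M) = c *s (x v* M)"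
  by (simp add: vec_eq_iff vector_matrix_mult_def cscale_def sum_distrib_left mult_ac)

lemma vmult_uminus: "x v* (- M) = - (x v* (M :: complex ^ 'n ^ 'm))"
  by (simp add: vec_eq_iff vector_matrix_mult_def sum_negf)

lemma uminus_vmult: "(- x) v* M = - (x v* (M :: complex ^ 'n ^ 'm))"
  by (simp add: vec_eq_iff vector_matrix_mult_def sum_negf)

lemma vmult_mat_1[simp]: "x v* mat 1 = (x :: complex ^ 'm)"
  by (simp add: vec_eq_iff vector_matrix_mult_def mat_def if_distrib cong: if_cong)

lemma matrix_eqI_vmult:
  fixes M N :: "complex ^ 'n ^ 'm"
  assumes "\<And>x. x v* M = x v* N"
  shows "M = N"
proof -
  have "M $ i $ j = N $ i $ j" for i j
  proof -
    have "axis i 1 v* M = axis i 1 v* N" by (rule assms)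
    then have "(axis i 1 v* M) $ j = (axis i 1 v* N) $ j" by simp
    then show ?thesis
      by (simp add: vector_matrix_mult_def axis_def if_distrib[of "\<lambda>x. x * _"] cong: if_cong)
  qed
  then show ?thesis by (simp add: vec_eq_iff)
qed

lemma cdot_add_left: "cdot (a + b) c = cdot a c + cdot b c"
  by (simp add: cdot_def algebra_simps sum.distrib)

lemma cdot_add_right: "cdot a (b + c) = cdot a b + cdot a c"
  by (simp add: cdot_def algebra_simps sum.distrib)

lemma cdot_diff_left: "cdot (a - b) c = cdot a c - cdot b c"
  by (simp add: cdot_def algebra_simps sum_subtractf)

lemma cdot_diff_right: "cdot a (b - c) = cdot a b - cdot a c"
  by (simp add: cdot_def algebra_simps sum_subtractf)

lemma cdot_smult_left: "cdot (k *s a) b = k * cdot a b"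
  by (simp add: cdot_def sum_distrib_left mult_ac)

lemma cdot_smult_right: "cdot a (k *s b) = cnj k * cdot a b"
  by (simp add: cdot_def sum_distrib_left mult_ac)

lemma cdot_minus_left: "cdot (- a) b = - cdot a b"
  by (simp add: cdot_def sum_negf)

lemma cdot_zero[simp]: "cdot 0 b = 0" "cdot a 0 = 0"
  by (simp_all add: cdot_def)

lemma cdot_commute: "cdot a b = cnj (cdot b a)"
  by (simp add: cdot_def mult_ac)

lemma cdot_self: "cdot a a = complex_of_real ((norm a)\<^sup>2)"
  by (simp add: cdot_def norm_vec_sq complex_norm_square del: of_real_power)

lemma cdot_cong_0: "(\<And>b. cdot a b = 0) \<Longrightarrow> a = 0"
  using cdot_self[of a] by (metis norm_eq_zero of_real_eq_0_iff zero_eq_power2)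

lemma norm_cdot_le: "norm (cdot a b) \<le> norm a * norm b"
proof -
  have "norm (cdot a b) \<le> (\<Sum>i\<in>UNIV. \<bar>norm (a $ i)\<bar> * \<bar>norm (b $ i)\<bar>)"
    unfolding cdot_def by (rule order_trans[OF norm_sum]) (simp add: norm_mult)
  also have "\<dots> \<le> norm a * norm b"
    unfolding norm_vec_def by (rule L2_set_mult_ineq)
  finally show ?thesis .
qed

lemma cdot_vmult: "cdot (a v* M) b = cdot a (b v* hconj M)"
proof -
  have "cdot (a v* M) b = (\<Sum>j\<in>UNIV. \<Sum>i\<in>UNIV. a $ i * M $ i $ j * cnj (b $ j))"
    by (simp add: cdot_def vector_matrix_mult_def sum_distrib_right)
  also have "\<dots> = (\<Sum>i\<in>UNIV. \<Sum>j\<in>UNIV. a $ i * M $ i $ j * cnj (b $ j))"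
    by (rule sum.swap)
  also have "\<dots> = cdot a (b v* hconj M)"
    by (simp add: cdot_def vector_matrix_mult_def sum_distrib_left mult_ac)
  finally show ?thesis .
qed

lemma cdot_vmult_right: "cdot a (b v* M) = cdot (a v* hconj M) b"
  by (simp add: cdot_vmult)

lemma bounded_bilinear_cdot: "bounded_bilinear (cdot :: complex ^ 'n \<Rightarrow> _)"
proof
  show "\<exists>K. \<forall>a b. norm (cdot a (b :: complex ^ 'n)) \<le> norm a * norm b * K"
    by (intro exI[of _ 1]) (simp add: norm_cdot_le)
qed (simp_all add: cdot_add_left cdot_add_right, simp_all add: cdot_def scaleR_sum_right)

lemmas borel_measurable_cdot[measurable] = borel_measurable_bilinear[OF bounded_bilinear_cdot]

lemma trace_hconj_mult:
  "trace (hconj M ** (M :: complex ^ 'm ^ 'p))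
     = complex_of_real (\<Sum>j\<in>UNIV. \<Sum>i\<in>UNIV. (norm (M $ i $ j))\<^sup>2)"
proof -
  have "trace (hconj M ** M) = (\<Sum>j\<in>UNIV. \<Sum>i\<in>UNIV. cnj (M $ i $ j) * M $ i $ j)"
    by (simp add: trace_def matrix_matrix_mult_def)
  also have "\<dots> = (\<Sum>j\<in>UNIV. \<Sum>i\<in>UNIV. complex_of_real ((norm (M $ i $ j))\<^sup>2))"
    by (simp only: complex_norm_square mult.commute)
  finally show ?thesis by simp
qed

text \<open>The trace is the squared Hilbert-Schmidt norm of M, so Cauchy-Schwarz in each column
  bounds the operator norm by 1. This is where the normalisation of the kernel enters every later
  estimate.\<close>

lemma norm_vmult_le_trace_1:
  assumes "trace (hconj M ** (M :: complex ^ 'm ^ 'p)) = 1"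
  shows "norm (a v* M) \<le> norm a"
proof -
  have F: "(\<Sum>j\<in>UNIV. \<Sum>i\<in>UNIV. (norm (M $ i $ j))\<^sup>2) = 1"
    using assms unfolding trace_hconj_mult using of_real_eq_1_iff by blast
  have "(norm (a v* M))\<^sup>2 = (\<Sum>j\<in>UNIV. (norm (\<Sum>i\<in>UNIV. a $ i * M $ i $ j))\<^sup>2)"
    by (simp add: norm_vec_sq vector_matrix_mult_def)
  also have "\<dots> \<le> (\<Sum>j\<in>UNIV. (norm a)\<^sup>2 * (\<Sum>i\<in>UNIV. (norm (M $ i $ j))\<^sup>2))"
  proof (rule sum_mono)
    fix j
    have "norm (\<Sum>i\<in>UNIV. a $ i * M $ i $ j) \<le> (\<Sum>i\<in>UNIV. \<bar>norm (a $ i)\<bar> * \<bar>norm (M $ i $ j)\<bar>)"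
      by (rule order_trans[OF norm_sum]) (simp add: norm_mult)
    also have "\<dots> \<le> norm a * L2_set (\<lambda>i. norm (M $ i $ j)) UNIV"
      unfolding norm_vec_def by (rule L2_set_mult_ineq)
    finally have "(norm (\<Sum>i\<in>UNIV. a $ i * M $ i $ j))\<^sup>2
        \<le> (norm a * L2_set (\<lambda>i. norm (M $ i $ j)) UNIV)\<^sup>2"
      by (rule power_mono) simp
    then show "(norm (\<Sum>i\<in>UNIV. a $ i * M $ i $ j))\<^sup>2 \<le> (norm a)\<^sup>2 * (\<Sum>i\<in>UNIV. (norm (M $ i $ j))\<^sup>2)"
      by (simp add: power_mult_distrib L2_set_def sum_nonneg)
  qed
  also have "\<dots> = (norm a)\<^sup>2"
    using F by (simp flip: sum_distrib_left)
  finally show ?thesis by (rule power2_le_imp_le) simp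
qed

text \<open>The adjoint of a contraction is a contraction: with b = a M^*, one has |b|^2 = <a, b M>
  \<le> |a| |b|.\<close>

lemma norm_vmult_hconj_le_trace_1:
  assumes "trace (hconj M ** (M :: complex ^ 'm ^ 'p)) = 1"
  shows "norm (a v* hconj M) \<le> norm a"
proof -
  let ?b = "a v* hconj M"
  have "(norm ?b)\<^sup>2 = norm (cdot ?b ?b)" by (simp add: cdot_self norm_power)
  also have "\<dots> = norm (cdot a (?b v* M))" by (simp add: cdot_vmult)
  also have "\<dots> \<le> norm a * norm ?b"
    by (rule order_trans[OF norm_cdot_le mult_left_mono[OF norm_vmult_le_trace_1[OF assms]]]) simp
  finally show ?thesis
    by (metis mult_right_le_imp_le norm_ge_zero order_le_less power2_eq_square zero_le_power2 norm_zero)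
qed

section \<open>The space \<open>H\<close>\<close>

lemma finite_measure_\<Delta>: "finite_measure (\<Delta> l)"
  by (intro finite_measureI) (simp add: emeasure_restrict_space emeasure_lborel_Icc_eq)

lemma sigma_finite_\<Delta>: "sigma_finite_measure (\<Delta> l)"
  using finite_measure_\<Delta> by (simp add: finite_measure_def)

lemma id_measurable_\<Delta>[measurable]: "(\<lambda>w. w) \<in> borel_measurable (\<Delta> l)"
  by (intro measurable_restrict_space1 measurable_completion) simp

lemma integrable_\<Delta>_bounded:
  fixes f :: "real \<Rightarrow> 'a::{banach, second_countable_topology}"
  assumes "f \<in> borel_measurable (\<Delta> l)" "\<And>w. w \<in> {-l..l} \<Longrightarrow> norm (f w) \<le> C"
  shows "integrable (\<Delta> l) f"
  using assms by (intro finite_measure.integrable_const_bound[OF finite_measure_\<Delta>, of f C])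
    (auto intro!: AE_I2)

lemma H_measurable: "f \<in> H l \<Longrightarrow> f \<in> borel_measurable (\<Delta> l)"
  by (simp add: H_def)

lemma H_sq_integrable: "f \<in> H l \<Longrightarrow> integrable (\<Delta> l) (\<lambda>w. (norm (f w))\<^sup>2)"
  by (simp add: H_def)

lemma HI_bound:
  fixes f :: "real \<Rightarrow> complex ^ 'p" and g :: "real \<Rightarrow> complex ^ 'q"
  assumes "f \<in> borel_measurable (\<Delta> l)" "g \<in> H l"
    and "\<And>w. w \<in> {-l..l} \<Longrightarrow> norm (f w) \<le> C * norm (g w)"
  shows "f \<in> H l"
proof -
  have "integrable (\<Delta> l) (\<lambda>w. (norm (f w))\<^sup>2)"
  proof (rule Bochner_Integration.integrable_bound)
    show "integrable (\<Delta> l) (\<lambda>w. C\<^sup>2 * (norm (g w))\<^sup>2)" using H_sq_integrable[OF assms(2)] by simp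
    show "(\<lambda>w. (norm (f w))\<^sup>2) \<in> borel_measurable (\<Delta> l)" using assms(1) by measurable
    show "AE w in \<Delta> l. norm ((norm (f w))\<^sup>2) \<le> norm (C\<^sup>2 * (norm (g w))\<^sup>2)"
    proof (rule AE_I2)
      fix w assume "w \<in> space (\<Delta> l)"
      then have "(norm (f w))\<^sup>2 \<le> (C * norm (g w))\<^sup>2"
        using assms(3) by (intro power_mono) auto
      then show "norm ((norm (f w))\<^sup>2) \<le> norm (C\<^sup>2 * (norm (g w))\<^sup>2)"
        by (simp add: power_mult_distrib abs_mult)
    qed
  qed
  with assms(1) show ?thesis by (simp add: H_def)
qed

lemma HI_bounded:
  fixes f :: "real \<Rightarrow> complex ^ 'p"
  assumes "f \<in> borel_measurable (\<Delta> l)" "\<And>w. w \<in> {-l..l} \<Longrightarrow> norm (f w) \<le> C"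
  shows "f \<in> H l"
proof -
  have "integrable (\<Delta> l) (\<lambda>w. (norm (f w))\<^sup>2)"
  proof (rule integrable_\<Delta>_bounded)
    show "(\<lambda>w. (norm (f w))\<^sup>2) \<in> borel_measurable (\<Delta> l)" using assms(1) by measurable
    show "norm ((norm (f w))\<^sup>2) \<le> C\<^sup>2" if "w \<in> {-l..l}" for w
      using assms(2)[OF that] by (simp add: power_mono)
  qed
  with assms(1) show ?thesis by (simp add: H_def)
qed

lemma H_add: assumes "f \<in> H l" "g \<in> H l" shows "(\<lambda>w. f w + g w) \<in> H l"
proof -
  note [measurable] = H_measurable[OF assms(1)] H_measurable[OF assms(2)]
  have "integrable (\<Delta> l) (\<lambda>w. (norm (f w + g w))\<^sup>2)"
  proof (rule Bochner_Integration.integrable_bound)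
    show "integrable (\<Delta> l) (\<lambda>w. 2 * (norm (f w))\<^sup>2 + 2 * (norm (g w))\<^sup>2)"
      using H_sq_integrable[OF assms(1)] H_sq_integrable[OF assms(2)] by simp
    show "AE w in \<Delta> l. norm ((norm (f w + g w))\<^sup>2) \<le> norm (2 * (norm (f w))\<^sup>2 + 2 * (norm (g w))\<^sup>2)"
    proof (rule AE_I2)
      fix w
      have "(norm (f w + g w))\<^sup>2 \<le> (norm (f w) + norm (g w))\<^sup>2"
        by (rule power_mono) (auto intro: norm_triangle_ineq)
      also have "\<dots> \<le> 2 * (norm (f w))\<^sup>2 + 2 * (norm (g w))\<^sup>2"
        using zero_le_power2[of "norm (f w) - norm (g w)"] by (simp add: power2_eq_square algebra_simps)
      finally show "norm ((norm (f w + g w))\<^sup>2) \<le> norm (2 * (norm (f w))\<^sup>2 + 2 * (norm (g w))\<^sup>2)"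
        by simp
    qed
  qed measurable
  then show ?thesis unfolding H_def by simp
qed

lemma H_smult: "f \<in> H l \<Longrightarrow> (\<lambda>w. c *s f w) \<in> H l"
  by (rule HI_bound[where C = "norm c" and g = f]) (auto simp: norm_smult dest: H_measurable)

lemma H_lin: "f \<in> H l \<Longrightarrow> g \<in> H l \<Longrightarrow> (\<lambda>w. c *s f w + d *s g w) \<in> H l"
  by (intro H_add H_smult)

lemma H_diff: "f \<in> H l \<Longrightarrow> g \<in> H l \<Longrightarrow> (\<lambda>w. f w - g w) \<in> H l"
  using H_lin[of f l g 1 "-1"] by (simp add: vector_sneg_minus1[symmetric])

lemma H_zero: "(\<lambda>w. 0) \<in> H l"
  by (rule HI_bounded[where C = 0]) auto

lemma H_mult_id: "f \<in> H l \<Longrightarrow> (\<lambda>w. complex_of_real w *s f w) \<in> H l"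
  by (rule HI_bound[where C = "\<bar>l\<bar>" and g = f])
     (auto simp: norm_smult intro!: mult_right_mono dest: H_measurable)

lemma H_integrable_norm: assumes "f \<in> H l" shows "integrable (\<Delta> l) (\<lambda>w. norm (f w))"
proof (rule Bochner_Integration.integrable_bound)
  note [measurable] = H_measurable[OF assms]
  show "integrable (\<Delta> l) (\<lambda>w. 1 + (norm (f w))\<^sup>2)"
    using H_sq_integrable[OF assms] finite_measure.integrable_const[OF finite_measure_\<Delta>] by simp
  show "(\<lambda>w. norm (f w)) \<in> borel_measurable (\<Delta> l)" by measurable
  show "AE w in \<Delta> l. norm (norm (f w)) \<le> norm (1 + (norm (f w))\<^sup>2)"
  proof (rule AE_I2)
    fix w show "norm (norm (f w)) \<le> norm (1 + (norm (f w))\<^sup>2)"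
      using zero_le_power2[of "norm (f w) - 1/2"] by (simp add: power2_eq_square algebra_simps)
  qed
qed

lemma H_integrable: "f \<in> H l \<Longrightarrow> integrable (\<Delta> l) f"
  by (simp add: H_integrable_norm H_measurable integrable_norm_cancel)

lemma integrable_norm_mult_H:
  fixes f :: "real \<Rightarrow> complex ^ 'p" and g :: "real \<Rightarrow> complex ^ 'q"
  assumes "f \<in> H l" "g \<in> H l" shows "integrable (\<Delta> l) (\<lambda>w. norm (f w) * norm (g w))"
proof (rule Bochner_Integration.integrable_bound)
  note [measurable] = H_measurable[OF assms(1)] H_measurable[OF assms(2)]
  show "integrable (\<Delta> l) (\<lambda>w. (norm (f w))\<^sup>2 + (norm (g w))\<^sup>2)"
    using H_sq_integrable[OF assms(1)] H_sq_integrable[OF assms(2)] by simp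
  show "(\<lambda>w. norm (f w) * norm (g w)) \<in> borel_measurable (\<Delta> l)" by measurable
  show "AE w in \<Delta> l. norm (norm (f w) * norm (g w)) \<le> norm ((norm (f w))\<^sup>2 + (norm (g w))\<^sup>2)"
  proof (rule AE_I2)
    fix w
    have "norm (f w) * norm (g w) \<le> (norm (f w))\<^sup>2 + (norm (g w))\<^sup>2"
      using zero_le_power2[of "norm (f w) - norm (g w)"] zero_le_power2[of "norm (f w)"]
        zero_le_power2[of "norm (g w)"] unfolding power2_diff by linarith
    then show "norm (norm (f w) * norm (g w)) \<le> norm ((norm (f w))\<^sup>2 + (norm (g w))\<^sup>2)" by simp
  qed
qed

lemma integrable_cdot:
  assumes "f \<in> H l" "g \<in> H l" shows "integrable (\<Delta> l) (\<lambda>w. cdot (f w) (g w))"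
proof (rule Bochner_Integration.integrable_bound[OF integrable_norm_mult_H[OF assms]])
  show "(\<lambda>w. cdot (f w) (g w)) \<in> borel_measurable (\<Delta> l)"
    using assms by (auto dest!: H_measurable intro: borel_measurable_cdot)
  show "AE w in \<Delta> l. norm (cdot (f w) (g w)) \<le> norm (norm (f w) * norm (g w))"
    by (rule AE_I2) (simp add: norm_cdot_le)
qed

lemma innerH_add_left:
  "f \<in> H l \<Longrightarrow> g \<in> H l \<Longrightarrow> h \<in> H l \<Longrightarrow> innerH l (\<lambda>w. f w + g w) h = innerH l f h + innerH l g h"
  by (simp add: innerH_def cdot_add_left integrable_cdot)

lemma innerH_diff_left:
  "f \<in> H l \<Longrightarrow> g \<in> H l \<Longrightarrow> h \<in> H l \<Longrightarrow> innerH l (\<lambda>w. f w - g w) h = innerH l f h - innerH l g h"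
  by (simp add: innerH_def cdot_diff_left integrable_cdot)

lemma innerH_smult_left: "innerH l (\<lambda>w. c *s f w) h = c * innerH l f h"
  by (simp add: innerH_def cdot_smult_left)

lemma innerH_commute: "innerH l f g = cnj (innerH l g f)"
  unfolding innerH_def by (subst cdot_commute) simp

lemma innerH_add_right:
  "f \<in> H l \<Longrightarrow> g \<in> H l \<Longrightarrow> h \<in> H l \<Longrightarrow> innerH l h (\<lambda>w. f w + g w) = innerH l h f + innerH l h g"
  by (simp add: innerH_def cdot_add_right integrable_cdot)

lemma innerH_diff_right:
  "f \<in> H l \<Longrightarrow> g \<in> H l \<Longrightarrow> h \<in> H l \<Longrightarrow> innerH l h (\<lambda>w. f w - g w) = innerH l h f - innerH l h g"
  by (simp add: innerH_def cdot_diff_right integrable_cdot)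

lemma innerH_smult_right: "innerH l h (\<lambda>w. c *s f w) = cnj c * innerH l h f"
  by (simp add: innerH_def cdot_smult_right)

lemma innerH_self: "innerH l f f = complex_of_real (LINT w|\<Delta> l. (norm (f w))\<^sup>2)"
  by (simp add: innerH_def cdot_self flip: of_real_power)

lemma normH_sq: "(normH l f)\<^sup>2 = (LINT w|\<Delta> l. (norm (f w))\<^sup>2)"
  by (simp add: normH_def)

lemma normH_nonneg[simp]: "0 \<le> normH l f"
  by (simp add: normH_def)

lemma eqH_refl[simp]: "eqH l f f"
  by (simp add: eqH_def)

lemma eqH_sym: "eqH l f g \<Longrightarrow> eqH l g f"
  unfolding eqH_def by (auto elim: eventually_mono)

lemma eqH_trans: "eqH l f g \<Longrightarrow> eqH l g h \<Longrightarrow> eqH l f h"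
  unfolding eqH_def by (auto elim: eventually_elim2)

lemma eqH_lin: "eqH l f f' \<Longrightarrow> eqH l g g' \<Longrightarrow>
  eqH l (\<lambda>w. c *s f w + d *s g w) (\<lambda>w. c *s f' w + d *s g' w)"
  unfolding eqH_def by (auto elim: eventually_elim2)

lemma eqH_diff_iff: "eqH l (\<lambda>w. f w - g w) (\<lambda>w. 0) \<longleftrightarrow> eqH l f g"
  unfolding eqH_def by simp

lemma eqH_pointwise: "(\<And>w. w \<in> {-l..l} \<Longrightarrow> f w = g w) \<Longrightarrow> eqH l f g"
  unfolding eqH_def by (rule AE_I2) simp

lemma innerH_cong:
  assumes "f \<in> H l" "f' \<in> H l" "g \<in> H l" "g' \<in> H l" "eqH l f f'" "eqH l g g'"
  shows "innerH l f g = innerH l f' g'"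
  unfolding innerH_def
proof (rule integral_cong_AE)
  show "AE w in \<Delta> l. cdot (f w) (g w) = cdot (f' w) (g' w)"
    using assms(5,6) unfolding eqH_def by (auto elim: eventually_elim2)
qed (use assms in \<open>auto dest!: H_measurable intro: borel_measurable_cdot\<close>)

lemma normH_cong:
  assumes "f \<in> H l" "f' \<in> H l" "eqH l f f'"
  shows "normH l f = normH l f'"
  using innerH_cong[OF assms(1,2,1,2,3,3)] by (simp add: innerH_self normH_def)

lemma normH_eq_0_iff: assumes "f \<in> H l" shows "normH l f = 0 \<longleftrightarrow> eqH l f (\<lambda>w. 0)"
proof -
  have "normH l f = 0 \<longleftrightarrow> (LINT w|\<Delta> l. (norm (f w))\<^sup>2) = 0" by (simp add: normH_def)
  also have "\<dots> \<longleftrightarrow> (AE w in \<Delta> l. (norm (f w))\<^sup>2 = 0)"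
    by (rule integral_nonneg_eq_0_iff_AE[OF H_sq_integrable[OF assms]]) simp
  finally show ?thesis by (simp add: eqH_def)
qed

text \<open>Cauchy-Schwarz, from the integral of (t |f| - |g|)^2 being nonnegative for every real t.
  The two functions may take values in spaces of different dimension, so that one of them can be the
  scalar constant \<open>one_H\<close>.\<close>

lemma integral_norm_mult_le:
  fixes f :: "real \<Rightarrow> complex ^ 'p" and g :: "real \<Rightarrow> complex ^ 'q"
  assumes "f \<in> H l" "g \<in> H l"
  shows "(LINT w|\<Delta> l. norm (f w) * norm (g w)) \<le> normH l f * normH l g"
proof -
  define a b where "a = normH l f" and "b = normH l g"
  let ?I = "LINT w|\<Delta> l. norm (f w) * norm (g w)"
  have I: "2 * t * ?I \<le> t\<^sup>2 * a\<^sup>2 + b\<^sup>2" for t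
  proof -
    have "2 * t * ?I = (LINT w|\<Delta> l. 2 * t * (norm (f w) * norm (g w)))" by simp
    also have "\<dots> \<le> (LINT w|\<Delta> l. t\<^sup>2 * (norm (f w))\<^sup>2 + (norm (g w))\<^sup>2)"
    proof (rule integral_mono)
      fix w
      show "2 * t * (norm (f w) * norm (g w)) \<le> t\<^sup>2 * (norm (f w))\<^sup>2 + (norm (g w))\<^sup>2"
        using zero_le_power2[of "t * norm (f w) - norm (g w)"]
        by (simp add: power2_diff power_mult_distrib mult_ac)
    qed (use assms in \<open>simp_all add: integrable_norm_mult_H H_sq_integrable\<close>)
    also have "\<dots> = t\<^sup>2 * a\<^sup>2 + b\<^sup>2"
      using assms by (simp add: a_def b_def normH_sq H_sq_integrable)
    finally show ?thesis .
  qed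
  have ab: "0 \<le> a" "0 \<le> b" by (simp_all add: a_def b_def)
  have "?I \<le> a * b"
  proof (cases "a = 0")
    case True
    have "?I \<le> 0"
    proof (rule ccontr)
      assume *: "\<not> ?I \<le> 0"
      \<comment> \<open>For a = 0 the inequality is linear in t, so a large t contradicts a positive
        left side; this t makes the contradiction 2 (b^2 + 1) \<le> b^2.\<close>
      then have "2 * ((b\<^sup>2 + 1) / ?I) * ?I \<le> b\<^sup>2" using I[of "(b\<^sup>2 + 1) / ?I"] True by simp
      then have "2 * (b\<^sup>2 + 1) \<le> b\<^sup>2" using * by simp
      then show False using zero_le_power2[of b] by (smt (verit))
    qed
    then show ?thesis using True by simp
  next
    case False
    then have "a > 0" using ab by simp
    then have "2 * (b / a) * ?I \<le> b\<^sup>2 + b\<^sup>2" using I[of "b / a"] by (simp add: power_divide)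
    then have *: "b * ?I \<le> b * (a * b)" using \<open>a > 0\<close> by (simp add: field_simps power2_eq_square)
    show ?thesis
    proof (cases "b = 0")
      case True
      have "?I \<le> 0"
      proof (rule ccontr)
        assume **: "\<not> ?I \<le> 0"
        have "2 * (?I / a\<^sup>2) * ?I \<le> (?I / a\<^sup>2)\<^sup>2 * a\<^sup>2" using I[of "?I / a\<^sup>2"] True by simp
        then have "?I * ?I \<le> 0" using \<open>a > 0\<close> by (simp add: power2_eq_square field_simps)
        then show False using ** by (simp add: mult_le_0_iff)
      qed
      then show ?thesis using True by simp
    next
      case False
      then show ?thesis using * ab by simp
    qed
  qed
  then show ?thesis by (simp add: a_def b_def)
qed

lemma norm_innerH_le:
  assumes "f \<in> H l" "g \<in> H l"
  shows "norm (innerH l f g) \<le> normH l f * normH l g"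
proof -
  have "norm (innerH l f g) \<le> (LINT w|\<Delta> l. norm (cdot (f w) (g w)))"
    unfolding innerH_def by (rule integral_norm_bound)
  also have "\<dots> \<le> (LINT w|\<Delta> l. norm (f w) * norm (g w))"
    by (intro integral_mono integrable_norm integrable_cdot integrable_norm_mult_H assms norm_cdot_le)
  finally show ?thesis using integral_norm_mult_le[OF assms] by linarith
qed

lemma normH_add_le:
  assumes "f \<in> H l" "g \<in> H l"
  shows "normH l (\<lambda>w. f w + g w) \<le> normH l f + normH l g"
proof -
  let ?s = "\<lambda>w. f w + g w"
  have s: "?s \<in> H l" by (rule H_add[OF assms])
  have sq: "Re (innerH l h h) = (normH l h)\<^sup>2" for h :: "real \<Rightarrow> complex ^ 'a"
    by (simp add: innerH_self normH_sq)
  have "(normH l ?s)\<^sup>2 = Re (innerH l f ?s) + Re (innerH l g ?s)"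
    using innerH_add_left[OF assms s] sq[of ?s] by simp
  also have "\<dots> \<le> normH l f * normH l ?s + normH l g * normH l ?s"
    using norm_innerH_le[OF assms(1) s] norm_innerH_le[OF assms(2) s]
      complex_Re_le_cmod[of "innerH l f ?s"] complex_Re_le_cmod[of "innerH l g ?s"] by linarith
  finally have "normH l ?s * normH l ?s \<le> (normH l f + normH l g) * normH l ?s"
    by (simp add: power2_eq_square algebra_simps)
  then show ?thesis
    using normH_nonneg[of l f] normH_nonneg[of l g] normH_nonneg[of l ?s]
    by (cases "normH l ?s = 0") auto
qed

lemma eqH_zero_if_innerH:
  assumes "f \<in> H l" "\<And>g. g \<in> H l \<Longrightarrow> innerH l f g = 0"
  shows "eqH l f (\<lambda>w. 0)"
proof -
  have "normH l f = 0"
    using assms(2)[OF assms(1)] by (simp add: innerH_self normH_def)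
  then show ?thesis using normH_eq_0_iff[OF assms(1)] by simp
qed

lemma eqH_if_innerH:
  assumes "f \<in> H l" "g \<in> H l" "\<And>h. h \<in> H l \<Longrightarrow> innerH l f h = innerH l g h"
  shows "eqH l f g"
  using eqH_zero_if_innerH[OF H_diff[OF assms(1,2)]] assms by (simp add: innerH_diff_left eqH_diff_iff)

section \<open>Indefinite integrals\<close>

text \<open>The indefinite integral from -l, written as a cut-off inside one fixed integral over the
  interval. It is thereby defined for all real w, is constant outside [-l,l], and all integrability
  questions live on a single measure space.\<close>

definition cum :: "real \<Rightarrow> (real \<Rightarrow> 'a::{banach, second_countable_topology}) \<Rightarrow> real \<Rightarrow> 'a" where
  "cum l h w = (LINT \<xi>|\<Delta> l. indicator {..w} \<xi> *\<^sub>R h \<xi>)"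

lemma indicator_measurable_\<Delta>[measurable]: "(indicator {..w} :: real \<Rightarrow> real) \<in> borel_measurable (\<Delta> l)"
  by (intro measurable_restrict_space1 measurable_completion) simp

lemma integrable_indicator_cut:
  fixes h :: "real \<Rightarrow> 'a::{banach, second_countable_topology}"
  assumes "integrable (\<Delta> l) h"
  shows "integrable (\<Delta> l) (\<lambda>\<xi>. indicator {..w} \<xi> *\<^sub>R h \<xi>)"
  by (rule Bochner_Integration.integrable_bound[OF assms])
     (use assms in measurable, rule AE_I2, simp add: indicator_def)

lemma cum_add: "integrable (\<Delta> l) h \<Longrightarrow> integrable (\<Delta> l) k \<Longrightarrow>
    cum l (\<lambda>\<xi>. h \<xi> + k \<xi>) w = cum l h w + cum l k w"
  by (simp add: cum_def scaleR_add_right integrable_indicator_cut)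

lemma cum_diff: "integrable (\<Delta> l) h \<Longrightarrow> integrable (\<Delta> l) k \<Longrightarrow>
    cum l (\<lambda>\<xi>. h \<xi> - k \<xi>) w = cum l h w - cum l k w"
  by (simp add: cum_def scaleR_diff_right integrable_indicator_cut)

lemma cum_bounded_linear:
  assumes "bounded_linear T" "integrable (\<Delta> l) h"
  shows "cum l (\<lambda>\<xi>. T (h \<xi>)) w = T (cum l h w)"
  unfolding cum_def integral_bounded_linear[OF assms(1) integrable_indicator_cut[OF assms(2)], symmetric]
  by (simp only: linear_simps(5)[OF assms(1)])

lemma cum_cong_AE:
  assumes "integrable (\<Delta> l) h" "integrable (\<Delta> l) k" "AE \<xi> in \<Delta> l. h \<xi> = k \<xi>"
  shows "cum l h w = cum l k w"
  unfolding cum_def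
proof (rule integral_cong_AE)
  show "AE \<xi> in \<Delta> l. indicator {..w} \<xi> *\<^sub>R h \<xi> = indicator {..w} \<xi> *\<^sub>R k \<xi>"
    using assms(3) by eventually_elim simp
qed (intro borel_measurable_integrable integrable_indicator_cut assms)+

lemma cum_mono:
  fixes h k :: "real \<Rightarrow> real"
  assumes "integrable (\<Delta> l) h" "integrable (\<Delta> l) k" "AE \<xi> in \<Delta> l. h \<xi> \<le> k \<xi>"
  shows "cum l h w \<le> cum l k w"
  unfolding cum_def
  by (rule integral_mono_AE[OF integrable_indicator_cut[OF assms(1)] integrable_indicator_cut[OF assms(2)]])
     (use assms(3) in eventually_elim, simp add: indicator_def)

lemma norm_cum_le:
  "integrable (\<Delta> l) h \<Longrightarrow> norm (cum l h w) \<le> cum l (\<lambda>\<xi>. norm (h \<xi>)) w"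
  unfolding cum_def by (rule order_trans[OF integral_norm_bound]) simp

lemma cum_le_integral:
  fixes h :: "real \<Rightarrow> real"
  assumes "integrable (\<Delta> l) h" "\<And>\<xi>. 0 \<le> h \<xi>"
  shows "cum l h w \<le> (LINT \<xi>|\<Delta> l. h \<xi>)"
  unfolding cum_def
  by (rule integral_mono[OF integrable_indicator_cut[OF assms(1)] assms(1)])
     (simp add: indicator_def assms(2))

lemma cum_end: "l \<le> w \<Longrightarrow> cum l h w = (LINT \<xi>|\<Delta> l. h \<xi>)"
  unfolding cum_def by (rule Bochner_Integration.integral_cong) auto

lemma AE_\<Delta>_neq: "AE \<xi> in \<Delta> l. \<xi> \<noteq> w"
proof -
  have "AE \<xi> in lebesgue. \<xi> \<noteq> w" by (intro AE_completion AE_lborel_singleton)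
  then show ?thesis by (simp add: AE_restrict_space_iff) (auto elim: eventually_mono)
qed

text \<open>Dominated convergence: as the cut moves to w, the cut-off functions converge at every
  point other than w itself, a null set.\<close>

lemma continuous_cum:
  assumes "integrable (\<Delta> l) h"
  shows "continuous_on UNIV (cum l h)"
proof (rule continuous_at_imp_continuous_on, rule ballI)
  fix w
  show "isCont (cum l h) w"
    unfolding continuous_at_sequentially comp_def
  proof (intro allI impI)
    fix x assume x: "x \<longlonglongrightarrow> w"
    show "(\<lambda>n. cum l h (x n)) \<longlonglongrightarrow> cum l h w"
      unfolding cum_def
    proof (rule integral_dominated_convergence[where w = "\<lambda>\<xi>. norm (h \<xi>)"])
      show "AE \<xi> in \<Delta> l. (\<lambda>n. indicator {..x n} \<xi> *\<^sub>R h \<xi>) \<longlonglongrightarrow> indicator {..w} \<xi> *\<^sub>R h \<xi>"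
        using AE_\<Delta>_neq[where l = l and w = w]
      proof eventually_elim
        fix \<xi> assume "\<xi> \<noteq> w"
        have "\<forall>\<^sub>F n in sequentially. indicator {..x n} \<xi> *\<^sub>R h \<xi> = indicator {..w} \<xi> *\<^sub>R h \<xi>"
        proof (cases "\<xi> < w")
          case True
          show ?thesis using order_tendstoD(1)[OF x True]
            by eventually_elim (use True in \<open>simp add: indicator_def\<close>)
        next
          case False
          then have "w < \<xi>" using \<open>\<xi> \<noteq> w\<close> by simp
          show ?thesis using order_tendstoD(2)[OF x \<open>w < \<xi>\<close>]
            by eventually_elim (use \<open>w < \<xi>\<close> in \<open>simp add: indicator_def\<close>)
        qed
        then show "(\<lambda>n. indicator {..x n} \<xi> *\<^sub>R h \<xi>) \<longlonglongrightarrow> indicator {..w} \<xi> *\<^sub>R h \<xi>"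
          by (rule tendsto_eventually)
      qed
      show "(\<lambda>\<xi>. indicator {..w} \<xi> *\<^sub>R h \<xi>) \<in> borel_measurable (\<Delta> l)"
        by (rule borel_measurable_integrable[OF integrable_indicator_cut[OF assms]])
      show "(\<lambda>\<xi>. indicator {..x n} \<xi> *\<^sub>R h \<xi>) \<in> borel_measurable (\<Delta> l)" for n
        by (rule borel_measurable_integrable[OF integrable_indicator_cut[OF assms]])
      show "integrable (\<Delta> l) (\<lambda>\<xi>. norm (h \<xi>))" using assms by (rule integrable_norm)
      show "AE \<xi> in \<Delta> l. norm (indicator {..x n} \<xi> *\<^sub>R h \<xi>) \<le> norm (h \<xi>)" for n
        by (rule AE_I2) (simp add: indicator_def)
    qed
  qed
qed

lemma borel_measurable_continuous_\<Delta>: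
  fixes f :: "real \<Rightarrow> 'a::{second_countable_topology, real_normed_vector}"
  assumes "continuous_on UNIV f" shows "f \<in> borel_measurable (\<Delta> l)"
  using borel_measurable_continuous_on[OF assms id_measurable_\<Delta>] by simp

lemma cum_bounded:
  assumes "integrable (\<Delta> l) h"
  shows "norm (cum l h w) \<le> (LINT \<xi>|\<Delta> l. norm (h \<xi>))"
  by (rule order_trans[OF norm_cum_le[OF assms] cum_le_integral[OF integrable_norm[OF assms]]]) simp

lemma integrable_mult_bounded:
  fixes h g :: "real \<Rightarrow> complex"
  assumes "integrable (\<Delta> l) h" "g \<in> borel_measurable (\<Delta> l)" "\<And>w. norm (g w) \<le> C"
  shows "integrable (\<Delta> l) (\<lambda>w. h w * g w)"
proof (rule Bochner_Integration.integrable_bound)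
  show "integrable (\<Delta> l) (\<lambda>w. C * norm (h w))" using assms(1) by simp
  show "(\<lambda>w. h w * g w) \<in> borel_measurable (\<Delta> l)" using assms by measurable
  show "AE w in \<Delta> l. norm (h w * g w) \<le> norm (C * norm (h w))"
  proof (rule AE_I2)
    fix w
    have "norm (h w) * norm (g w) \<le> norm (h w) * C" by (intro mult_left_mono assms) simp
    then show "norm (h w * g w) \<le> norm (C * norm (h w))"
      by (simp add: norm_mult mult.commute)
  qed
qed

lemma integrable_mult_cum:
  fixes h k :: "real \<Rightarrow> complex"
  assumes "integrable (\<Delta> l) h" "integrable (\<Delta> l) k"
  shows "integrable (\<Delta> l) (\<lambda>w. h w * cum l k w)"
  using assms(1) borel_measurable_continuous_\<Delta>[OF continuous_cum[OF assms(2)]] cum_bounded[OF assms(2)]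
  by (rule integrable_mult_bounded)

text \<open>Fubini on the square \<open>{..w} \<times> {..w}\<close>, cut along the diagonal.\<close>

lemma cum_mult:
  fixes h k :: "real \<Rightarrow> complex"
  assumes h: "integrable (\<Delta> l) h" and k: "integrable (\<Delta> l) k"
  shows "cum l h w * cum l k w = cum l (\<lambda>\<xi>. h \<xi> * cum l k \<xi> + cum l h \<xi> * k \<xi>) w"
proof -
  interpret pair_sigma_finite "\<Delta> l" "\<Delta> l"
    by (intro pair_sigma_finite.intro sigma_finite_\<Delta>)
  define a where "a = (\<lambda>\<xi>. indicator {..w} \<xi> *\<^sub>R h \<xi>)"
  define b where "b = (\<lambda>\<xi>. indicator {..w} \<xi> *\<^sub>R k \<xi>)"
  have a: "integrable (\<Delta> l) a" and b: "integrable (\<Delta> l) b"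
    using integrable_indicator_cut[OF h] integrable_indicator_cut[OF k] by (simp_all add: a_def b_def)
  note [measurable] = borel_measurable_integrable[OF a] borel_measurable_integrable[OF b]
  have ab: "integrable (\<Delta> l \<Otimes>\<^sub>M \<Delta> l) (\<lambda>(x, y). a x * b y)"
  proof (rule Fubini_integrable)
    show "(\<lambda>(x, y). a x * b y) \<in> borel_measurable (\<Delta> l \<Otimes>\<^sub>M \<Delta> l)" by measurable
    show "integrable (\<Delta> l) (\<lambda>x. LINT y|\<Delta> l. norm (case (x, y) of (x, y) \<Rightarrow> a x * b y))"
      using a by (simp add: norm_mult)
    show "AE x in \<Delta> l. integrable (\<Delta> l) (\<lambda>y. case (x, y) of (x, y) \<Rightarrow> a x * b y)"
      using b by simp
  qed
  \<comment> \<open>The open triangle is chosen so that its complement is cut exactly by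
    \<open>{..x}\<close>; on the triangle itself the cut \<open>{..y}\<close> differs only in the
    diagonal point, which is why only that half needs an argument up to null sets.\<close>
  define T where "T = {p :: real \<times> real. fst p < snd p}"
  have T[measurable]: "(indicator T :: _ \<Rightarrow> real) \<in> borel_measurable (\<Delta> l \<Otimes>\<^sub>M \<Delta> l)"
  proof -
    have "{p \<in> space (\<Delta> l \<Otimes>\<^sub>M \<Delta> l). fst p < snd p} \<in> sets (\<Delta> l \<Otimes>\<^sub>M \<Delta> l)"
      by measurable
    moreover have "T \<inter> space (\<Delta> l \<Otimes>\<^sub>M \<Delta> l) = {p \<in> space (\<Delta> l \<Otimes>\<^sub>M \<Delta> l). fst p < snd p}"
      unfolding T_def by blast
    ultimately show ?thesis
      unfolding borel_measurable_indicator_iff by simp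
  qed
  have abT: "integrable (\<Delta> l \<Otimes>\<^sub>M \<Delta> l) (\<lambda>(x, y). indicator T (x, y) *\<^sub>R (a x * b y))"
  proof (rule Bochner_Integration.integrable_bound[OF ab])
    show "(\<lambda>(x, y). indicator T (x, y) *\<^sub>R (a x * b y)) \<in> borel_measurable (\<Delta> l \<Otimes>\<^sub>M \<Delta> l)"
      by measurable
  qed (auto simp: indicator_def)
  have upper: "(LINT x|\<Delta> l. LINT y|\<Delta> l. indicator T (x, y) *\<^sub>R (a x * b y))
      = (LINT y|\<Delta> l. indicator {..w} y *\<^sub>R (cum l h y * k y))"
  proof -
    have "(LINT x|\<Delta> l. LINT y|\<Delta> l. indicator T (x, y) *\<^sub>R (a x * b y))
        = (LINT y|\<Delta> l. LINT x|\<Delta> l. indicator T (x, y) *\<^sub>R (a x * b y))"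
      using Fubini_integral[of "\<lambda>x y. indicator T (x, y) *\<^sub>R (a x * b y)"] abT by simp
    also have "\<dots> = (LINT y|\<Delta> l. indicator {..w} y *\<^sub>R (cum l h y * k y))"
    proof (rule Bochner_Integration.integral_cong[OF refl])
      fix y
      have "(LINT x|\<Delta> l. indicator T (x, y) *\<^sub>R (a x * b y)) = (LINT x|\<Delta> l. (indicator {..y} x *\<^sub>R h x) * b y)"
      proof (rule integral_cong_AE)
        show "AE x in \<Delta> l. indicator T (x, y) *\<^sub>R (a x * b y) = (indicator {..y} x *\<^sub>R h x) * b y"
          using AE_\<Delta>_neq[where l = l and w = y]
          by eventually_elim (auto simp: T_def a_def b_def indicator_def)
        have [measurable]: "(\<lambda>x. indicator T (x, y) :: real) \<in> borel_measurable (\<Delta> l)"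
        proof -
          have "{x \<in> space (\<Delta> l). x < y} \<in> sets (\<Delta> l)" by measurable
          moreover have "{x. x < y} \<inter> space (\<Delta> l) = {x \<in> space (\<Delta> l). x < y}" by blast
          ultimately have "(indicator {x. x < y} :: real \<Rightarrow> real) \<in> borel_measurable (\<Delta> l)"
            unfolding borel_measurable_indicator_iff by simp
          moreover have "(\<lambda>x. indicator T (x, y) :: real) = indicator {x. x < y}"
            by (auto simp: T_def indicator_def)
          ultimately show ?thesis by simp
        qed
        show "(\<lambda>x. indicator T (x, y) *\<^sub>R (a x * b y)) \<in> borel_measurable (\<Delta> l)" by measurable
        show "(\<lambda>x. (indicator {..y} x *\<^sub>R h x) * b y) \<in> borel_measurable (\<Delta> l)"
          using integrable_indicator_cut[OF h, of y] by measurable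
      qed
      also have "\<dots> = cum l h y * b y" unfolding cum_def by (rule integral_mult_left_zero)
      finally show "(LINT x|\<Delta> l. indicator T (x, y) *\<^sub>R (a x * b y)) = indicator {..w} y *\<^sub>R (cum l h y * k y)"
        by (simp add: b_def)
    qed
    finally show ?thesis .
  qed
  have lower: "(LINT x|\<Delta> l. LINT y|\<Delta> l. a x * b y - indicator T (x, y) *\<^sub>R (a x * b y))
      = (LINT x|\<Delta> l. indicator {..w} x *\<^sub>R (h x * cum l k x))"
  proof (rule Bochner_Integration.integral_cong[OF refl])
    fix x
    have "(LINT y|\<Delta> l. a x * b y - indicator T (x, y) *\<^sub>R (a x * b y)) = (LINT y|\<Delta> l. a x * (indicator {..x} y *\<^sub>R k y))"
      by (rule Bochner_Integration.integral_cong[OF refl]) (auto simp: T_def a_def b_def indicator_def)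
    also have "\<dots> = a x * cum l k x" unfolding cum_def by (rule integral_mult_right_zero)
    finally show "(LINT y|\<Delta> l. a x * b y - indicator T (x, y) *\<^sub>R (a x * b y)) = indicator {..w} x *\<^sub>R (h x * cum l k x)"
      by (simp add: a_def)
  qed
  have "cum l h w = (LINT x|\<Delta> l. a x)" "cum l k w = (LINT y|\<Delta> l. b y)"
    by (simp_all only: cum_def a_def b_def)
  then have "cum l h w * cum l k w = (LINT x|\<Delta> l. LINT y|\<Delta> l. a x * b y)"
    by simp
  also have "\<dots> = (LINT p|(\<Delta> l \<Otimes>\<^sub>M \<Delta> l). (\<lambda>(x, y). a x * b y) p)"
    using integral_fst'[OF ab] by simp
  also have "\<dots> = (LINT p|(\<Delta> l \<Otimes>\<^sub>M \<Delta> l). (\<lambda>(x, y). a x * b y - indicator T (x, y) *\<^sub>R (a x * b y)) p)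
      + (LINT p|(\<Delta> l \<Otimes>\<^sub>M \<Delta> l). (\<lambda>(x, y). indicator T (x, y) *\<^sub>R (a x * b y)) p)"
    using Bochner_Integration.integral_diff[OF ab abT] by (simp add: case_prod_unfold)
  also have "(LINT p|(\<Delta> l \<Otimes>\<^sub>M \<Delta> l). (\<lambda>(x, y). a x * b y - indicator T (x, y) *\<^sub>R (a x * b y)) p)
      = (LINT x|\<Delta> l. LINT y|\<Delta> l. a x * b y - indicator T (x, y) *\<^sub>R (a x * b y))"
    using integral_fst'[OF Bochner_Integration.integrable_diff[OF ab abT]] by (simp add: case_prod_unfold)
  also have "(LINT p|(\<Delta> l \<Otimes>\<^sub>M \<Delta> l). (\<lambda>(x, y). indicator T (x, y) *\<^sub>R (a x * b y)) p)
      = (LINT x|\<Delta> l. LINT y|\<Delta> l. indicator T (x, y) *\<^sub>R (a x * b y))"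
    using integral_fst'[OF abT] by simp
  also have "(LINT x|\<Delta> l. LINT y|\<Delta> l. a x * b y - indicator T (x, y) *\<^sub>R (a x * b y))
      + (LINT x|\<Delta> l. LINT y|\<Delta> l. indicator T (x, y) *\<^sub>R (a x * b y))
      = cum l (\<lambda>\<xi>. h \<xi> * cum l k \<xi>) w + cum l (\<lambda>\<xi>. cum l h \<xi> * k \<xi>) w"
    unfolding upper lower by (simp add: cum_def)
  also have "\<dots> = cum l (\<lambda>\<xi>. h \<xi> * cum l k \<xi> + cum l h \<xi> * k \<xi>) w"
    using integrable_mult_cum[OF h k] integrable_mult_cum[OF k h] by (simp add: cum_add mult.commute)
  finally show ?thesis .
qed

text \<open>Integration by parts, from the product formula at the right end point. It moves an
  indefinite integral onto the other factor as an integral over the remaining tail, which is the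
  shape of the adjoint of a Volterra operator.\<close>

lemma integral_cum_mult:
  fixes h k :: "real \<Rightarrow> complex"
  assumes h: "integrable (\<Delta> l) h" and k: "integrable (\<Delta> l) k"
  shows "(LINT w|\<Delta> l. cum l h w * k w) = (LINT w|\<Delta> l. h w * ((LINT \<xi>|\<Delta> l. k \<xi>) - cum l k w))"
proof -
  note hk = integrable_mult_cum[OF h k]
  have kh: "integrable (\<Delta> l) (\<lambda>w. cum l h w * k w)"
    using integrable_mult_cum[OF k h] by (simp add: mult.commute)
  have "(LINT w|\<Delta> l. h w) * (LINT w|\<Delta> l. k w)
      = (LINT w|\<Delta> l. h w * cum l k w) + (LINT w|\<Delta> l. cum l h w * k w)"
    using cum_mult[OF h k, of "l"] hk kh by (simp add: cum_end)
  moreover have "(LINT w|\<Delta> l. h w * ((LINT \<xi>|\<Delta> l. k \<xi>) - cum l k w))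
      = (LINT w|\<Delta> l. h w) * (LINT w|\<Delta> l. k w) - (LINT w|\<Delta> l. h w * cum l k w)"
    using hk h by (simp add: right_diff_distrib)
  ultimately show ?thesis by simp
qed

lemma bounded_linear_vec_nth_complex: "bounded_linear (\<lambda>x :: complex ^ 'n. x $ i)"
  by (rule bounded_linear_vec_nth)

text \<open>The integrated form of d|e|^2 = 2 Re <e', e> for an absolutely continuous e with density
  h and starting value \<kappa>. Since h is only integrable, the identity is obtained coordinate by
  coordinate from the product formula \<open>cum_mult\<close> and not from a derivative.\<close>

lemma energy_identity:
  fixes h :: "real \<Rightarrow> complex ^ 'n"
  assumes h: "integrable (\<Delta> l) h" and e: "\<And>w. e w = \<kappa> + cum l h w"
  shows "(norm (e w))\<^sup>2 = (norm \<kappa>)\<^sup>2 + cum l (\<lambda>\<xi>. 2 * Re (cdot (h \<xi>) (e \<xi>))) w"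
    and "integrable (\<Delta> l) (\<lambda>\<xi>. cdot (h \<xi>) (e \<xi>))"
proof -
  define hi where "hi = (\<lambda>i \<xi>. h \<xi> $ i)"
  have hi: "integrable (\<Delta> l) (hi i)" "integrable (\<Delta> l) (\<lambda>\<xi>. cnj (hi i \<xi>))" for i
    using integrable_bounded_linear[OF bounded_linear_vec_nth_complex h] by (simp_all add: hi_def)
  have Hi: "cum l (hi i) w = cum l h w $ i" for i w
    using cum_bounded_linear[OF bounded_linear_vec_nth_complex h] by (simp add: hi_def)
  have Hc: "cum l (\<lambda>\<xi>. cnj (hi i \<xi>)) w = cnj (cum l (hi i) w)" for i w
    using cum_bounded_linear[OF bounded_linear_cnj hi(1)[of i]] by simp
  have int1: "integrable (\<Delta> l) (\<lambda>\<xi>. hi i \<xi> * cnj (e \<xi> $ i))" for i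
    using hi(1)[of i] integrable_mult_cum[OF hi(1)[of i] hi(2)[of i]]
    by (simp add: e Hi Hc algebra_simps)
  then show int: "integrable (\<Delta> l) (\<lambda>\<xi>. cdot (h \<xi>) (e \<xi>))"
    by (simp add: cdot_def hi_def)
  have comp: "e w $ i * cnj (e w $ i) = \<kappa> $ i * cnj (\<kappa> $ i)
      + cum l (\<lambda>\<xi>. hi i \<xi> * cnj (e \<xi> $ i) + cnj (hi i \<xi> * cnj (e \<xi> $ i))) w" for i
  proof -
    have "cum l (\<lambda>\<xi>. hi i \<xi> * cnj (e \<xi> $ i) + cnj (hi i \<xi> * cnj (e \<xi> $ i))) w
       = cum l (\<lambda>\<xi>. (cnj (\<kappa> $ i) * hi i \<xi> + \<kappa> $ i * cnj (hi i \<xi>))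
           + (hi i \<xi> * cum l (\<lambda>\<xi>. cnj (hi i \<xi>)) \<xi> + cum l (hi i) \<xi> * cnj (hi i \<xi>))) w"
      by (rule arg_cong[of _ _ "\<lambda>g. cum l g w"]) (simp add: e Hi Hc algebra_simps)
    also have "\<dots> = cum l (\<lambda>\<xi>. cnj (\<kappa> $ i) * hi i \<xi>) w + cum l (\<lambda>\<xi>. \<kappa> $ i * cnj (hi i \<xi>)) w
        + cum l (hi i) w * cum l (\<lambda>\<xi>. cnj (hi i \<xi>)) w"
      using hi[of i] integrable_mult_cum[OF hi(1)[of i] hi(2)[of i]]
        integrable_mult_cum[OF hi(2)[of i] hi(1)[of i]]
      by (simp add: cum_add cum_mult mult.commute)
    also have "\<dots> = cnj (\<kappa> $ i) * cum l (hi i) w + \<kappa> $ i * cnj (cum l (hi i) w)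
        + cum l (hi i) w * cnj (cum l (hi i) w)"
      using cum_bounded_linear[OF bounded_linear_mult_right hi(1)[of i]]
        cum_bounded_linear[OF bounded_linear_mult_right hi(2)[of i]] by (simp add: Hc)
    finally show ?thesis by (simp add: e Hi algebra_simps)
  qed
  have "complex_of_real ((norm (e w))\<^sup>2) = cdot (e w) (e w)" by (simp only: cdot_self)
  also have "\<dots> = cdot \<kappa> \<kappa> + (\<Sum>i\<in>UNIV. cum l (\<lambda>\<xi>. hi i \<xi> * cnj (e \<xi> $ i) + cnj (hi i \<xi> * cnj (e \<xi> $ i))) w)"
    by (simp add: cdot_def comp sum.distrib)
  also have "(\<Sum>i\<in>UNIV. cum l (\<lambda>\<xi>. hi i \<xi> * cnj (e \<xi> $ i) + cnj (hi i \<xi> * cnj (e \<xi> $ i))) w)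
     = cum l (\<lambda>\<xi>. \<Sum>i\<in>UNIV. (hi i \<xi> * cnj (e \<xi> $ i) + cnj (hi i \<xi> * cnj (e \<xi> $ i)))) w"
    unfolding cum_def scaleR_sum_right
  proof (rule Bochner_Integration.integral_sum[symmetric])
    fix i
    show "integrable (\<Delta> l) (\<lambda>\<xi>. indicator {..w} \<xi> *\<^sub>R (hi i \<xi> * cnj (e \<xi> $ i) + cnj (hi i \<xi> * cnj (e \<xi> $ i))))"
      using int1[of i] integrable_cnj[OF int1[of i]]
      by (intro integrable_indicator_cut Bochner_Integration.integrable_add)
  qed
  also have "(\<lambda>\<xi>. \<Sum>i\<in>UNIV. (hi i \<xi> * cnj (e \<xi> $ i) + cnj (hi i \<xi> * cnj (e \<xi> $ i))))
     = (\<lambda>\<xi>. complex_of_real (2 * Re (cdot (h \<xi>) (e \<xi>))))"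
    by (simp add: cdot_def hi_def complex_add_cnj sum_distrib_left del: complex_cnj_mult)
  also have "cum l (\<lambda>\<xi>. complex_of_real (2 * Re (cdot (h \<xi>) (e \<xi>)))) w
     = complex_of_real (cum l (\<lambda>\<xi>. 2 * Re (cdot (h \<xi>) (e \<xi>))) w)"
    by (rule cum_bounded_linear[OF bounded_linear_of_real]) (use int in simp)
  finally show "(norm (e w))\<^sup>2 = (norm \<kappa>)\<^sup>2 + cum l (\<lambda>\<xi>. 2 * Re (cdot (h \<xi>) (e \<xi>))) w"
    unfolding cdot_self of_real_add[symmetric] of_real_eq_iff .
qed

section \<open>Gronwall's inequality and linear Volterra equations\<close>

lemma Icc_sets_lebesgue: "{a..b::real} \<inter> space lebesgue \<in> sets lebesgue"
  by simp

lemma cum_eq_integral: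
  fixes h :: "real \<Rightarrow> real"
  assumes "continuous_on UNIV h" "w \<in> {-l..l}"
  shows "cum l h w = integral {-l..w} h"
proof -
  have sub: "{-l..w} \<subseteq> {-l..l}" using assms by auto
  have c: "continuous_on {-l..w} h" using assms(1) continuous_on_subset by blast
  have "cum l h w = (LINT \<xi>|lebesgue_on {-l..l}. indicator {-l..w} \<xi> *\<^sub>R h \<xi>)"
    unfolding cum_def by (rule Bochner_Integration.integral_cong) (auto simp: indicator_def)
  also have "\<dots> = (LINT \<xi>|lebesgue_on {-l..w}. h \<xi>)"
    unfolding integral_restrict_space[OF Icc_sets_lebesgue]
    by (rule Bochner_Integration.integral_cong[OF refl]) (use sub in \<open>auto simp: indicator_def\<close>)
  also have "\<dots> = integral {-l..w} h"
    by (rule lebesgue_integral_eq_integral[OF continuous_imp_integrable_real[OF c]]) simp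
  finally show ?thesis .
qed

text \<open>The majorant I, that is, a plus the integral of k \<phi>, satisfies I' = k \<phi> \<le>
  k I, so I exp(-K) does not increase. The kernel comes with an explicit primitive K because the
  application needs the total increase of K, which there is a difference of arctangents and
  therefore bounded independently of the interval.\<close>

lemma gronwall:
  fixes \<phi> k K :: "real \<Rightarrow> real"
  assumes \<phi>: "continuous_on UNIV \<phi>" and k: "continuous_on UNIV k" "\<And>w. 0 \<le> k w"
    and K: "\<And>w. (K has_real_derivative k w) (at w)"
    and le: "\<And>w. w \<in> {-l..l} \<Longrightarrow> \<phi> w \<le> a + cum l (\<lambda>\<xi>. k \<xi> * \<phi> \<xi>) w"
    and w: "w \<in> {-l..l}"
  shows "\<phi> w \<le> a * exp (K w - K (-l))"
proof -
  define I where "I = (\<lambda>w. a + integral {-l..w} (\<lambda>\<xi>. k \<xi> * \<phi> \<xi>))"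
  have c: "continuous_on UNIV (\<lambda>\<xi>. k \<xi> * \<phi> \<xi>)" using \<phi> k(1) by (intro continuous_intros)
  have le': "\<phi> x \<le> I x" if "x \<in> {-l..l}" for x
    using le[OF that] cum_eq_integral[OF c that] by (simp add: I_def)
  have I': "(I has_real_derivative k x * \<phi> x) (at x within {-l..l})" if "x \<in> {-l..l}" for x
    unfolding I_def
    by (auto intro!: derivative_eq_intros integral_has_real_derivative that continuous_on_subset[OF c])
  define F where "F = (\<lambda>x. I x * exp (- K x))"
  have F': "(F has_real_derivative (k x * \<phi> x - I x * k x) * exp (- K x)) (at x within {-l..l})"
    if "x \<in> {-l..l}" for x
    unfolding F_def
    by (auto intro!: derivative_eq_intros I'[OF that] DERIV_subset[OF K] simp: algebra_simps)
  have contF: "continuous_on {-l..l} F"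
    using F' by (intro DERIV_continuous_on)
  have "F w \<le> F (-l)"
  proof (rule DERIV_nonpos_imp_decreasing_open[where f = F and a = "-l" and b = w])
    show "-l \<le> w" using w by simp
    show "continuous_on {-l..w} F" using contF by (rule continuous_on_subset) (use w in auto)
    fix x assume x: "-l < x" "x < w"
    then have "(F has_real_derivative (k x * \<phi> x - I x * k x) * exp (- K x)) (at x)"
      using F'[of x] w at_within_interior[of x "{-l..l}"] by (simp add: interior_atLeastAtMost_real)
    moreover have "(k x * \<phi> x - I x * k x) * exp (- K x) \<le> 0"
    proof (rule mult_nonpos_nonneg)
      show "k x * \<phi> x - I x * k x \<le> 0"
        using mult_left_mono[OF le'[of x] k(2)[of x]] x w by (simp add: mult.commute)
    qed simp
    ultimately show "\<exists>y. (F has_real_derivative y) (at x) \<and> y \<le> 0" by blast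
  qed
  then have "I w * exp (- K w) \<le> a * exp (- K (-l))" by (simp add: F_def I_def)
  then have "I w * exp (- K w) * exp (K w) \<le> a * exp (- K (-l)) * exp (K w)"
    by (rule mult_right_mono) simp
  then have "I w \<le> a * exp (K w - K (-l))"
    by (simp add: mult.assoc exp_diff exp_minus field_simps)
  then show ?thesis using le'[OF w] by linarith
qed


lemma integral_exp_cut_le:
  assumes "0 < c" "w \<in> {-l..l}"
  shows "cum l (\<lambda>\<xi>. exp (c * \<xi>)) w \<le> exp (c * w) / c"
proof -
  have "((\<lambda>\<xi>. exp (c * \<xi>)) has_integral exp (c * w) / c - exp (c * (-l)) / c) {-l..w}"
  proof (rule fundamental_theorem_of_calculus)
    fix x
    show "((\<lambda>\<xi>. exp (c * \<xi>) / c) has_vector_derivative exp (c * x)) (at x within {-l..w})"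
      unfolding has_real_derivative_iff_has_vector_derivative[symmetric]
      by (rule derivative_eq_intros refl | use assms in simp)+
  qed (use assms in simp)
  moreover have "cum l (\<lambda>\<xi>. exp (c * \<xi>)) w = integral {-l..w} (\<lambda>\<xi>. exp (c * \<xi>))"
    by (rule cum_eq_integral[OF _ assms(2)]) (intro continuous_intros)
  ultimately show ?thesis using assms by (simp add: integral_unique)
qed

text \<open>Banach's fixed point theorem in a sup norm with exponential weight, so that one
  contraction covers the whole interval although the coefficient N is merely measurable and
  bounded.\<close>

lemma volterra_solution:
  fixes \<Psi> :: "real \<Rightarrow> complex ^ 'n" and N :: "real \<Rightarrow> complex ^ 'n ^ 'n"
  assumes \<Psi>: "continuous_on UNIV \<Psi>"
    and N: "N \<in> borel_measurable (\<Delta> l)"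
    and K: "\<And>\<xi> x. \<xi> \<in> {-l..l} \<Longrightarrow> norm (x v* N \<xi>) \<le> K * norm x"
    and l: "0 < l"
  obtains e where "continuous_on UNIV e" "\<And>w. w \<in> {-l..l} \<Longrightarrow> e w = \<Psi> w + cum l (\<lambda>\<xi>. e \<xi> v* N \<xi>) w"
    "integrable (\<Delta> l) (\<lambda>\<xi>. e \<xi> v* N \<xi>)"
proof -
  \<comment> \<open>With weight exp(-c w) the integral operator has norm at most |K| / c, which this
    choice makes at most 1/2; the summand 1 keeps c positive when K = 0.\<close>
  define c where "c = 2 * \<bar>K\<bar> + 1"
  have c: "0 < c" by (simp add: c_def)
  \<comment> \<open>The complete space used is that of bounded continuous functions on the real
    line; composing with the retraction onto [-l,l] keeps the iterates in it without changing them
    on the interval.\<close>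
  define clamp where "clamp = (\<lambda>w. max (-l) (min l w))"
  have clamp: "clamp w \<in> {-l..l}" "w \<in> {-l..l} \<Longrightarrow> clamp w = w" for w
    using l by (auto simp: clamp_def)
  have cont_clamp: "continuous_on UNIV clamp"
    unfolding clamp_def by (intro continuous_intros)
  have int: "integrable (\<Delta> l) (\<lambda>\<xi>. (exp (c * \<xi>) *\<^sub>R y \<xi>) v* N \<xi>)"
    if y: "continuous_on UNIV y" "\<And>\<xi>. norm (y \<xi>) \<le> C" for y :: "real \<Rightarrow> complex ^ 'n" and C
  proof (rule integrable_\<Delta>_bounded)
    show "(\<lambda>\<xi>. (exp (c * \<xi>) *\<^sub>R y \<xi>) v* N \<xi>) \<in> borel_measurable (\<Delta> l)"
      by (intro borel_measurable_vmult N borel_measurable_continuous_\<Delta> continuous_intros y(1))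
    fix \<xi> assume \<xi>: "\<xi> \<in> {-l..l}"
    have "norm ((exp (c * \<xi>) *\<^sub>R y \<xi>) v* N \<xi>) \<le> K * norm (exp (c * \<xi>) *\<^sub>R y \<xi>)"
      by (rule K[OF \<xi>])
    also have "\<dots> \<le> \<bar>K\<bar> * (exp (c * l) * C)"
    proof (rule mult_mono)
      show "norm (exp (c * \<xi>) *\<^sub>R y \<xi>) \<le> exp (c * l) * C"
        using y(2)[of \<xi>] \<xi> c by (simp add: mult_mono)
    qed auto
    finally show "norm ((exp (c * \<xi>) *\<^sub>R y \<xi>) v* N \<xi>) \<le> \<bar>K\<bar> * (exp (c * l) * C)" .
  qed
  \<comment> \<open>The unknown of the fixed point equation is y = exp(-c w) e, so the weight moves
    from the norm into the operator.\<close>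
  define F where "F = (\<lambda>(y :: real \<Rightarrow> complex ^ 'n) w. exp (- c * w) *\<^sub>R
    (\<Psi> w + cum l (\<lambda>\<xi>. (exp (c * \<xi>) *\<^sub>R y \<xi>) v* N \<xi>) w))"
  have bnd: "\<exists>C. \<forall>\<xi>. norm (apply_bcontfun y \<xi>) \<le> C" for y :: "real \<Rightarrow>\<^sub>C (complex ^ 'n)"
    by (intro exI[of _ "norm y"] allI norm_bounded)
  have inty: "integrable (\<Delta> l) (\<lambda>\<xi>. (exp (c * \<xi>) *\<^sub>R apply_bcontfun y \<xi>) v* N \<xi>)" for y :: "real \<Rightarrow>\<^sub>C (complex ^ 'n)"
    using bnd[of y] int[of "apply_bcontfun y"] by auto
  have contF: "continuous_on UNIV (F (apply_bcontfun y))" for y :: "real \<Rightarrow>\<^sub>C (complex ^ 'n)"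
    unfolding F_def by (intro continuous_intros \<Psi> continuous_cum inty)
  have Fb: "(\<lambda>w. F (apply_bcontfun y) (clamp w)) \<in> bcontfun" for y :: "real \<Rightarrow>\<^sub>C (complex ^ 'n)"
  proof -
    have "compact (F (apply_bcontfun y) ` {-l..l})"
      by (intro compact_continuous_image continuous_on_subset[OF contF]) auto
    then obtain C where C: "\<And>w. w \<in> {-l..l} \<Longrightarrow> norm (F (apply_bcontfun y) w) \<le> C"
      by (meson bounded_iff compact_imp_bounded imageI)
    show ?thesis
    proof (rule bcontfun_normI)
      show "continuous_on UNIV (\<lambda>w. F (apply_bcontfun y) (clamp w))"
        by (rule continuous_on_compose2[OF contF cont_clamp]) simp
      show "norm (F (apply_bcontfun y) (clamp w)) \<le> C" for w
        using C clamp(1) by blast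
    qed
  qed
  define T where "T = (\<lambda>y. Bcontfun (\<lambda>w. F (apply_bcontfun y) (clamp w)))"
  have Tapp: "apply_bcontfun (T y) w = F (apply_bcontfun y) (clamp w)" for y w
    unfolding T_def using Bcontfun_inverse[OF Fb] by simp
  have "\<exists>!y. T y = y"
  proof (rule banach_fix_type[of "1/2"])
    show "\<forall>y z. dist (T y) (T z) \<le> 1/2 * dist y z"
    proof (intro allI dist_bound)
      fix y z :: "real \<Rightarrow>\<^sub>C (complex ^ 'n)" and w0
      define w where "w = clamp w0"
      have w: "w \<in> {-l..l}" using clamp(1) by (simp add: w_def)
      let ?D = "\<lambda>\<xi>. (exp (c * \<xi>) *\<^sub>R (apply_bcontfun y \<xi> - apply_bcontfun z \<xi>)) v* N \<xi>"
      have D: "?D = (\<lambda>\<xi>. (exp (c * \<xi>) *\<^sub>R apply_bcontfun y \<xi>) v* N \<xi> - (exp (c * \<xi>) *\<^sub>R apply_bcontfun z \<xi>) v* N \<xi>)"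
        by (simp add: scaleR_diff_right vector_matrix_mult_diff_distrib)
      have intD: "integrable (\<Delta> l) ?D" unfolding D by (intro Bochner_Integration.integrable_diff inty)
      have "dist (T y w0) (T z w0) = norm (exp (- c * w) *\<^sub>R cum l ?D w)"
      proof -
        have "cum l ?D w = cum l (\<lambda>\<xi>. (exp (c * \<xi>) *\<^sub>R apply_bcontfun y \<xi>) v* N \<xi>) w
           - cum l (\<lambda>\<xi>. (exp (c * \<xi>) *\<^sub>R apply_bcontfun z \<xi>) v* N \<xi>) w"
          unfolding D by (rule cum_diff[OF inty inty])
        then show ?thesis
          unfolding dist_norm Tapp F_def w_def[symmetric] by (simp add: scaleR_diff_right[symmetric])
      qed
      also have "\<dots> \<le> exp (- c * w) * (\<bar>K\<bar> * dist y z * (exp (c * w) / c))"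
      proof -
        have "norm (cum l ?D w) \<le> cum l (\<lambda>\<xi>. norm (?D \<xi>)) w" by (rule norm_cum_le[OF intD])
        also have "\<dots> \<le> cum l (\<lambda>\<xi>. \<bar>K\<bar> * dist y z * exp (c * \<xi>)) w"
        proof (rule cum_mono)
          show "integrable (\<Delta> l) (\<lambda>\<xi>. norm (?D \<xi>))" by (rule integrable_norm[OF intD])
          have "integrable (\<Delta> l) (\<lambda>\<xi>. exp (c * \<xi>))"
          proof (rule integrable_\<Delta>_bounded)
            show "(\<lambda>\<xi>. exp (c * \<xi>)) \<in> borel_measurable (\<Delta> l)"
              by (intro borel_measurable_continuous_\<Delta> continuous_intros)
            show "norm (exp (c * \<xi>)) \<le> exp (c * l)" if "\<xi> \<in> {-l..l}" for \<xi>
              using that c by simp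
          qed
          then show "integrable (\<Delta> l) (\<lambda>\<xi>. \<bar>K\<bar> * dist y z * exp (c * \<xi>))" by simp
          show "AE \<xi> in \<Delta> l. norm (?D \<xi>) \<le> \<bar>K\<bar> * dist y z * exp (c * \<xi>)"
          proof (rule AE_I2)
            fix \<xi> assume "\<xi> \<in> space (\<Delta> l)"
            then have "\<xi> \<in> {-l..l}" by simp
            then have "norm (?D \<xi>) \<le> K * norm (exp (c * \<xi>) *\<^sub>R (apply_bcontfun y \<xi> - apply_bcontfun z \<xi>))"
              by (rule K)
            also have "\<dots> \<le> \<bar>K\<bar> * (exp (c * \<xi>) * dist y z)"
            proof (rule mult_mono)
              have "norm (apply_bcontfun y \<xi> - apply_bcontfun z \<xi>) \<le> dist y z"
                using dist_bounded[of y \<xi> z] by (simp add: dist_norm)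
              then show "norm (exp (c * \<xi>) *\<^sub>R (apply_bcontfun y \<xi> - apply_bcontfun z \<xi>)) \<le> exp (c * \<xi>) * dist y z"
                by simp
            qed auto
            finally show "norm (?D \<xi>) \<le> \<bar>K\<bar> * dist y z * exp (c * \<xi>)" by (simp add: mult_ac)
          qed
        qed
        also have "\<dots> = \<bar>K\<bar> * dist y z * cum l (\<lambda>\<xi>. exp (c * \<xi>)) w"
        proof -
          have "cum l (\<lambda>\<xi>. a * exp (c * \<xi>)) w = a * cum l (\<lambda>\<xi>. exp (c * \<xi>)) w" for a
            unfolding cum_def integral_mult_right_zero[symmetric]
            by (rule Bochner_Integration.integral_cong) (simp_all add: mult_ac)
          then show ?thesis .
        qed
        also have "\<dots> \<le> \<bar>K\<bar> * dist y z * (exp (c * w) / c)"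
          by (intro mult_left_mono integral_exp_cut_le c w) simp
        finally show ?thesis
          unfolding norm_scaleR abs_exp_cancel by (rule mult_left_mono) simp
      qed
      also have "\<dots> = \<bar>K\<bar> / c * dist y z"
        using c by (simp add: exp_minus field_simps)
      also have "\<dots> \<le> 1/2 * dist y z"
        by (intro mult_right_mono) (simp_all add: c_def field_simps)
      finally show "dist (T y w0) (T z w0) \<le> 1/2 * dist y z" .
    qed
  qed auto
  then obtain y where y: "T y = y" by blast
  define e where "e = (\<lambda>w. exp (c * w) *\<^sub>R apply_bcontfun y w)"
  show ?thesis
  proof (rule that[of e])
    show "continuous_on UNIV e" unfolding e_def by (intro continuous_intros) simp
    show "integrable (\<Delta> l) (\<lambda>\<xi>. e \<xi> v* N \<xi>)" unfolding e_def by (rule inty)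
    fix w assume w: "w \<in> {-l..l}"
    have "apply_bcontfun y w = F (apply_bcontfun y) w"
      using Tapp[of y w] y clamp(2)[OF w] by simp
    then show "e w = \<Psi> w + cum l (\<lambda>\<xi>. e \<xi> v* N \<xi>) w"
      by (simp add: e_def F_def exp_minus)
  qed
qed

section \<open>The triangular model\<close>

lemma H_cong: "f \<in> H l \<Longrightarrow> (\<And>w. w \<in> {-l..l} \<Longrightarrow> f w = g w) \<Longrightarrow> g \<in> H l"
  unfolding H_def
  using measurable_cong[of "\<Delta> l" f g borel]
    Bochner_Integration.integrable_cong[of "\<Delta> l" "\<Delta> l" "\<lambda>w. (norm (f w))\<^sup>2" "\<lambda>w. (norm (g w))\<^sup>2"]
  by simp

lemma normH_mono:
  fixes f :: "real \<Rightarrow> complex ^ 'p" and g :: "real \<Rightarrow> complex ^ 'q"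
  assumes "f \<in> H l" "g \<in> H l" "AE w in \<Delta> l. norm (f w) \<le> C * norm (g w)" "0 \<le> C"
  shows "normH l f \<le> C * normH l g"
proof -
  have "(normH l f)\<^sup>2 \<le> (LINT w|\<Delta> l. C\<^sup>2 * (norm (g w))\<^sup>2)"
    unfolding normH_sq
  proof (rule integral_mono_AE)
    show "AE w in \<Delta> l. (norm (f w))\<^sup>2 \<le> C\<^sup>2 * (norm (g w))\<^sup>2"
      using assms(3)
    proof eventually_elim
      fix w assume "norm (f w) \<le> C * norm (g w)"
      from power_mono[OF this, of 2] show "(norm (f w))\<^sup>2 \<le> C\<^sup>2 * (norm (g w))\<^sup>2"
        by (simp add: power_mult_distrib)
    qed
  qed (use H_sq_integrable assms in auto)
  also have "\<dots> = (C * normH l g)\<^sup>2" by (simp add: power_mult_distrib normH_sq)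
  finally show ?thesis by (rule power2_le_imp_le) (use assms(4) in simp)
qed

text \<open>The constant 1 as an element of scalar L^2; pairing with it bounds L^1 norms by L^2
  norms, and uniform bounds become L^2 bounds.\<close>

definition one_H :: "real \<Rightarrow> complex ^ 1" where "one_H w = (\<chi> i. 1)"

lemma norm_one_H[simp]: "norm (one_H w) = 1"
  by (simp add: one_H_def norm_vec_def)

lemma one_H_in_H: "one_H \<in> H l"
  by (rule HI_bounded[where C = 1]) (simp_all add: one_H_def[abs_def] norm_vec_def)

lemma integral_norm_le:
  assumes "g \<in> H l" shows "(LINT w|\<Delta> l. norm (g w)) \<le> normH l g * normH l one_H"
  using integral_norm_mult_le[OF assms one_H_in_H] by simp

text \<open>Integration by parts for the Hermitian product, applied to each coordinate with the
  second factor conjugated.\<close>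

lemma integral_cdot_cum:
  fixes h k :: "real \<Rightarrow> complex ^ 'n"
  assumes h: "integrable (\<Delta> l) h" and k: "integrable (\<Delta> l) k"
  shows "(LINT w|\<Delta> l. cdot (cum l h w) (k w))
    = (LINT w|\<Delta> l. cdot (h w) ((LINT \<xi>|\<Delta> l. k \<xi>) - cum l k w))"
proof -
  define hi where "hi = (\<lambda>i w. h w $ i)"
  define ki where "ki = (\<lambda>i w. cnj (k w $ i))"
  have bc: "bounded_linear (\<lambda>x :: complex ^ 'n. cnj (x $ i))" for i
    by (rule bounded_linear_compose[OF bounded_linear_cnj bounded_linear_vec_nth_complex])
  have hi: "integrable (\<Delta> l) (hi i)" and ki: "integrable (\<Delta> l) (ki i)" for i
    unfolding hi_def ki_def
    by (rule integrable_bounded_linear[OF bounded_linear_vec_nth_complex h],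
        rule integrable_bounded_linear[OF bc k])
  have Hi: "cum l h w $ i = cum l (hi i) w" and Ki: "cnj (cum l k w $ i) = cum l (ki i) w" for i w
    unfolding hi_def ki_def
    by (rule cum_bounded_linear[OF bounded_linear_vec_nth_complex h, symmetric],
        rule cum_bounded_linear[OF bc k, symmetric])
  have Kt: "cnj ((LINT \<xi>|\<Delta> l. k \<xi>) $ i) = (LINT \<xi>|\<Delta> l. ki i \<xi>)" for i
    unfolding ki_def by (rule integral_bounded_linear[OF bc k, symmetric])
  have i1: "integrable (\<Delta> l) (\<lambda>w. cum l (hi i) w * ki i w)" for i
    using integrable_mult_cum[OF ki hi] by (simp add: mult.commute)
  have i2: "integrable (\<Delta> l) (\<lambda>w. hi i w * ((LINT \<xi>|\<Delta> l. ki i \<xi>) - cum l (ki i) w))" for i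
    using integrable_mult_cum[OF hi ki] hi by (simp add: right_diff_distrib)
  have "(LINT w|\<Delta> l. cdot (cum l h w) (k w)) = (\<Sum>i\<in>UNIV. LINT w|\<Delta> l. cum l (hi i) w * ki i w)"
    unfolding cdot_def Hi using i1 by (simp add: ki_def)
  also have "\<dots> = (\<Sum>i\<in>UNIV. LINT w|\<Delta> l. hi i w * ((LINT \<xi>|\<Delta> l. ki i \<xi>) - cum l (ki i) w))"
    by (intro sum.cong refl integral_cum_mult hi ki)
  also have "\<dots> = (LINT w|\<Delta> l. cdot (h w) ((LINT \<xi>|\<Delta> l. k \<xi>) - cum l k w))"
    using i2 by (simp add: cdot_def hi_def Kt Ki)
  finally show ?thesis .
qed

lemma bounded_bilinear_mmult:
  "bounded_bilinear ((**) :: complex ^ 'b ^ 'a \<Rightarrow> complex ^ 'c ^ 'b \<Rightarrow> complex ^ 'c ^ 'a)"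
  unfolding bilinear_conv_bounded_bilinear[symmetric] bilinear_def linear_iff
  by (simp add: vec_eq_iff matrix_matrix_mult_def algebra_simps sum.distrib scaleR_sum_right)

lemma bounded_bilinear_cscale: "bounded_bilinear ((*\<^sub>m) :: complex \<Rightarrow> complex ^ 'b ^ 'a \<Rightarrow> _)"
  unfolding bilinear_conv_bounded_bilinear[symmetric] bilinear_def linear_iff
  by (simp add: vec_eq_iff cscale_def algebra_simps)

lemmas borel_measurable_mmult = borel_measurable_bilinear[OF bounded_bilinear_mmult]
lemmas borel_measurable_cscale = borel_measurable_bilinear[OF bounded_bilinear_cscale]

lemma norm_Im_le: "\<bar>Im z\<bar> \<le> norm (complex_of_real \<xi> - z)"
  using abs_Im_le_cmod[of "complex_of_real \<xi> - z"] by simp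

text \<open>Here J stands for J_1 - J_2 and E for the projection J_2 to the second block. For row
  vectors, E S_0 = S_0 says that S_0 reads only the second block, while S_0 J = S_0 and S_0 E = 0
  say that it writes only into the first. Everything needed about the block decomposition is
  contained in these identities, so no index positions occur below.\<close>

locale model =
  fixes l :: real and P :: "real \<Rightarrow> complex ^ ('m::finite) ^ ('p::finite)" and J E S0 :: "'m cmat"
  assumes l_pos: "0 < l"
    and P_meas[measurable]: "P \<in> borel_measurable (\<Delta> l)"
    and P_trace: "w \<in> {-l..l} \<Longrightarrow> trace (hconj (P w) ** P w) = 1"
    and P_J: "w \<in> {-l..l} \<Longrightarrow> hconj (P w) ** P w ** J = J ** (hconj (P w) ** P w)"
    and P_E: "w \<in> {-l..l} \<Longrightarrow> hconj (P w) ** P w ** E = E ** (hconj (P w) ** P w)"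
    and J_herm: "hconj J = J" and J_sq: "J ** J = mat 1"
    and E_J: "E ** J = J ** E" and E_S0: "E ** S0 = S0" and S0_J: "S0 ** J = S0" and S0_E: "S0 ** E = 0"
    and norm_E: "norm (x v* E) \<le> norm x"
begin

definition "PP w = hconj (P w) ** P w"

definition G :: "'p hfun \<Rightarrow> real \<Rightarrow> complex ^ 'm" where
  "G f = cum l (\<lambda>\<xi>. f \<xi> v* P \<xi>)"

definition Phi :: "'p hfun \<Rightarrow> complex ^ 'm" where
  "Phi f = (LINT \<xi>|\<Delta> l. f \<xi> v* P \<xi>)"

text \<open>The triangular model in reduced form. With L = J + S_0 + S_0^*, the integrals containing
  S_0^* cancel, and the two integrals containing S_0, over complementary pieces of the interval, add
  up to the integral over the whole interval. What remains is a Volterra part through J and a part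
  of finite rank through S_0.\<close>

definition Bop :: "'p hfun \<Rightarrow> 'p hfun" where
  "Bop f w = complex_of_real w *s f w + \<i> *s ((G f w v* J + Phi f v* S0) v* hconj (P w))"

text \<open>The function that turns B f - z f = g into a linear differential equation: its density
  is f \<Pi>, its value at -l is \<open>Phi f v* S0\<close>, and because S_0 J = S_0 the operator
  acts as w f + i e J \<Pi>^*.\<close>

definition ef :: "'p hfun \<Rightarrow> real \<Rightarrow> complex ^ 'm" where
  "ef f w = Phi f v* S0 + G f w"

lemma norm_J: "norm (x v* J) = norm x"
proof -
  have "cdot (x v* J) (x v* J) = cdot x x"
    unfolding cdot_vmult J_herm vector_matrix_mul_assoc J_sq by simp
  then show ?thesis unfolding cdot_self of_real_eq_iff by (simp add: power2_eq_iff_nonneg)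
qed

lemma norm_P: "w \<in> {-l..l} \<Longrightarrow> norm (x v* P w) \<le> norm x"
  by (rule norm_vmult_le_trace_1[OF P_trace])

lemma norm_Ph: "w \<in> {-l..l} \<Longrightarrow> norm (x v* hconj (P w)) \<le> norm x"
  by (rule norm_vmult_hconj_le_trace_1[OF P_trace])

lemma S0_S0: "S0 ** S0 = 0"
proof -
  have "S0 ** S0 = S0 ** (E ** S0)" by (simp add: E_S0)
  also have "\<dots> = (S0 ** E) ** S0" by (rule matrix_mul_assoc)
  finally show ?thesis by (simp add: S0_E)
qed

lemma Bop_ef: "Bop f w = complex_of_real w *s f w + \<i> *s ((ef f w v* J) v* hconj (P w))"
proof -
  have "Phi f v* S0 v* J = Phi f v* S0" by (simp add: vector_matrix_mul_assoc S0_J)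
  then show ?thesis by (simp add: Bop_def ef_def vector_matrix_left_distrib add.commute)
qed

lemma fP_H: assumes "f \<in> H l" shows "(\<lambda>\<xi>. f \<xi> v* P \<xi>) \<in> H l"
proof (rule HI_bound[OF _ assms, of _ 1])
  show "(\<lambda>\<xi>. f \<xi> v* P \<xi>) \<in> borel_measurable (\<Delta> l)"
    using H_measurable[OF assms] by measurable
qed (use norm_P in auto)

lemma fP_integrable: "f \<in> H l \<Longrightarrow> integrable (\<Delta> l) (\<lambda>\<xi>. f \<xi> v* P \<xi>)"
  by (rule H_integrable[OF fP_H])

lemma continuous_G: "f \<in> H l \<Longrightarrow> continuous_on UNIV (G f)"
  unfolding G_def by (rule continuous_cum[OF fP_integrable])

lemma G_end: "G f l = Phi f"
  unfolding G_def Phi_def by (rule cum_end) simp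

lemma multP_H:
  assumes "continuous_on UNIV e" shows "(\<lambda>w. e w v* hconj (P w)) \<in> H l"
proof -
  have "compact (e ` {-l..l})"
    by (intro compact_continuous_image continuous_on_subset[OF assms]) auto
  then obtain C where C: "\<And>w. w \<in> {-l..l} \<Longrightarrow> norm (e w) \<le> C"
    by (meson bounded_iff compact_imp_bounded imageI)
  show ?thesis
  proof (rule HI_bounded)
    show "(\<lambda>w. e w v* hconj (P w)) \<in> borel_measurable (\<Delta> l)"
      by (intro borel_measurable_vmult borel_measurable_continuous_\<Delta> assms borel_measurable_hconj P_meas)
    show "norm (e w v* hconj (P w)) \<le> C" if "w \<in> {-l..l}" for w
      using norm_Ph[OF that, of "e w"] C[OF that] by linarith
  qed
qed

lemma continuous_vmult: "continuous_on UNIV e \<Longrightarrow> continuous_on UNIV (\<lambda>w. e w v* (M :: complex ^ 'a ^ 'b))"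
  by (rule bounded_linear.continuous_on[OF bounded_linear_vector_matrix_mult])

lemma continuous_ef: "f \<in> H l \<Longrightarrow> continuous_on UNIV (ef f)"
  unfolding ef_def by (intro continuous_intros continuous_G)

lemma Bop_H: assumes "f \<in> H l" shows "Bop f \<in> H l"
  unfolding Bop_ef[abs_def]
  by (intro H_add H_mult_id assms H_smult multP_H continuous_vmult continuous_ef)

lemma Phi_lin: "f \<in> H l \<Longrightarrow> g \<in> H l \<Longrightarrow> Phi (\<lambda>w. c *s f w + d *s g w) = c *s Phi f + d *s Phi g"
proof -
  assume "f \<in> H l" "g \<in> H l"
  note i = fP_integrable[OF this(1)] fP_integrable[OF this(2)]
  have s: "bounded_linear (\<lambda>x :: complex ^ 'm. k *s x)" for k
    by (rule bounded_bilinear.bounded_linear_right[OF bounded_bilinear_smult])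
  have "Phi (\<lambda>w. c *s f w + d *s g w) = (LINT \<xi>|\<Delta> l. c *s (f \<xi> v* P \<xi>) + d *s (g \<xi> v* P \<xi>))"
    by (simp add: Phi_def vector_matrix_left_distrib vmult_smult)
  then show ?thesis
    using integrable_bounded_linear[OF s i(1)] integrable_bounded_linear[OF s i(2)]
      integral_bounded_linear[OF s i(1)] integral_bounded_linear[OF s i(2)]
    by (simp add: Phi_def)
qed

lemma G_lin: "f \<in> H l \<Longrightarrow> g \<in> H l \<Longrightarrow> G (\<lambda>w. c *s f w + d *s g w) v = c *s G f v + d *s G g v"
proof -
  assume "f \<in> H l" "g \<in> H l"
  note i = fP_integrable[OF this(1)] fP_integrable[OF this(2)]
  have s: "bounded_linear (\<lambda>x :: complex ^ 'm. k *s x)" for k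
    by (rule bounded_bilinear.bounded_linear_right[OF bounded_bilinear_smult])
  have "G (\<lambda>w. c *s f w + d *s g w) v = cum l (\<lambda>\<xi>. c *s (f \<xi> v* P \<xi>) + d *s (g \<xi> v* P \<xi>)) v"
    by (simp add: G_def vector_matrix_left_distrib vmult_smult)
  then show ?thesis
    using integrable_bounded_linear[OF s i(1)] integrable_bounded_linear[OF s i(2)]
      cum_bounded_linear[OF s i(1)] cum_bounded_linear[OF s i(2)]
    by (simp add: G_def cum_add)
qed

lemma Bop_lin: "f \<in> H l \<Longrightarrow> g \<in> H l \<Longrightarrow>
    Bop (\<lambda>w. c *s f w + d *s g w) = (\<lambda>w. c *s Bop f w + d *s Bop g w)"
  by (rule ext) (simp add: Bop_def G_lin Phi_lin vector_matrix_left_distrib vmult_smult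
    vector_add_ldistrib vector_smult_assoc mult_ac)

lemma Phi_cong: assumes "f \<in> H l" "g \<in> H l" "eqH l f g" shows "Phi f = Phi g"
proof -
  have "AE w in \<Delta> l. f w v* P w = g w v* P w"
    using assms(3) unfolding eqH_def by eventually_elim simp
  then show ?thesis unfolding Phi_def
    by (intro integral_cong_AE borel_measurable_integrable fP_integrable assms(1,2))
qed

lemma G_cong: assumes "f \<in> H l" "g \<in> H l" "eqH l f g" shows "G f w = G g w"
proof -
  have "AE w in \<Delta> l. f w v* P w = g w v* P w"
    using assms(3) unfolding eqH_def by eventually_elim simp
  then show ?thesis unfolding G_def
    by (intro cum_cong_AE fP_integrable assms(1,2))
qed

lemma Bop_cong: assumes "f \<in> H l" "g \<in> H l" "eqH l f g" shows "eqH l (Bop f) (Bop g)"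
  using assms(3) unfolding eqH_def
  by eventually_elim (simp add: Bop_def G_cong[OF assms] Phi_cong[OF assms])

lemma Phi_adj: assumes "f \<in> H l" shows "cdot (Phi f) c = innerH l f (\<lambda>w. c v* hconj (P w))"
proof -
  have b: "bounded_linear (\<lambda>x :: complex ^ 'm. cdot x c)"
    by (rule bounded_bilinear.bounded_linear_left[OF bounded_bilinear_cdot])
  show ?thesis
    unfolding Phi_def innerH_def using integral_bounded_linear[OF b fP_integrable[OF assms]]
    by (simp add: cdot_vmult)
qed

text \<open>An explicit adjoint of \<open>Bop\<close>: integration by parts replaces the integral up
  to w by the tail from w, and S_0 by its conjugate transpose. Its existence is what gives content
  to the adjoint chosen by \<open>adjH\<close>.\<close>

definition Bad :: "'p hfun \<Rightarrow> 'p hfun" where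
  "Bad g w = complex_of_real w *s g w + (- \<i>) *s (((Phi g - G g w) v* J + Phi g v* hconj S0) v* hconj (P w))"

lemma Bad_H: assumes "f \<in> H l" shows "Bad f \<in> H l"
  unfolding Bad_def[abs_def]
  by (intro H_add H_mult_id assms H_smult multP_H continuous_vmult continuous_intros continuous_G)

lemma Bop_adj:
  assumes f: "f \<in> H l" and g: "g \<in> H l"
  shows "innerH l (Bop f) g = innerH l f (Bad g)"
proof -
  let ?V = "\<lambda>w. (G f w v* J) v* hconj (P w)" and ?S = "\<lambda>w. (Phi f v* S0) v* hconj (P w)"
  let ?V' = "\<lambda>w. ((Phi g - G g w) v* J) v* hconj (P w)" and ?S' = "\<lambda>w. (Phi g v* hconj S0) v* hconj (P w)"
  have H': "?V \<in> H l" "?S \<in> H l" "?V' \<in> H l" "?S' \<in> H l"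
    by (intro multP_H continuous_vmult continuous_G f g continuous_intros)+
  have bJ: "bounded_linear (\<lambda>x. x v* J)" by (rule bounded_linear_vector_matrix_mult)
  have fPJ: "integrable (\<Delta> l) (\<lambda>\<xi>. f \<xi> v* P \<xi> v* J)"
    by (rule integrable_bounded_linear[OF bJ fP_integrable[OF f]])
  have GJ: "G f w v* J = cum l (\<lambda>\<xi>. f \<xi> v* P \<xi> v* J) w" for w
    unfolding G_def by (rule cum_bounded_linear[OF bJ fP_integrable[OF f], symmetric])
  have V: "innerH l ?V g = innerH l f ?V'"
  proof -
    have "innerH l ?V g = (LINT w|\<Delta> l. cdot (cum l (\<lambda>\<xi>. f \<xi> v* P \<xi> v* J) w) (g w v* P w))"
      by (simp add: innerH_def cdot_vmult GJ)
    also have "\<dots> = (LINT w|\<Delta> l. cdot (f w v* P w v* J) (Phi g - G g w))"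
      unfolding Phi_def G_def by (rule integral_cdot_cum[OF fPJ fP_integrable[OF g]])
    also have "\<dots> = innerH l f ?V'"
      by (simp add: innerH_def cdot_vmult J_herm)
    finally show ?thesis .
  qed
  have S: "innerH l ?S g = innerH l f ?S'"
  proof -
    have "innerH l ?S g = cnj (innerH l g ?S)" by (rule innerH_commute)
    also have "\<dots> = cdot (Phi f v* S0) (Phi g)"
      unfolding Phi_adj[OF g, symmetric] by (rule cdot_commute[symmetric])
    also have "\<dots> = innerH l f ?S'" by (simp add: cdot_vmult Phi_adj[OF f])
    finally show ?thesis .
  qed
  have M: "innerH l (\<lambda>w. complex_of_real w *s f w) g = innerH l f (\<lambda>w. complex_of_real w *s g w)"
    by (simp add: innerH_def cdot_smult_left cdot_smult_right)
  have B: "Bop f = (\<lambda>w. complex_of_real w *s f w + \<i> *s (?V w + ?S w))"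
    by (rule ext) (simp add: Bop_def vector_matrix_left_distrib)
  have B': "Bad g = (\<lambda>w. complex_of_real w *s g w + (-\<i>) *s (?V' w + ?S' w))"
    by (rule ext) (simp add: Bad_def vector_matrix_left_distrib)
  have "innerH l (Bop f) g = innerH l (\<lambda>w. complex_of_real w *s f w) g + \<i> * (innerH l ?V g + innerH l ?S g)"
    unfolding B by (simp add: innerH_add_left innerH_smult_left H' H_add H_smult H_mult_id f g distrib_left)
  also have "\<dots> = innerH l f (\<lambda>w. complex_of_real w *s g w) + \<i> * (innerH l f ?V' + innerH l f ?S')"
    by (simp only: M V S)
  also have "\<dots> = innerH l f (Bad g)"
    unfolding B' by (simp only: innerH_add_right innerH_smult_right H' H_add H_smult H_mult_id f g
        complex_cnj_minus complex_cnj_i minus_minus)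
  finally show ?thesis .
qed

lemma PP_J: "w \<in> {-l..l} \<Longrightarrow> PP w ** J = J ** PP w"
  unfolding PP_def by (rule P_J)

lemma PP_E: "w \<in> {-l..l} \<Longrightarrow> PP w ** E = E ** PP w"
  unfolding PP_def by (rule P_E)

lemma JPP_form:
  assumes w: "w \<in> {-l..l}"
  shows "Im (cdot (x v* (J ** PP w)) x) = 0" "norm (cdot (x v* (J ** PP w)) x) \<le> (norm x)\<^sup>2"
    "norm (x v* (J ** PP w)) \<le> norm x"
proof -
  have PPh: "hconj (PP w) = PP w" by (simp add: PP_def hconj_matrix_mult)
  have "hconj (J ** PP w) = J ** PP w" by (simp add: hconj_matrix_mult PPh J_herm PP_J[OF w])
  then have "cdot (x v* (J ** PP w)) x = cnj (cdot (x v* (J ** PP w)) x)"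
    by (metis cdot_commute cdot_vmult)
  then show "Im (cdot (x v* (J ** PP w)) x) = 0"
    by (metis Im_complex_of_real Reals_cnj_iff complex_is_Real_iff)
  have "norm (x v* (J ** PP w)) = norm (((x v* J) v* hconj (P w)) v* P w)"
    by (simp add: PP_def vector_matrix_mul_assoc matrix_mul_assoc)
  also have "\<dots> \<le> norm x" using norm_P[OF w] norm_Ph[OF w] norm_J by (metis order_trans)
  finally show n: "norm (x v* (J ** PP w)) \<le> norm x" .
  show "norm (cdot (x v* (J ** PP w)) x) \<le> (norm x)\<^sup>2"
    unfolding power2_eq_square
    by (rule order_trans[OF norm_cdot_le mult_right_mono[OF n]]) simp
qed

text \<open>
  As \<open>J\<close> commutes with \<open>\<Pi>\<^sup>*\<Pi>\<close>, the quadratic form of \<open>J \<Pi>\<^sup>*\<Pi>\<close> is real, so only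
  \<open>Im (1 / (\<xi> - z))\<close> drives the growth of \<open>|e|\<^sup>2\<close>; its integral over the line is \<open>\<pi>\<close>.
\<close>

lemma energy_bound:
  assumes d: "integrable (\<Delta> l) d" and e: "\<And>w. w \<in> {-l..l} \<Longrightarrow> e w = \<kappa> + cum l d w"
    and ode: "AE \<xi> in \<Delta> l. d \<xi> = (1 / (complex_of_real \<xi> - z)) *s (q \<xi> - \<i> *s (e \<xi> v* (J ** PP \<xi>)))"
    and q: "\<And>\<xi>. \<xi> \<in> {-l..l} \<Longrightarrow> norm (q \<xi>) \<le> g \<xi>" and g: "integrable (\<Delta> l) g"
    and z: "Im z \<noteq> 0" and w: "w \<in> {-l..l}"
  shows "norm (e w) \<le> exp (2 * pi) * (norm \<kappa> + 2 * ((LINT \<xi>|\<Delta> l. \<bar>g \<xi>\<bar>) / \<bar>Im z\<bar>))"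
proof -
  define y where "y = \<bar>Im z\<bar>"
  have y: "0 < y" using z by (simp add: y_def)
  define N where "N = (LINT \<xi>|\<Delta> l. \<bar>g \<xi>\<bar>) / y"
  have N0: "0 \<le> N" using y by (simp add: N_def)
  define E' where "E' = (\<lambda>w. \<kappa> + cum l d w)"
  have contE: "continuous_on UNIV E'" unfolding E'_def by (intro continuous_intros continuous_cum d)
  have eE: "e w = E' w" if "w \<in> {-l..l}" for w using e[OF that] by (simp add: E'_def)
  define \<phi> where "\<phi> = (\<lambda>w. (norm (E' w))\<^sup>2)"
  have cont\<phi>: "continuous_on UNIV \<phi>" unfolding \<phi>_def by (intro continuous_intros contE)
  \<comment> \<open>The forcing term contributes Re <q, e>, which is linear in e; estimating |e|
    there by its maximum M keeps the inequality for |e|^2 of Gronwall type, at the price of solving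
    a quadratic inequality for M at the end.\<close>
  obtain w0 where w0: "w0 \<in> {-l..l}" and max: "\<And>w. w \<in> {-l..l} \<Longrightarrow> norm (E' w) \<le> norm (E' w0)"
    using continuous_attains_sup[of "{-l..l}" "\<lambda>w. norm (E' w)"] l_pos
      continuous_on_subset[OF continuous_on_norm[OF contE], of "{-l..l}"] by auto
  define M where "M = norm (E' w0)"
  \<comment> \<open>k is 2 |Im (1 / (\<xi> - z))|, and K is its primitive. K increases by less than
    2 \<pi> along the whole line, so the Gronwall factor exp(2 \<pi>) depends neither on z nor on
    l.\<close>
  define k where "k = (\<lambda>\<xi>. 2 * y / ((\<xi> - Re z)\<^sup>2 + y\<^sup>2))"
  define K where "K = (\<lambda>\<xi>. 2 * arctan ((\<xi> - Re z) / y))"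
  have pos: "0 < (\<xi> - Re z)\<^sup>2 + y\<^sup>2" for \<xi> using y by (simp add: add_nonneg_pos)
  have contk: "continuous_on UNIV k"
    unfolding k_def by (intro continuous_intros ballI) (metis pos less_irrefl)
  have k0: "0 \<le> k w" for w unfolding k_def using y pos[of w] by simp
  have K: "(K has_real_derivative k w) (at w)" for w
    unfolding K_def k_def
    by (rule derivative_eq_intros refl | use y pos[of w] in \<open>simp add: field_simps power2_eq_square\<close>)+
  have key: "2 * Re (cdot (d \<xi>) (E' \<xi>)) \<le> 2 * M * (\<bar>g \<xi>\<bar> / y) + k \<xi> * \<phi> \<xi>"
    if \<xi>: "\<xi> \<in> {-l..l}" and o: "d \<xi> = (1 / (complex_of_real \<xi> - z)) *s (q \<xi> - \<i> *s (e \<xi> v* (J ** PP \<xi>)))" for \<xi>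
  proof -
    define c where "c = 1 / (complex_of_real \<xi> - z)"
    define s where "s = cdot (E' \<xi> v* (J ** PP \<xi>)) (E' \<xi>)"
    have s: "Im s = 0" "norm s \<le> \<phi> \<xi>"
      using JPP_form[OF \<xi>, of "E' \<xi>"] by (simp_all add: s_def \<phi>_def)
    have nc: "norm c \<le> 1 / y"
      using norm_Im_le[of z \<xi>] y unfolding c_def y_def by (simp add: norm_divide frac_le)
    have Imc: "Im c = Im z / ((\<xi> - Re z)\<^sup>2 + y\<^sup>2)"
      by (simp add: c_def Im_divide y_def)
    have "cdot (d \<xi>) (E' \<xi>) = c * cdot (q \<xi>) (E' \<xi>) - \<i> * c * s"
      unfolding o eE[OF \<xi>] c_def[symmetric] cdot_smult_left cdot_diff_left s_def by (simp add: algebra_simps)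
    then have "Re (cdot (d \<xi>) (E' \<xi>)) = Re (c * cdot (q \<xi>) (E' \<xi>)) + Im c * Re s"
      using s(1) by simp
    moreover have "Re (c * cdot (q \<xi>) (E' \<xi>)) \<le> 1 / y * (\<bar>g \<xi>\<bar> * M)"
    proof -
      have "Re (c * cdot (q \<xi>) (E' \<xi>)) \<le> norm c * norm (cdot (q \<xi>) (E' \<xi>))"
        unfolding norm_mult[symmetric] by (rule complex_Re_le_cmod)
      also have "\<dots> \<le> 1 / y * (\<bar>g \<xi>\<bar> * M)"
      proof (rule mult_mono[OF nc])
        have "norm (q \<xi>) \<le> \<bar>g \<xi>\<bar>" using q[OF \<xi>] by linarith
        then show "norm (cdot (q \<xi>) (E' \<xi>)) \<le> \<bar>g \<xi>\<bar> * M"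
          using max[OF \<xi>] by (intro order_trans[OF norm_cdot_le mult_mono]) (auto simp: M_def)
      qed (use y in auto)
      finally show ?thesis .
    qed
    moreover have "2 * (Im c * Re s) \<le> k \<xi> * \<phi> \<xi>"
    proof -
      have "Im c * Re s \<le> \<bar>Im c\<bar> * norm s"
        using abs_Re_le_cmod[of s] by (metis abs_ge_self abs_mult mult_left_mono order_trans abs_ge_zero)
      also have "\<dots> \<le> \<bar>Im c\<bar> * \<phi> \<xi>" by (rule mult_left_mono[OF s(2)]) simp
      also have "\<bar>Im c\<bar> = k \<xi> / 2" 
      proof -
        have "k \<xi> = 2 * (y / ((\<xi> - Re z)\<^sup>2 + y\<^sup>2))" unfolding k_def by (rule times_divide_eq_right[symmetric])
        then have "k \<xi> / 2 = y / ((\<xi> - Re z)\<^sup>2 + y\<^sup>2)"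
          by (metis nonzero_mult_div_cancel_left zero_neq_numeral)
        also have "\<dots> = \<bar>Im c\<bar>" unfolding Imc y_def[symmetric] using pos[of \<xi>] by (simp add: y_def abs_divide)
        finally show ?thesis by simp
      qed
      finally show ?thesis by simp
    qed
    moreover have "2 * M * (\<bar>g \<xi>\<bar> / y) = 2 * (1 / y * (\<bar>g \<xi>\<bar> * M))" by simp
    ultimately show ?thesis by linarith
  qed
  have intg: "integrable (\<Delta> l) (\<lambda>\<xi>. \<bar>g \<xi>\<bar>)" using g by simp
  have intk: "integrable (\<Delta> l) (\<lambda>\<xi>. k \<xi> * \<phi> \<xi>)"
  proof -
    have c: "continuous_on {-l..l} (\<lambda>\<xi>. k \<xi> * \<phi> \<xi>)"
      by (intro continuous_intros continuous_on_subset[OF contk] continuous_on_subset[OF cont\<phi>]) auto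
    show ?thesis by (rule continuous_imp_integrable_real[OF c])
  qed
  have A: "\<phi> w \<le> ((norm \<kappa>)\<^sup>2 + 2 * M * N) + cum l (\<lambda>\<xi>. k \<xi> * \<phi> \<xi>) w" for w
  proof -
    have "\<phi> w = (norm \<kappa>)\<^sup>2 + cum l (\<lambda>\<xi>. 2 * Re (cdot (d \<xi>) (E' \<xi>))) w"
      unfolding \<phi>_def by (rule energy_identity(1)[OF d]) (simp add: E'_def)
    moreover have "cum l (\<lambda>\<xi>. 2 * Re (cdot (d \<xi>) (E' \<xi>))) w
        \<le> cum l (\<lambda>\<xi>. 2 * M * (\<bar>g \<xi>\<bar> / y) + k \<xi> * \<phi> \<xi>) w"
    proof (rule cum_mono)
      have "integrable (\<Delta> l) (\<lambda>\<xi>. cdot (d \<xi>) (E' \<xi>))"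
        by (rule energy_identity(2)[OF d]) (simp add: E'_def)
      then show "integrable (\<Delta> l) (\<lambda>\<xi>. 2 * Re (cdot (d \<xi>) (E' \<xi>)))" by simp
      show "integrable (\<Delta> l) (\<lambda>\<xi>. 2 * M * (\<bar>g \<xi>\<bar> / y) + k \<xi> * \<phi> \<xi>)"
        using intg intk by simp
      show "AE \<xi> in \<Delta> l. 2 * Re (cdot (d \<xi>) (E' \<xi>)) \<le> 2 * M * (\<bar>g \<xi>\<bar> / y) + k \<xi> * \<phi> \<xi>"
        using ode AE_space[where M = "\<Delta> l"] by eventually_elim (use key in simp)
    qed
    moreover have "cum l (\<lambda>\<xi>. 2 * M * (\<bar>g \<xi>\<bar> / y) + k \<xi> * \<phi> \<xi>) w
        = cum l (\<lambda>\<xi>. 2 * M * (\<bar>g \<xi>\<bar> / y)) w + cum l (\<lambda>\<xi>. k \<xi> * \<phi> \<xi>) w"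
      using intg intk by (intro cum_add) simp_all
    moreover have "cum l (\<lambda>\<xi>. 2 * M * (\<bar>g \<xi>\<bar> / y)) w \<le> (LINT \<xi>|\<Delta> l. 2 * M * (\<bar>g \<xi>\<bar> / y))"
      using intg y by (intro cum_le_integral) (simp_all add: M_def)
    moreover have "(LINT \<xi>|\<Delta> l. 2 * M * (\<bar>g \<xi>\<bar> / y)) = 2 * M * N"
      by (simp add: N_def)
    ultimately show ?thesis by linarith
  qed
  have M2: "M\<^sup>2 \<le> ((norm \<kappa>)\<^sup>2 + 2 * M * N) * exp (2 * pi)"
  proof -
    have "\<phi> w0 \<le> ((norm \<kappa>)\<^sup>2 + 2 * M * N) * exp (K w0 - K (-l))"
      by (rule gronwall[OF cont\<phi> contk k0 K A w0])
    also have "\<dots> \<le> ((norm \<kappa>)\<^sup>2 + 2 * M * N) * exp (2 * pi)"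
    proof (rule mult_left_mono)
      show "exp (K w0 - K (-l)) \<le> exp (2 * pi)"
        using arctan_ubound[of "(w0 - Re z) / y"] arctan_lbound[of "(- l - Re z) / y"]
        unfolding K_def by simp
      show "0 \<le> (norm \<kappa>)\<^sup>2 + 2 * M * N" using N0 by (simp add: M_def)
    qed
    finally show ?thesis by (simp add: \<phi>_def M_def)
  qed
  have ge1: "1 \<le> exp (2 * pi)" by simp
  \<comment> \<open>Either M \<le> |\<kappa>| and there is nothing to do, or |\<kappa>|^2 \<le> M
    |\<kappa>| and the quadratic inequality can be divided by M. The result is linear in the
    data.\<close>
  have "M \<le> exp (2 * pi) * (norm \<kappa> + 2 * N)"
  proof (cases "M \<le> norm \<kappa>")
    case True
    have "norm \<kappa> + 2 * N \<le> exp (2 * pi) * (norm \<kappa> + 2 * N)"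
      using mult_right_mono[OF ge1, of "norm \<kappa> + 2 * N"] N0 by simp
    then show ?thesis using True N0 by linarith
  next
    case False
    have "(norm \<kappa>)\<^sup>2 \<le> M * norm \<kappa>" using False by (simp add: power2_eq_square mult_right_mono)
    then have "M * M \<le> (M * norm \<kappa> + 2 * M * N) * exp (2 * pi)"
      by (intro order_trans[OF M2[unfolded power2_eq_square[of M]]] mult_right_mono) simp_all
    then have "M * M \<le> M * (exp (2 * pi) * (norm \<kappa> + 2 * N))" by (simp add: algebra_simps)
    moreover have "0 < M" using False norm_ge_zero[of \<kappa>] by linarith
    ultimately show ?thesis by simp
  qed
  moreover have "norm (e w) \<le> M" using max[OF w] eE[OF w] by (simp add: M_def)
  ultimately show ?thesis by (simp add: N_def y_def)
qed


section \<open>Resolvent bound, injectivity and solvability for the model\<close>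

lemma ef_end: "ef f l = Phi f v* S0 + Phi f"
  unfolding ef_def by (simp add: G_end)

text \<open>The boundary value \<open>\<Phi> f S\<^sub>0\<close> of \<open>e\<close> only sees the second block \<open>e E\<close>, which starts from 0.\<close>

lemma Phi_S0: "Phi f v* S0 = (ef f l v* E) v* S0"
proof -
  have "(ef f l v* E) v* S0 = Phi f v* (S0 ** S0) + Phi f v* S0"
    by (simp add: ef_end vector_matrix_left_distrib vector_matrix_mul_assoc E_S0 S0_S0 S0_E)
  then show ?thesis by (simp add: S0_S0 S0_E)
qed

lemma ef_E:
  assumes "f \<in> H l" shows "ef f w v* E = 0 + cum l (\<lambda>\<xi>. f \<xi> v* P \<xi> v* E) w"
proof -
  have "cum l (\<lambda>\<xi>. f \<xi> v* P \<xi> v* E) w = G f w v* E"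
    unfolding G_def by (rule cum_bounded_linear[OF bounded_linear_vector_matrix_mult fP_integrable[OF assms]])
  then show ?thesis by (simp add: ef_def vector_matrix_left_distrib vector_matrix_mul_assoc S0_E)
qed

lemma JP_P: "x v* J v* hconj (P w) v* P w = x v* (J ** PP w)"
  by (simp add: PP_def vector_matrix_mul_assoc matrix_mul_assoc)

lemma JPP_E:
  assumes "w \<in> {-l..l}" shows "x v* (J ** PP w) v* E = (x v* E) v* (J ** PP w)"
proof -
  have "J ** PP w ** E = E ** (J ** PP w)"
    by (metis E_J PP_E[OF assms] matrix_mul_assoc)
  then show ?thesis by (simp add: vector_matrix_mul_assoc)
qed

lemma S0_bound: obtains C where "0 \<le> C" "\<And>x. norm (x v* S0) \<le> C * norm x"
  by (metis bounded_linear.nonneg_bounded bounded_linear_vector_matrix_mult mult.commute)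

lemma resolvent_bound:
  obtains C where "0 \<le> C"
    "\<And>f g z. f \<in> H l \<Longrightarrow> g \<in> H l \<Longrightarrow> Im z \<noteq> 0 \<Longrightarrow> eqH l (\<lambda>w. Bop f w - z *s f w) g \<Longrightarrow>
      normH l f \<le> C * (1 / \<bar>Im z\<bar> + 1 / \<bar>Im z\<bar>\<^sup>2) * normH l g"
proof -
  obtain s where s: "0 \<le> s" "\<And>x. norm (x v* S0) \<le> s * norm x" by (rule S0_bound) blast
  define a where "a = exp (2 * pi)"
  define n1 where "n1 = normH l one_H"
  have n1: "0 \<le> n1" by (simp add: n1_def)
  have a: "0 \<le> a" by (simp add: a_def)
  \<comment> \<open>Two factors a come from the two energy bounds, s from the norm of S_0 between
    them, and n1 from passing to the L^2 norm of g.\<close>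
  define C1 where "C1 = a * (s * (a * 2) + 2) * n1"
  have C1: "0 \<le> C1" using a s n1 by (simp add: C1_def)
  show ?thesis
  proof (rule that[of "1 + C1 * n1"])
    show "0 \<le> 1 + C1 * n1" using C1 n1 by simp
    fix f g :: "'p hfun" and z
    assume f: "f \<in> H l" and g: "g \<in> H l" and z: "Im z \<noteq> 0"
      and eq: "eqH l (\<lambda>w. Bop f w - z *s f w) g"
    define y where "y = \<bar>Im z\<bar>"
    have y: "0 < y" using z by (simp add: y_def)
    define e where "e = ef f"
    let ?c = "\<lambda>w. 1 / (complex_of_real w - z)"
    have fw: "AE w in \<Delta> l. f w = ?c w *s (g w - \<i> *s (e w v* J v* hconj (P w)))"
      using eq unfolding eqH_def
    proof eventually_elim
      fix w assume h: "Bop f w - z *s f w = g w"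
      have nz: "complex_of_real w - z \<noteq> 0" using z by (auto simp: complex_eq_iff)
      have "(complex_of_real w - z) *s f w = g w - \<i> *s (e w v* J v* hconj (P w))"
        using h unfolding Bop_ef e_def by (simp add: vector_sub_rdistrib algebra_simps)
      then have "?c w *s ((complex_of_real w - z) *s f w) = ?c w *s (g w - \<i> *s (e w v* J v* hconj (P w)))"
        by simp
      then show "f w = ?c w *s (g w - \<i> *s (e w v* J v* hconj (P w)))"
        using nz by (simp only: vector_smult_assoc) simp
    qed
    have ode: "AE w in \<Delta> l. f w v* P w = ?c w *s (g w v* P w - \<i> *s (e w v* (J ** PP w)))"
      using fw
    proof eventually_elim
      fix w assume h: "f w = ?c w *s (g w - \<i> *s (e w v* J v* hconj (P w)))"
      show "f w v* P w = ?c w *s (g w v* P w - \<i> *s (e w v* (J ** PP w)))"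
        by (subst h) (simp only: vmult_smult vector_matrix_mult_diff_distrib JP_P)
    qed
    have ode2: "AE w in \<Delta> l. f w v* P w v* E = ?c w *s (g w v* P w v* E - \<i> *s (e w v* E v* (J ** PP w)))"
      using ode AE_space[where M = "\<Delta> l"]
    proof eventually_elim
      fix w assume h: "f w v* P w = ?c w *s (g w v* P w - \<i> *s (e w v* (J ** PP w)))" and "w \<in> space (\<Delta> l)"
      then have w: "w \<in> {-l..l}" by simp
      show "f w v* P w v* E = ?c w *s (g w v* P w v* E - \<i> *s (e w v* E v* (J ** PP w)))"
        unfolding h by (simp only: vmult_smult vector_matrix_mult_diff_distrib JPP_E[OF w])
    qed
    have gn: "integrable (\<Delta> l) (\<lambda>w. norm (g w))" by (rule H_integrable_norm[OF g])
    define N where "N = n1 * normH l g / y"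
    have N: "(LINT \<xi>|\<Delta> l. \<bar>norm (g \<xi>)\<bar>) / \<bar>Im z\<bar> \<le> N"
      using integral_norm_le[OF g] y unfolding N_def n1_def y_def
      by (intro divide_right_mono) (simp_all add: mult.commute)
    have e2: "norm (e w v* E) \<le> a * (2 * N)" if w: "w \<in> {-l..l}" for w
    proof -
      have "norm (e w v* E) \<le> exp (2 * pi) * (norm (0 :: complex ^ 'm) + 2 * ((LINT \<xi>|\<Delta> l. \<bar>norm (g \<xi>)\<bar>) / \<bar>Im z\<bar>))"
      proof (rule energy_bound[where d = "\<lambda>w. f w v* P w v* E" and q = "\<lambda>w. g w v* P w v* E"])
        show "integrable (\<Delta> l) (\<lambda>w. f w v* P w v* E)"
          by (rule integrable_bounded_linear[OF bounded_linear_vector_matrix_mult fP_integrable[OF f]])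
        show "norm (g \<xi> v* P \<xi> v* E) \<le> norm (g \<xi>)" if "\<xi> \<in> {-l..l}" for \<xi>
          using norm_E norm_P[OF that] by (metis order_trans)
      qed (use ef_E[OF f] ode2 gn z w in \<open>simp_all add: e_def\<close>)
      also have "\<dots> \<le> a * (2 * N)"
        unfolding a_def using N by (intro mult_left_mono) simp_all
      finally show ?thesis .
    qed
    \<comment> \<open>The starting value of e is the image under S_0 of the end value of the second
      block, estimated just before.\<close>
    have \<kappa>: "norm (Phi f v* S0) \<le> s * (a * (2 * N))"
      unfolding Phi_S0 using s e2[of l] l_pos
      by (metis e_def order_trans mult_left_mono atLeastAtMost_iff order_refl less_imp_le neg_le_0_iff_le)
    have e1: "norm (e w) \<le> C1 * normH l g / y" if w: "w \<in> {-l..l}" for w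
    proof -
      have "norm (e w) \<le> exp (2 * pi) * (norm (Phi f v* S0) + 2 * ((LINT \<xi>|\<Delta> l. \<bar>norm (g \<xi>)\<bar>) / \<bar>Im z\<bar>))"
      proof (rule energy_bound[where d = "\<lambda>w. f w v* P w" and q = "\<lambda>w. g w v* P w"])
        show "norm (g \<xi> v* P \<xi>) \<le> norm (g \<xi>)" if "\<xi> \<in> {-l..l}" for \<xi>
          by (rule norm_P[OF that])
      qed (use fP_integrable[OF f] ode gn z w in \<open>simp_all add: e_def ef_def G_def\<close>)
      also have "\<dots> \<le> a * (s * (a * (2 * N)) + 2 * N)"
        unfolding a_def[symmetric] using N \<kappa> a by (intro mult_left_mono add_mono) simp_all
      also have "\<dots> = C1 * normH l g / y" by (simp add: C1_def N_def algebra_simps add_divide_distrib)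
      finally show ?thesis .
    qed
    let ?b = "C1 * normH l g / y"
    have b0: "0 \<le> ?b" using C1 y by simp
    have nc: "norm (?c w) \<le> 1 / y" for w
      using norm_Im_le[of z w] y unfolding y_def by (simp add: norm_divide frac_le)
    let ?g' = "\<lambda>w. ?c w *s g w" and ?e' = "\<lambda>w. ?c w *s ((- \<i>) *s (e w v* J v* hconj (P w)))"
    have eP: "(\<lambda>w. (- \<i>) *s (e w v* J v* hconj (P w))) \<in> H l"
      unfolding e_def by (intro H_smult multP_H continuous_vmult continuous_ef f)
    have cm: "?c \<in> borel_measurable (\<Delta> l)" by measurable
    have cH: "(\<lambda>w. ?c w *s h w) \<in> H l" if h: "h \<in> H l" for h :: "'p hfun"
    proof (rule HI_bound[OF _ h, of _ "1 / y"])
      show "(\<lambda>w. ?c w *s h w) \<in> borel_measurable (\<Delta> l)"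
        by (rule borel_measurable_smult[OF cm H_measurable[OF h]])
      show "norm (?c w *s h w) \<le> 1 / y * norm (h w)" for w
        unfolding norm_smult by (rule mult_right_mono[OF nc]) simp
    qed
    have n1': "normH l ?g' \<le> 1 / y * normH l g"
    proof (rule normH_mono[OF cH[OF g] g])
      show "AE w in \<Delta> l. norm (?c w *s g w) \<le> 1 / y * norm (g w)"
        unfolding norm_smult by (intro AE_I2 mult_right_mono nc) simp
    qed (use y in simp)
    have n2': "normH l ?e' \<le> (1 / y * ?b) * normH l one_H"
    proof (rule normH_mono[OF cH[OF eP] one_H_in_H])
      show "AE w in \<Delta> l. norm (?c w *s ((- \<i>) *s (e w v* J v* hconj (P w)))) \<le> 1 / y * ?b * norm (one_H w)"
      proof (rule AE_I2)
        fix w assume "w \<in> space (\<Delta> l)"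
        then have w: "w \<in> {-l..l}" by simp
        have "norm (e w v* J v* hconj (P w)) \<le> ?b"
          using norm_Ph[OF w, of "e w v* J"] norm_J[of "e w"] e1[OF w] by linarith
        then show "norm (?c w *s ((- \<i>) *s (e w v* J v* hconj (P w)))) \<le> 1 / y * ?b * norm (one_H w)"
          unfolding norm_smult norm_one_H using nc[of w] y
          by (simp only: norm_minus_cancel norm_ii mult_1 mult_1_right) (intro mult_mono, simp_all)
      qed
    qed (rule mult_nonneg_nonneg[OF _ b0], use y in simp)
    have "normH l f = normH l (\<lambda>w. ?g' w + ?e' w)"
    proof (rule normH_cong[OF f H_add[OF cH[OF g] cH[OF eP]]])
      show "eqH l f (\<lambda>w. ?g' w + ?e' w)"
        using fw unfolding eqH_def
        by eventually_elim (simp add: vector_ssub_ldistrib vector_smult_assoc algebra_simps vec_eq_iff)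
    qed
    also have "\<dots> \<le> 1 / y * normH l g + (1 / y * ?b) * n1"
      using normH_add_le[OF cH[OF g] cH[OF eP]] n1' n2' unfolding n1_def by linarith
    also have "\<dots> = (1 / y + C1 * n1 * (1 / y\<^sup>2)) * normH l g"
      by (simp add: power2_eq_square algebra_simps)
    also have "\<dots> \<le> ((1 + C1 * n1) * (1 / y + 1 / y\<^sup>2)) * normH l g"
    proof (rule mult_right_mono)
      have "p + q * r \<le> (1 + q) * (p + r)" if "0 \<le> p" "0 \<le> q" "0 \<le> r" for p q r :: real
        using that mult_nonneg_nonneg[of q p] by (simp add: algebra_simps)
      then show "1 / y + C1 * n1 * (1 / y\<^sup>2) \<le> (1 + C1 * n1) * (1 / y + 1 / y\<^sup>2)"
        using C1 n1 y by (meson mult_nonneg_nonneg divide_nonneg_nonneg zero_le_one less_imp_le zero_le_power2)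
    qed simp
    finally show "normH l f \<le> (1 + C1 * n1) * (1 / \<bar>Im z\<bar> + 1 / \<bar>Im z\<bar>\<^sup>2) * normH l g"
      by (simp add: y_def)
  qed
qed

text \<open>At z = 0 the density satisfies w e' = - i e J \<Pi>^*\<Pi>, and the quadratic form of J
  \<Pi>^*\<Pi> is real, so Re <e', e> = 0 almost everywhere and |e| is constant. For the second
  block the constant is 0, hence \<open>Phi f v* S0\<close> vanishes; then e starts from 0 and
  vanishes as well, which leaves w f = 0.\<close>

lemma Bop_injective:
  assumes f: "f \<in> H l" and eq: "eqH l (Bop f) (\<lambda>w. 0)"
  shows "eqH l f (\<lambda>w. 0)"
proof -
  define e where "e = ef f"
  have fw: "AE w in \<Delta> l. w \<noteq> 0 \<and> complex_of_real w *s f w = - (\<i> *s (e w v* J v* hconj (P w)))"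
    using eq AE_\<Delta>_neq[where l = l and w = 0] unfolding eqH_def
    by eventually_elim (simp add: Bop_ef e_def eq_neg_iff_add_eq_0)
  \<comment> \<open>After pairing with x the right side is i times a real number, and the factor w
    is real and nonzero.\<close>
  have zero: "Re (cdot d x) = 0"
    if w: "w \<in> {-l..l}" "w \<noteq> 0" and d: "complex_of_real w *s d = - (\<i> *s (x v* (J ** PP w)))" for w d x
  proof -
    have "complex_of_real w * cdot d x = - (\<i> * cdot (x v* (J ** PP w)) x)"
      unfolding cdot_smult_left[symmetric] d by (simp add: cdot_minus_left cdot_smult_left)
    then have "Re (complex_of_real w * cdot d x) = 0" using JPP_form(1)[OF w(1)] by simp
    then show ?thesis using w(2) by simp
  qed
  have ode: "AE w in \<Delta> l. w \<noteq> 0 \<and> complex_of_real w *s (f w v* P w) = - (\<i> *s (e w v* (J ** PP w)))"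
    using fw
  proof eventually_elim
    fix w assume h: "w \<noteq> 0 \<and> complex_of_real w *s f w = - (\<i> *s (e w v* J v* hconj (P w)))"
    have "complex_of_real w *s (f w v* P w) = (complex_of_real w *s f w) v* P w" by (simp only: vmult_smult)
    also have "\<dots> = (- (\<i> *s (e w v* J v* hconj (P w)))) v* P w" using h by simp
    also have "\<dots> = - (\<i> *s (e w v* (J ** PP w)))" by (simp only: uminus_vmult vmult_smult JP_P)
    finally show "w \<noteq> 0 \<and> complex_of_real w *s (f w v* P w) = - (\<i> *s (e w v* (J ** PP w)))"
      using h by simp
  qed
  have const: "norm (x w) = norm \<kappa>"
    if x: "\<And>w. x w = \<kappa> + cum l d w" and d: "integrable (\<Delta> l) d"
      and o: "AE w in \<Delta> l. w \<noteq> 0 \<and> complex_of_real w *s d w = - (\<i> *s (x w v* (J ** PP w)))"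
    for x d \<kappa> w
  proof -
    have "cum l (\<lambda>\<xi>. 2 * Re (cdot (d \<xi>) (x \<xi>))) w = 0"
      unfolding cum_def
    proof (rule integral_eq_zero_AE)
      show "AE \<xi> in \<Delta> l. indicator {..w} \<xi> *\<^sub>R (2 * Re (cdot (d \<xi>) (x \<xi>))) = 0"
        using o AE_space[where M = "\<Delta> l"]
      proof eventually_elim
        fix \<xi> assume o: "\<xi> \<noteq> 0 \<and> complex_of_real \<xi> *s d \<xi> = - (\<i> *s (x \<xi> v* (J ** PP \<xi>)))"
          and "\<xi> \<in> space (\<Delta> l)"
        then have "\<xi> \<in> {-l..l}" by simp
        from zero[OF this] o show "indicator {..w} \<xi> *\<^sub>R (2 * Re (cdot (d \<xi>) (x \<xi>))) = 0" by simp
      qed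
    qed
    then have "(norm (x w))\<^sup>2 = (norm \<kappa>)\<^sup>2" using energy_identity(1)[OF d x] by simp
    then show ?thesis by (simp add: power2_eq_iff_nonneg)
  qed
  have "norm (e l v* E) = norm (0 :: complex ^ 'm)"
  proof (rule const)
    show "e w v* E = 0 + cum l (\<lambda>\<xi>. f \<xi> v* P \<xi> v* E) w" for w unfolding e_def by (rule ef_E[OF f])
    show "integrable (\<Delta> l) (\<lambda>w. f w v* P w v* E)"
      by (rule integrable_bounded_linear[OF bounded_linear_vector_matrix_mult fP_integrable[OF f]])
    show "AE w in \<Delta> l. w \<noteq> 0 \<and> complex_of_real w *s (f w v* P w v* E) = - (\<i> *s (e w v* E v* (J ** PP w)))"
      using ode AE_space[where M = "\<Delta> l"]
    proof eventually_elim
      fix w assume h: "w \<noteq> 0 \<and> complex_of_real w *s (f w v* P w) = - (\<i> *s (e w v* (J ** PP w)))"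
        and "w \<in> space (\<Delta> l)"
      then have w: "w \<in> {-l..l}" by simp
      have "complex_of_real w *s (f w v* P w v* E) = (complex_of_real w *s (f w v* P w)) v* E"
        by (simp only: vmult_smult)
      also have "\<dots> = (- (\<i> *s (e w v* (J ** PP w)))) v* E" using h by simp
      also have "\<dots> = - (\<i> *s (e w v* E v* (J ** PP w)))"
        by (simp only: vmult_smult uminus_vmult JPP_E[OF w])
      finally show "w \<noteq> 0 \<and> complex_of_real w *s (f w v* P w v* E) = - (\<i> *s (e w v* E v* (J ** PP w)))"
        using h by simp
    qed
  qed
  then have \<kappa>: "Phi f v* S0 = 0" using Phi_S0[of f] by (simp add: e_def)
  have e0: "e w = 0" for w
  proof -
    have "norm (e w) = norm (0 :: complex ^ 'm)"
    proof (rule const)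
      show "e w = 0 + cum l (\<lambda>\<xi>. f \<xi> v* P \<xi>) w" for w by (simp add: e_def ef_def \<kappa> G_def)
    qed (rule fP_integrable[OF f], rule ode)
    then show ?thesis by simp
  qed
  show ?thesis
    using fw unfolding eqH_def by eventually_elim (auto simp: e0)
qed

text \<open>The differential equation for e has a starting value that depends on its own solution.
  It is found by solving once with starting value 0, reading off \<kappa> at the right end, and
  solving again from \<kappa>. The two solutions have the same second block, so the end value of the
  second one reproduces \<kappa>, and f is then defined algebraically from e.\<close>

lemma resolvent_exists:
  assumes g: "g \<in> H l" and z: "Im z \<noteq> 0"
  obtains f where "f \<in> H l" "eqH l (\<lambda>w. Bop f w - z *s f w) g"
proof -
  define y where "y = \<bar>Im z\<bar>"
  have y: "0 < y" using z by (simp add: y_def)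
  let ?c = "\<lambda>w. 1 / (complex_of_real w - z)"
  have nz: "complex_of_real w - z \<noteq> 0" for w using z by (auto simp: complex_eq_iff)
  have nc: "norm (?c w) \<le> 1 / y" for w
    using norm_Im_le[of z w] y unfolding y_def by (simp add: norm_divide frac_le)
  have cm: "?c \<in> borel_measurable (\<Delta> l)" by measurable
  have cH: "(\<lambda>w. ?c w *s h w) \<in> H l" if h: "h \<in> H l" for h :: "real \<Rightarrow> complex ^ 'q"
  proof (rule HI_bound[OF _ h, of _ "1 / y"])
    show "(\<lambda>w. ?c w *s h w) \<in> borel_measurable (\<Delta> l)"
      by (rule borel_measurable_smult[OF cm H_measurable[OF h]])
    show "norm (?c w *s h w) \<le> 1 / y * norm (h w)" for w
      unfolding norm_smult by (rule mult_right_mono[OF nc]) simp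
  qed
  define a where "a = (\<lambda>w. ?c w *s (g w v* P w))"
  have a: "integrable (\<Delta> l) a"
    unfolding a_def by (rule H_integrable[OF cH[OF fP_H[OF g]]])
  \<comment> \<open>The coefficient of the Volterra equation; \<open>Napp\<close> writes it with
    forcing term 0, the form in which the energy bound applies to it.\<close>
  define N where "N = (\<lambda>w. (- \<i> * ?c w) *\<^sub>m (J ** PP w))"
  have Napp: "x v* N w = ?c w *s (0 - \<i> *s (x v* (J ** PP w)))" for x w
    by (simp add: N_def vmult_cscale vec_eq_iff)
  have N_meas: "N \<in> borel_measurable (\<Delta> l)"
    unfolding N_def PP_def
    by (intro borel_measurable_cscale borel_measurable_mmult borel_measurable_hconj P_meas) simp_all
  have Nb: "norm (x v* N w) \<le> 1 / y * norm x" if w: "w \<in> {-l..l}" for x w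
    unfolding Napp norm_smult using nc[of w] JPP_form(3)[OF w, of x] y
    by (intro mult_mono) (simp_all add: norm_smult)
  have sol: "\<exists>e. continuous_on UNIV e \<and> (\<forall>w\<in>{-l..l}. e w = \<kappa> + cum l (\<lambda>w. a w + e w v* N w) w)
      \<and> integrable (\<Delta> l) (\<lambda>w. e w v* N w)" for \<kappa>
  proof -
    have "continuous_on UNIV (\<lambda>w. \<kappa> + cum l a w)" by (intro continuous_intros continuous_cum a)
    then obtain e where e: "continuous_on UNIV e"
      "\<And>w. w \<in> {-l..l} \<Longrightarrow> e w = \<kappa> + cum l a w + cum l (\<lambda>w. e w v* N w) w"
      "integrable (\<Delta> l) (\<lambda>w. e w v* N w)"
      using volterra_solution[OF _ N_meas Nb l_pos] by blast
    then show ?thesis using a by (intro exI[of _ e]) (simp add: cum_add)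
  qed
  obtain e0 where e0: "continuous_on UNIV e0"
    "\<And>w. w \<in> {-l..l} \<Longrightarrow> e0 w = 0 + cum l (\<lambda>w. a w + e0 w v* N w) w"
    "integrable (\<Delta> l) (\<lambda>w. e0 w v* N w)" using sol[of 0] by blast
  \<comment> \<open>As an image under S_0, \<kappa> lies in the first block: it does not disturb the
    second block and is annihilated by S_0.\<close>
  define \<kappa> where "\<kappa> = e0 l v* S0"
  obtain e where e: "continuous_on UNIV e"
    "\<And>w. w \<in> {-l..l} \<Longrightarrow> e w = \<kappa> + cum l (\<lambda>w. a w + e w v* N w) w"
    "integrable (\<Delta> l) (\<lambda>w. e w v* N w)" using sol[of \<kappa>] by blast
  have \<kappa>0: "\<kappa> v* S0 = 0" "\<kappa> v* E = 0"
    by (simp_all add: \<kappa>_def vector_matrix_mul_assoc S0_S0 S0_E)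
  define d where "d = (\<lambda>w. (e w v* N w - e0 w v* N w) v* E)"
  have dint: "integrable (\<Delta> l) d"
    unfolding d_def
    by (rule integrable_bounded_linear[OF bounded_linear_vector_matrix_mult
          Bochner_Integration.integrable_diff[OF e(3) e0(3)]])
  have lI: "l \<in> {-l..l}" using l_pos by simp
  \<comment> \<open>The energy bound serves as a uniqueness statement here: with zero starting value
    and zero forcing, the second blocks of the two solutions coincide.\<close>
  have "norm ((e l - e0 l) v* E) \<le> exp (2 * pi) * (norm (0 :: complex ^ 'm) + 2 * ((LINT \<xi>|\<Delta> l. \<bar>0\<bar>) / \<bar>Im z\<bar>))"
  proof (rule energy_bound[where d = d and q = "\<lambda>w. 0" and e = "\<lambda>w. (e w - e0 w) v* E", OF dint])
    fix w assume w: "w \<in> {-l..l}"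
    have "e w - e0 w = \<kappa> + cum l (\<lambda>w. e w v* N w - e0 w v* N w) w"
      using e(2)[OF w] e0(2)[OF w] a e(3) e0(3) by (simp add: cum_add cum_diff)
    then show "(e w - e0 w) v* E = 0 + cum l d w"
      unfolding d_def cum_bounded_linear[OF bounded_linear_vector_matrix_mult
          Bochner_Integration.integrable_diff[OF e(3) e0(3)]]
      by (simp add: vector_matrix_left_distrib \<kappa>0)
  next
    show "AE \<xi> in \<Delta> l. d \<xi> = ?c \<xi> *s (0 - \<i> *s ((e \<xi> - e0 \<xi>) v* E v* (J ** PP \<xi>)))"
    proof (rule AE_I2)
      fix \<xi> assume "\<xi> \<in> space (\<Delta> l)"
      then have \<xi>: "\<xi> \<in> {-l..l}" by simp
      have "d \<xi> = ((e \<xi> - e0 \<xi>) v* N \<xi>) v* E"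
        by (simp add: d_def vector_matrix_mult_diff_distrib)
      also have "\<dots> = ?c \<xi> *s (0 - \<i> *s ((e \<xi> - e0 \<xi>) v* (J ** PP \<xi>) v* E))"
        unfolding Napp by (simp only: vmult_smult vector_matrix_mult_diff_distrib[of 0] vector_matrix_mult_0)
      finally show "d \<xi> = ?c \<xi> *s (0 - \<i> *s ((e \<xi> - e0 \<xi>) v* E v* (J ** PP \<xi>)))"
        unfolding JPP_E[OF \<xi>] .
    qed
  qed (use z lI in simp_all)
  then have "(e l - e0 l) v* E = 0" by simp
  then have el: "e l v* S0 = \<kappa>"
  proof -
    assume h: "(e l - e0 l) v* E = 0"
    have "e l v* S0 - e0 l v* S0 = (e l - e0 l) v* E v* S0"
      by (simp add: vector_matrix_mult_diff_distrib vector_matrix_mul_assoc E_S0)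
    then show ?thesis unfolding h by (simp add: \<kappa>_def)
  qed
  define f where "f = (\<lambda>w. ?c w *s (g w - \<i> *s (e w v* J v* hconj (P w))))"
  have f: "f \<in> H l"
    unfolding f_def by (intro cH H_diff g H_smult multP_H continuous_vmult e(1))
  have fP: "f w v* P w = a w + e w v* N w" for w
    unfolding f_def a_def Napp
    by (simp only: vmult_smult vector_matrix_mult_diff_distrib JP_P)
      (simp add: vector_ssub_ldistrib)
  have Gf: "G f w = e w - \<kappa>" if "w \<in> {-l..l}" for w
    using e(2)[OF that] by (simp add: G_def fP)
  have "Phi f v* S0 = \<kappa>"
    unfolding G_end[symmetric] using Gf[OF lI]
    by (simp add: vector_matrix_mult_diff_distrib el \<kappa>0)
  then have ef: "ef f w = e w" if "w \<in> {-l..l}" for w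
    using Gf[OF that] by (simp add: ef_def)
  show ?thesis
  proof (rule that[OF f], rule eqH_pointwise)
    fix w assume w: "w \<in> {-l..l}"
    have "(complex_of_real w - z) *s f w = g w - \<i> *s (e w v* J v* hconj (P w))"
      using nz[of w] by (simp add: f_def vector_smult_assoc)
    then show "Bop f w - z *s f w = g w"
      unfolding Bop_ef ef[OF w] by (simp add: vector_sub_rdistrib algebra_simps)
  qed
qed

end

section \<open>Cube roots of an operator\<close>

text \<open>What the uniqueness of cube roots uses of an operator: no kernel, and solvability with a
  quantitative bound off the real axis. Linearity is an identity of representatives, so that
  iterates can be rewritten directly, whereas equations are only required almost everywhere.\<close>

locale resolvent_operator =
  fixes l :: real and T :: "('p::finite) hfun \<Rightarrow> 'p hfun"
  assumes T_H: "f \<in> H l \<Longrightarrow> T f \<in> H l"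
    and T_lin: "f \<in> H l \<Longrightarrow> g \<in> H l \<Longrightarrow> T (\<lambda>w. c *s f w + d *s g w) = (\<lambda>w. c *s T f w + d *s T g w)"
    and T_cong: "f \<in> H l \<Longrightarrow> g \<in> H l \<Longrightarrow> eqH l f g \<Longrightarrow> eqH l (T f) (T g)"
    and T_inj: "f \<in> H l \<Longrightarrow> eqH l (T f) (\<lambda>w. 0) \<Longrightarrow> eqH l f (\<lambda>w. 0)"
    and T_res_ex: "g \<in> H l \<Longrightarrow> Im z \<noteq> 0 \<Longrightarrow> \<exists>f\<in>H l. eqH l (\<lambda>w. T f w - z *s f w) g"
    and T_res_bound: "\<exists>C\<ge>0. \<forall>f\<in>H l. \<forall>g\<in>H l. \<forall>z. Im z \<noteq> 0 \<longrightarrow> eqH l (\<lambda>w. T f w - z *s f w) g \<longrightarrow>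
      normH l f \<le> C * (1 / \<bar>Im z\<bar> + 1 / \<bar>Im z\<bar>\<^sup>2) * normH l g"
begin

lemma T_diff: "f \<in> H l \<Longrightarrow> g \<in> H l \<Longrightarrow> T (\<lambda>w. f w - g w) = (\<lambda>w. T f w - T g w)"
  using T_lin[of f g 1 "-1"] by (simp add: vector_sneg_minus1[symmetric])

lemma T_smult: "f \<in> H l \<Longrightarrow> T (\<lambda>w. c *s f w) = (\<lambda>w. c *s T f w)"
  using T_lin[of f f c 0] by simp

definition Cb :: real where
  "Cb = (SOME C. C \<ge> 0 \<and> (\<forall>f\<in>H l. \<forall>g\<in>H l. \<forall>z. Im z \<noteq> 0 \<longrightarrow> eqH l (\<lambda>w. T f w - z *s f w) g \<longrightarrow>
      normH l f \<le> C * (1 / \<bar>Im z\<bar> + 1 / \<bar>Im z\<bar>\<^sup>2) * normH l g))"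

lemma Cb: "0 \<le> Cb"
  "f \<in> H l \<Longrightarrow> g \<in> H l \<Longrightarrow> Im z \<noteq> 0 \<Longrightarrow> eqH l (\<lambda>w. T f w - z *s f w) g \<Longrightarrow>
      normH l f \<le> Cb * (1 / \<bar>Im z\<bar> + 1 / \<bar>Im z\<bar>\<^sup>2) * normH l g"
  using someI_ex[OF T_res_bound[unfolded Bex_def]] unfolding Cb_def by blast+

definition R :: "complex \<Rightarrow> 'p hfun \<Rightarrow> 'p hfun" where
  "R z g = (SOME f. f \<in> H l \<and> eqH l (\<lambda>w. T f w - z *s f w) g)"

lemma R:
  assumes "g \<in> H l" "Im z \<noteq> 0"
  shows R_H: "R z g \<in> H l" and R_eq: "eqH l (\<lambda>w. T (R z g) w - z *s R z g w) g"
  using someI_ex[OF T_res_ex[OF assms, unfolded Bex_def]] unfolding R_def by blast+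

lemma R_norm: "g \<in> H l \<Longrightarrow> Im z \<noteq> 0 \<Longrightarrow>
    normH l (R z g) \<le> Cb * (1 / \<bar>Im z\<bar> + 1 / \<bar>Im z\<bar>\<^sup>2) * normH l g"
  by (intro Cb R)

lemma shift_inj:
  assumes "f \<in> H l" "Im z \<noteq> 0" "eqH l (\<lambda>w. T f w - z *s f w) (\<lambda>w. 0)"
  shows "eqH l f (\<lambda>w. 0)"
proof -
  have "normH l (\<lambda>w. 0 :: complex ^ 'p) = 0" by (simp add: normH_def)
  then have "normH l f = 0"
    using Cb(2)[OF assms(1) H_zero assms(2,3)] normH_nonneg[of l f] by simp
  then show ?thesis using normH_eq_0_iff[OF assms(1)] by simp
qed

lemma R_unique:
  assumes f: "f \<in> H l" and g: "g \<in> H l" and z: "Im z \<noteq> 0" and eq: "eqH l (\<lambda>w. T f w - z *s f w) g"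
  shows "eqH l (R z g) f"
proof -
  note r = R[OF g z]
  have "eqH l (\<lambda>w. T (\<lambda>w. R z g w - f w) w - z *s (R z g w - f w)) (\<lambda>w. 0)"
    using r(2) eq unfolding eqH_def T_diff[OF r(1) f]
    by eventually_elim (simp add: vector_ssub_ldistrib algebra_simps)
  then have "eqH l (\<lambda>w. R z g w - f w) (\<lambda>w. 0)"
    by (intro shift_inj[OF H_diff[OF r(1) f] z])
  then show ?thesis by (simp add: eqH_diff_iff)
qed

text \<open>The first resolvent identity. It is stated through inner products because
  \<open>R\<close> is a choice of representative and is determined only up to null sets.\<close>

lemma R_diff:
  assumes g: "g \<in> H l" and z: "Im z \<noteq> 0" and z': "Im z' \<noteq> 0" and h: "h \<in> H l"
  shows "innerH l (R z g) h - innerH l (R z' g) h = (z - z') * innerH l (R z (R z' g)) h"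
proof -
  note r = R[OF g z] and r' = R[OF g z']
  let ?f = "\<lambda>w. R z g w - R z' g w"
  have f: "?f \<in> H l" by (rule H_diff[OF r(1) r'(1)])
  let ?k = "\<lambda>w. (z - z') *s R z (R z' g) w"
  note rr = R[OF r'(1) z]
  have k: "?k \<in> H l" by (rule H_smult[OF rr(1)])
  have "eqH l (\<lambda>w. T (\<lambda>w. ?f w - ?k w) w - z *s (?f w - ?k w)) (\<lambda>w. 0)"
    using r(2) r'(2) rr(2) unfolding eqH_def T_diff[OF f k] T_diff[OF r(1) r'(1)] T_smult[OF rr(1)]
  proof eventually_elim
    fix w
    assume 1: "T (R z g) w - z *s R z g w = g w" and 2: "T (R z' g) w - z' *s R z' g w = g w"
      and 3: "T (R z (R z' g)) w - z *s R z (R z' g) w = R z' g w"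
    have "T (R z g) w - T (R z' g) w - (z - z') *s T (R z (R z' g)) w
          - z *s (R z g w - R z' g w - (z - z') *s R z (R z' g) w)
       = (T (R z g) w - z *s R z g w) - (T (R z' g) w - z' *s R z' g w)
         - (z - z') *s (T (R z (R z' g)) w - z *s R z (R z' g) w) + (z - z') *s R z' g w"
      by (simp add: vec_eq_iff algebra_simps)
    then show "T (R z g) w - T (R z' g) w - (z - z') *s T (R z (R z' g)) w
          - z *s (R z g w - R z' g w - (z - z') *s R z (R z' g) w) = 0"
      unfolding 1 2 3 by simp
  qed
  then have "eqH l (\<lambda>w. ?f w - ?k w) (\<lambda>w. 0)" by (rule shift_inj[OF H_diff[OF f k] z])
  then have "eqH l ?f ?k" by (simp add: eqH_diff_iff)
  then have "innerH l ?f h = innerH l ?k h" by (rule innerH_cong[OF f k h h _ eqH_refl])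
  then show ?thesis by (simp only: innerH_diff_left[OF r(1) r'(1) h] innerH_smult_left)
qed

lemma R_inner_bound:
  assumes "g \<in> H l" "h \<in> H l" "0 < y" "y \<le> \<bar>Im z\<bar>"
  shows "norm (innerH l (R z g) h) \<le> Cb * (1 / y + 1 / y\<^sup>2) * normH l g * normH l h"
proof -
  have z: "Im z \<noteq> 0" using assms by auto
  have "norm (innerH l (R z g) h) \<le> normH l (R z g) * normH l h"
    by (rule norm_innerH_le[OF R_H[OF assms(1) z] assms(2)])
  also have "\<dots> \<le> (Cb * (1 / y + 1 / y\<^sup>2) * normH l g) * normH l h"
  proof (rule mult_right_mono)
    have "1 / \<bar>Im z\<bar> + 1 / \<bar>Im z\<bar>\<^sup>2 \<le> 1 / y + 1 / y\<^sup>2"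
      using assms(3,4) by (intro add_mono frac_le power_mono) auto
    then show "normH l (R z g) \<le> Cb * (1 / y + 1 / y\<^sup>2) * normH l g"
      using Cb(1) by (intro order_trans[OF R_norm[OF assms(1) z]] mult_right_mono mult_left_mono) auto
  qed simp
  finally show ?thesis .
qed

lemma R_tendsto:
  assumes g: "g \<in> H l" and h: "h \<in> H l" and z: "Im z0 \<noteq> 0"
  shows "((\<lambda>z. innerH l (R z g) h) \<longlongrightarrow> innerH l (R z0 g) h) (at z0)"
proof -
  define y where "y = \<bar>Im z0\<bar> / 2"
  have y: "0 < y" using z by (simp add: y_def)
  define B where "B = Cb * (1 / y + 1 / y\<^sup>2) * normH l (R z0 g) * normH l h"
  have near: "\<forall>\<^sub>F z in at z0. y \<le> \<bar>Im z\<bar>"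
  proof -
    have "((\<lambda>z. \<bar>Im z\<bar>) \<longlongrightarrow> \<bar>Im z0\<bar>) (at z0)" by (intro tendsto_intros)
    moreover have "y < \<bar>Im z0\<bar>" using z by (simp add: y_def)
    ultimately have "\<forall>\<^sub>F z in at z0. y < \<bar>Im z\<bar>" by (rule order_tendstoD)
    then show ?thesis by eventually_elim simp
  qed
  have "((\<lambda>z. innerH l (R z g) h - innerH l (R z0 g) h) \<longlongrightarrow> 0) (at z0)"
  proof (rule tendsto_0_le[where K = B])
    show "((\<lambda>z. z - z0) \<longlongrightarrow> 0) (at z0)" by (simp add: LIM_zero_iff tendsto_ident_at)
    show "\<forall>\<^sub>F z in at z0. norm (innerH l (R z g) h - innerH l (R z0 g) h) \<le> norm (z - z0) * B"
      using near
    proof eventually_elim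
      fix z' assume zz: "y \<le> \<bar>Im z'\<bar>"
      then have "Im z' \<noteq> 0" using y by auto
      then show "norm (innerH l (R z' g) h - innerH l (R z0 g) h) \<le> norm (z' - z0) * B"
        unfolding R_diff[OF g \<open>Im z' \<noteq> 0\<close> z h] norm_mult B_def
        by (intro mult_left_mono R_inner_bound R_H g h z y zz) simp
    qed
  qed
  then show ?thesis by (simp add: LIM_zero_iff)
qed

text \<open>By the resolvent identity the difference quotient at z_0 is the matrix element of R(z)
  R(z_0), and this is continuous in z.\<close>

lemma R_holomorphic:
  assumes g: "g \<in> H l" and h: "h \<in> H l"
  shows "(\<lambda>z. innerH l (R z g) h) holomorphic_on {z. Im z \<noteq> 0}"
proof -
  have op: "open {z. Im z \<noteq> 0}" by (intro open_Collect_neq continuous_intros)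
  show ?thesis
    unfolding holomorphic_on_open[OF op]
  proof (intro ballI exI)
    fix z0 assume "z0 \<in> {z. Im z \<noteq> 0}"
    then have z0: "Im z0 \<noteq> 0" by simp
    show "((\<lambda>z. innerH l (R z g) h) has_field_derivative innerH l (R z0 (R z0 g)) h) (at z0)"
      unfolding has_field_derivative_iff
    proof (rule Lim_transform_eventually[OF R_tendsto[OF R_H[OF g z0] h z0]])
      have "\<forall>\<^sub>F z in at z0. z \<in> {z. Im z \<noteq> 0}"
        by (rule eventually_at_in_open'[OF op]) (use z0 in simp)
      then show "\<forall>\<^sub>F z in at z0. innerH l (R z (R z0 g)) h = (innerH l (R z g) h - innerH l (R z0 g) h) / (z - z0)"
        using eventually_neq_at_within[of z0 z0 UNIV]
        by eventually_elim (use R_diff[OF g _ z0 h] in simp)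
    qed
  qed
qed

text \<open>Iterating T r = \<zeta> r + f. The terms in T f and T^2 f carry different powers of
  \<zeta>, so weighted sums over cube roots of unity can remove them.\<close>

lemma cube_of_solution:
  assumes r: "r \<in> H l" and f: "f \<in> H l" and eq: "eqH l (\<lambda>w. T r w - \<zeta> *s r w) f"
  shows "AE w in \<Delta> l. T (T (T r)) w = \<zeta> ^ 3 *s r w + \<zeta>\<^sup>2 *s f w + \<zeta> *s T f w + T (T f) w"
proof -
  let ?a = "\<lambda>w. \<zeta> *s r w + 1 *s f w"
  have a: "?a \<in> H l" by (intro H_lin r f)
  have 1: "eqH l (T r) ?a" using eq unfolding eqH_def by eventually_elim (simp add: algebra_simps)
  let ?b = "\<lambda>w. \<zeta> *s T r w + 1 *s T f w"
  have b: "?b \<in> H l" by (intro H_lin T_H r f)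
  have 2: "eqH l (T (T r)) ?b"
    using T_cong[OF T_H[OF r] a 1] unfolding T_lin[OF r f] .
  have 3: "eqH l (T (T (T r))) (\<lambda>w. \<zeta> *s T (T r) w + 1 *s T (T f) w)"
    using T_cong[OF T_H[OF T_H[OF r]] b 2] unfolding T_lin[OF T_H[OF r] T_H[OF f]] .
  show ?thesis
    using 1 2 3 unfolding eqH_def
    by eventually_elim (simp add: vec_eq_iff power2_eq_square power3_eq_cube algebra_simps)
qed

end

section \<open>Rotation by cube roots of unity and continuation across the real axis\<close>

definition \<omega> :: complex where "\<omega> = Complex (-1/2) (sqrt 3 / 2)"

lemma \<omega>_sum: "1 + \<omega> + \<omega>\<^sup>2 = 0"
  by (simp add: \<omega>_def power2_eq_square complex_eq_iff)

lemma \<omega>_cube: "\<omega> ^ 3 = 1"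
proof -
  have "\<omega> ^ 3 - 1 = (\<omega> - 1) * (1 + \<omega> + \<omega>\<^sup>2)" by (simp add: algebra_simps power2_eq_square power3_eq_cube)
  then show ?thesis by (simp add: \<omega>_sum)
qed

lemma norm_\<omega>: "norm \<omega> = 1"
  by (simp add: \<omega>_def cmod_def power2_eq_square)

lemma Im_\<omega>: "Im (\<omega> * z) = sqrt 3 / 2 * Re z - Im z / 2"
  "Im (\<omega>\<^sup>2 * z) = - (sqrt 3 / 2 * Re z) - Im z / 2"
  by (simp_all add: \<omega>_def power2_eq_square)

text \<open>The three sectors \<open>|Im (\<omega>\<^sup>j z)| < |z| / 4\<close> are disjoint.\<close>

lemma sector:
  assumes "\<bar>Im z\<bar> < norm z / 4"
  shows "norm (\<omega> * z) / 4 \<le> \<bar>Im (\<omega> * z)\<bar>" "norm (\<omega>\<^sup>2 * z) / 4 \<le> \<bar>Im (\<omega>\<^sup>2 * z)\<bar>"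
proof -
  have n: "norm z \<le> \<bar>Re z\<bar> + \<bar>Im z\<bar>" by (rule cmod_le)
  have s: "1 \<le> sqrt 3" by simp
  have "\<bar>Re z\<bar> / 2 \<le> \<bar>sqrt 3 / 2 * Re z\<bar>"
    using mult_right_mono[OF s, of "\<bar>Re z\<bar> / 2"] by (simp add: abs_mult)
  then have "norm z / 4 \<le> \<bar>sqrt 3 / 2 * Re z\<bar> - \<bar>Im z\<bar> / 2"
    using n assms by linarith
  then show "norm (\<omega> * z) / 4 \<le> \<bar>Im (\<omega> * z)\<bar>" "norm (\<omega>\<^sup>2 * z) / 4 \<le> \<bar>Im (\<omega>\<^sup>2 * z)\<bar>"
    unfolding Im_\<omega> norm_mult norm_power norm_\<omega> power_one mult_1 by linarith+
qed

context resolvent_operator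
begin

text \<open>The partial fraction decomposition of 3 z^2 / (t^3 - z^3) with T in place of t: this is
  3 z^2 times the resolvent of T^3 at z^3.\<close>

definition Rsum :: "complex \<Rightarrow> 'p hfun \<Rightarrow> 'p hfun" where
  "Rsum z f = (\<lambda>w. 1 *s (1 *s R z f w + \<omega> *s R (\<omega> * z) f w) + \<omega>\<^sup>2 *s R (\<omega>\<^sup>2 * z) f w)"

lemma cube_sum:
  assumes f: "f \<in> H l" and z: "Im z \<noteq> 0" "Im (\<omega> * z) \<noteq> 0" "Im (\<omega>\<^sup>2 * z) \<noteq> 0"
  shows "Rsum z f \<in> H l" "eqH l (T (T (T (Rsum z f)))) (\<lambda>w. z ^ 3 *s Rsum z f w + (3 * z\<^sup>2) *s f w)"
proof -
  define s where "s = Rsum z f"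
  note s_def = s_def[unfolded Rsum_def]
  note r = R[OF f z(1)] R[OF f z(2)] R[OF f z(3)]
  show "Rsum z f \<in> H l" unfolding Rsum_def by (intro H_lin r)
  have 3: "T (T (T s)) = (\<lambda>w. 1 *s (1 *s T (T (T (R z f))) w + \<omega> *s T (T (T (R (\<omega> * z) f))) w)
      + \<omega>\<^sup>2 *s T (T (T (R (\<omega>\<^sup>2 * z) f))) w)"
    unfolding s_def by (simp only: T_lin H_lin T_H r)
  have "eqH l (T (T (T s))) (\<lambda>w. z ^ 3 *s s w + (3 * z\<^sup>2) *s f w)"
    using cube_of_solution[OF r(1) f r(2)] cube_of_solution[OF r(3) f r(4)] cube_of_solution[OF r(5) f r(6)]
    unfolding eqH_def
  proof eventually_elim
    fix w
    assume a: "T (T (T (R z f))) w = z ^ 3 *s R z f w + z\<^sup>2 *s f w + z *s T f w + T (T f) w"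
      "T (T (T (R (\<omega> * z) f))) w = (\<omega> * z) ^ 3 *s R (\<omega> * z) f w + (\<omega> * z)\<^sup>2 *s f w + (\<omega> * z) *s T f w + T (T f) w"
      "T (T (T (R (\<omega>\<^sup>2 * z) f))) w = (\<omega>\<^sup>2 * z) ^ 3 *s R (\<omega>\<^sup>2 * z) f w + (\<omega>\<^sup>2 * z)\<^sup>2 *s f w + (\<omega>\<^sup>2 * z) *s T f w + T (T f) w"
    have sw: "s w = 1 *s (1 *s R z f w + \<omega> *s R (\<omega> * z) f w) + \<omega>\<^sup>2 *s R (\<omega>\<^sup>2 * z) f w"
      by (simp only: s_def)
    have c6: "(\<omega>\<^sup>2) ^ 3 = 1" by (metis \<omega>_cube power_mult mult.commute power_one)
    have c4: "\<omega>\<^sup>2 * \<omega>\<^sup>2 = \<omega>" using \<omega>_cube by (simp add: power2_eq_square power3_eq_cube mult.assoc)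
    have c3: "\<omega> * \<omega>\<^sup>2 = 1" using \<omega>_cube by (simp add: power2_eq_square power3_eq_cube mult.assoc)
    have e1: "1 + \<omega> * \<omega> + \<omega>\<^sup>2 * \<omega>\<^sup>2 = 0"
      unfolding c4 using \<omega>_sum by (simp add: power2_eq_square add_ac)
    have e2: "1 + \<omega> * \<omega>\<^sup>2 + \<omega>\<^sup>2 * (\<omega>\<^sup>2 * \<omega>\<^sup>2) = 3"
      unfolding c4 using c3 by (simp add: mult.commute)
    \<comment> \<open>Collecting terms leaves the sums of 1, \<omega>, \<omega>^2 and their products
      as coefficients; they equal 3 for f and 0 for T f and T^2 f.\<close>
    have "T (T (T s)) w = z ^ 3 *s s w + (z\<^sup>2 * (1 + \<omega> * \<omega>\<^sup>2 + \<omega>\<^sup>2 * (\<omega>\<^sup>2 * \<omega>\<^sup>2))) *s f w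
      + (z * (1 + \<omega> * \<omega> + \<omega>\<^sup>2 * \<omega>\<^sup>2)) *s T f w + (1 + \<omega> + \<omega>\<^sup>2) *s T (T f) w"
      unfolding fun_cong[OF 3] a sw power_mult_distrib \<omega>_cube c6
      by (simp add: vec_eq_iff algebra_simps power2_eq_square)
    also have "\<dots> = z ^ 3 *s s w + (3 * z\<^sup>2) *s f w"
      unfolding e1 e2 \<omega>_sum by (simp add: mult.commute)
    finally show "T (T (T s)) w = z ^ 3 *s s w + (3 * z\<^sup>2) *s f w" .
  qed
  then show "eqH l (T (T (T (Rsum z f)))) (\<lambda>w. z ^ 3 *s Rsum z f w + (3 * z\<^sup>2) *s f w)"
    unfolding s_def Rsum_def .
qed

text \<open>T^3 - z^3 is the product of T - z, T - \<omega>^2 z and T - \<omega> z. Each factor is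
  injective because its point lies off the real axis, so they can be peeled off one at a
  time.\<close>

lemma cube_inj:
  assumes d: "d \<in> H l" and z: "Im z \<noteq> 0" "Im (\<omega> * z) \<noteq> 0" "Im (\<omega>\<^sup>2 * z) \<noteq> 0"
    and eq: "eqH l (T (T (T d))) (\<lambda>w. z ^ 3 *s d w)"
  shows "eqH l d (\<lambda>w. 0)"
proof -
  let ?v = "\<lambda>w. T d w - (\<omega> * z) *s d w"
  have v: "?v \<in> H l" by (intro H_diff T_H H_smult d)
  let ?u = "\<lambda>w. T ?v w - (\<omega>\<^sup>2 * z) *s ?v w"
  have u: "?u \<in> H l" by (intro H_diff T_H H_smult d)
  have c3: "\<omega> * \<omega>\<^sup>2 = 1" using \<omega>_cube by (simp add: power2_eq_square power3_eq_cube mult.assoc)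
  have Tv: "T ?v = (\<lambda>w. T (T d) w - (\<omega> * z) *s T d w)"
    by (simp only: T_diff T_smult T_H H_smult d)
  have Tu: "T ?u = (\<lambda>w. (T (T (T d)) w - (\<omega> * z) *s T (T d) w) - (\<omega>\<^sup>2 * z) *s (T (T d) w - (\<omega> * z) *s T d w))"
    by (simp only: T_diff T_smult T_H H_smult H_diff d)
  have "eqH l (\<lambda>w. T ?u w - z *s ?u w) (\<lambda>w. 0)"
    using eq unfolding eqH_def
  proof eventually_elim
    fix w assume h: "T (T (T d)) w = z ^ 3 *s d w"
    have "T ?u w - z *s ?u w = T (T (T d)) w - (z * (1 + \<omega> + \<omega>\<^sup>2)) *s T (T d) w
        + (z\<^sup>2 * (\<omega> * \<omega>\<^sup>2 + \<omega> + \<omega>\<^sup>2)) *s T d w - (z ^ 3 * (\<omega> * \<omega>\<^sup>2)) *s d w"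
      unfolding fun_cong[OF Tu, of w] fun_cong[OF Tv, of w] by (simp add: vec_eq_iff algebra_simps power2_eq_square power3_eq_cube)
    then show "T ?u w - z *s ?u w = 0" unfolding c3 \<omega>_sum h by simp
  qed
  then have "eqH l ?u (\<lambda>w. 0)" by (rule shift_inj[OF u z(1)])
  then have "eqH l ?v (\<lambda>w. 0)" by (rule shift_inj[OF v z(3)])
  then show ?thesis by (rule shift_inj[OF d z(2)])
qed

text \<open>The expansion of the resolvent at infinity to second order, with exact remainder R(z)
  T^2 f. It bounds z^2 R(z) f for large z up to the explicit terms, of which the one growing with z
  does not depend on T.\<close>

lemma R_expand:
  assumes f: "f \<in> H l" and h: "h \<in> H l" and z: "Im z \<noteq> 0"
  shows "z\<^sup>2 * innerH l (R z f) h = innerH l (R z (T (T f))) h - z * innerH l f h - innerH l (T f) h"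
proof -
  note r = R[OF f z] and r2 = R[OF T_H[OF T_H[OF f]] z]
  let ?a = "\<lambda>w. z\<^sup>2 *s R z f w"
  let ?b = "\<lambda>w. (R z (T (T f)) w - z *s f w) - T f w"
  have H': "?a \<in> H l" "?b \<in> H l" by (intro H_diff H_smult T_H r r2 f)+
  have "eqH l (\<lambda>w. T (\<lambda>w. ?a w - ?b w) w - z *s (?a w - ?b w)) (\<lambda>w. 0)"
    using r(2) r2(2) unfolding eqH_def
  proof eventually_elim
    fix w assume 1: "T (R z f) w - z *s R z f w = f w"
      and 2: "T (R z (T (T f))) w - z *s R z (T (T f)) w = T (T f) w"
    have "T (\<lambda>w. ?a w - ?b w) w = z\<^sup>2 *s T (R z f) w - ((T (R z (T (T f))) w - z *s T f w) - T (T f) w)"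
      by (simp only: T_diff T_smult T_H H_smult H_diff f r r2)
    then have "T (\<lambda>w. ?a w - ?b w) w - z *s (?a w - ?b w)
      = z\<^sup>2 *s (T (R z f) w - z *s R z f w) - (T (R z (T (T f))) w - z *s R z (T (T f)) w) + T (T f) w - z\<^sup>2 *s f w"
      by (simp add: vec_eq_iff algebra_simps power2_eq_square)
    then show "T (\<lambda>w. ?a w - ?b w) w - z *s (?a w - ?b w) = 0" unfolding 1 2 by simp
  qed
  then have "eqH l ?a ?b" using shift_inj[OF H_diff[OF H'] z] by (simp add: eqH_diff_iff)
  then have "innerH l ?a h = innerH l ?b h" by (rule innerH_cong[OF H' h h _ eqH_refl])
  also have "\<dots> = innerH l (R z (T (T f))) h - z * innerH l f h - innerH l (T f) h"
    by (simp only: innerH_diff_left innerH_smult_left H_diff H_smult T_H f h r2)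
  finally show ?thesis by (simp only: innerH_smult_left)
qed

end


text \<open>The functional equation expresses F at a point through its values at the two rotated
  points, and a nonzero point cannot have all three on the real line; so F extends holomorphically
  to the punctured plane. Where z is too close to the real axis for the hypothesis, the two rotated
  points lie in the good sector, which gives the bound 2 K for z^2 F everywhere. Liouville's theorem
  finishes.\<close>

lemma bounded_on_sectors_const:
  fixes F :: "complex \<Rightarrow> complex"
  assumes hol: "F holomorphic_on {z. Im z \<noteq> 0}"
    and sum: "\<And>z. Im z \<noteq> 0 \<Longrightarrow> Im (\<omega> * z) \<noteq> 0 \<Longrightarrow> Im (\<omega>\<^sup>2 * z) \<noteq> 0 \<Longrightarrow>
      F z + \<omega> * F (\<omega> * z) + \<omega>\<^sup>2 * F (\<omega>\<^sup>2 * z) = 0"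
    and bnd: "\<And>z. z \<noteq> 0 \<Longrightarrow> norm z / 4 \<le> \<bar>Im z\<bar> \<Longrightarrow> norm (z\<^sup>2 * F z) \<le> K"
  obtains b where "\<And>z. Im z \<noteq> 0 \<Longrightarrow> z\<^sup>2 * F z = b"
proof -
  \<comment> \<open>The value of F at z that the functional equation forces; it is defined wherever
    both rotated points are off the real axis, in particular at nonzero real z.\<close>
  define Q where "Q = (\<lambda>z. - (\<omega> * F (\<omega> * z)) - \<omega>\<^sup>2 * F (\<omega>\<^sup>2 * z))"
  define Fe where "Fe = (\<lambda>z. if Im z \<noteq> 0 then F z else Q z)"
  define U where "U = {z. Im z \<noteq> 0}"
  define V where "V = {z. Im (\<omega> * z) \<noteq> 0} \<inter> {z. Im (\<omega>\<^sup>2 * z) \<noteq> 0}"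
  have opU: "open U" unfolding U_def by (intro open_Collect_neq continuous_intros)
  have opV: "open V" unfolding V_def by (intro open_Int open_Collect_neq continuous_intros)
  have FeV: "Fe z = Q z" if "z \<in> V" for z
    using sum[of z] that unfolding Fe_def Q_def V_def by (auto simp: algebra_simps eq_neg_iff_add_eq_0)
  have "Fe holomorphic_on U"
    using hol unfolding U_def by (rule holomorphic_transform) (simp add: Fe_def)
  moreover have "Fe holomorphic_on V"
  proof (rule holomorphic_transform)
    have "(\<lambda>z. F (\<omega> * z)) holomorphic_on V" "(\<lambda>z. F (\<omega>\<^sup>2 * z)) holomorphic_on V"
      by (rule holomorphic_on_compose_gen[OF _ hol, unfolded comp_def];
          auto simp: V_def intro!: holomorphic_intros)+
    then show "Q holomorphic_on V" unfolding Q_def by (intro holomorphic_intros)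
  qed (simp add: FeV)
  ultimately have "Fe holomorphic_on U \<union> V" using opU opV by (intro holomorphic_on_Un)
  moreover have "- {0} \<subseteq> U \<union> V"
  proof
    fix z :: complex assume "z \<in> - {0}"
    then have "Im z = 0 \<Longrightarrow> Re z \<noteq> 0" by (simp add: complex_eq_iff)
    then show "z \<in> U \<union> V" unfolding U_def V_def Un_iff Int_iff mem_Collect_eq Im_\<omega> by auto
  qed
  ultimately have hFe: "Fe holomorphic_on - {0}" by (rule holomorphic_on_subset)
  have K0: "0 \<le> K" using order_trans[OF norm_ge_zero bnd[of \<i>]] by simp
  have FeK: "norm (z\<^sup>2 * Fe z) \<le> 2 * K" if z: "z \<noteq> 0" for z
  proof (cases "norm z / 4 \<le> \<bar>Im z\<bar>")
    case True
    then have "Im z \<noteq> 0" using z by auto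
    then show ?thesis using bnd[OF z True] K0 by (simp add: Fe_def)
  next
    case False
    then have sec: "norm (\<omega> * z) / 4 \<le> \<bar>Im (\<omega> * z)\<bar>" "norm (\<omega>\<^sup>2 * z) / 4 \<le> \<bar>Im (\<omega>\<^sup>2 * z)\<bar>"
      using sector[of z] by simp_all
    have nz: "\<omega> * z \<noteq> 0" "\<omega>\<^sup>2 * z \<noteq> 0" using z norm_\<omega> by auto
    have "z \<in> V" using sec nz unfolding V_def by auto
    have m: "norm (z\<^sup>2 * (c * F (c * z))) = norm ((c * z)\<^sup>2 * F (c * z))" if "norm c = 1" for c
      using that by (simp add: norm_mult norm_power)
    have "norm (z\<^sup>2 * Fe z) = norm (- (z\<^sup>2 * (\<omega> * F (\<omega> * z))) - z\<^sup>2 * (\<omega>\<^sup>2 * F (\<omega>\<^sup>2 * z)))"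
      unfolding FeV[OF \<open>z \<in> V\<close>] Q_def by (simp add: algebra_simps)
    also have "\<dots> \<le> norm (z\<^sup>2 * (\<omega> * F (\<omega> * z))) + norm (z\<^sup>2 * (\<omega>\<^sup>2 * F (\<omega>\<^sup>2 * z)))"
      by (rule order_trans[OF norm_triangle_ineq4]) simp
    also have "\<dots> \<le> K + K"
      by (intro add_mono; subst m) (auto simp: norm_\<omega> norm_power intro!: bnd sec nz)
    finally show ?thesis by simp
  qed
  \<comment> \<open>The exponent 3 in place of 2 makes the function tend to 0 at the origin, so the
    value there is known in advance; the price is linear growth, and Liouville yields g z = b
    z.\<close>
  define g where "g = (\<lambda>z. if z = 0 then 0 else z ^ 3 * Fe z)"
  have gb: "norm (g z) \<le> 2 * K * norm z ^ 1" for z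
  proof (cases "z = 0")
    case False
    have "norm (g z) = norm z * norm (z\<^sup>2 * Fe z)"
      using False by (simp add: g_def norm_mult norm_power power2_eq_square power3_eq_cube)
    also have "\<dots> \<le> norm z * (2 * K)" by (rule mult_left_mono[OF FeK[OF False]]) simp
    finally show ?thesis by (simp add: mult_ac)
  qed (simp add: g_def)
  have "g holomorphic_on UNIV"
    unfolding g_def
  proof (rule removable_singularity)
    show "(\<lambda>z. z ^ 3 * Fe z) holomorphic_on UNIV - {0}"
      using hFe by (intro holomorphic_intros) (simp add: Compl_eq_Diff_UNIV)
    have "((\<lambda>z. g z) \<longlongrightarrow> 0) (at 0)"
    proof (rule tendsto_0_le[where K = "2 * K"])
      show "((\<lambda>z :: complex. z) \<longlongrightarrow> 0) (at 0)" by (rule tendsto_ident_at)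
      show "\<forall>\<^sub>F z in at 0. norm (g z) \<le> norm z * (2 * K)" using gb by (simp add: mult_ac)
    qed
    moreover have "\<forall>\<^sub>F z in at 0. g z = z ^ 3 * Fe z"
      using eventually_neq_at_within[of "0::complex" 0 UNIV] by eventually_elim (simp add: g_def)
    ultimately show "(\<lambda>z. z ^ 3 * Fe z) \<midarrow>0\<rightarrow> 0" by (rule Lim_transform_eventually)
  qed simp
  note L = Liouville_polynomial[OF this gb]
  define b where "b = deriv g 0"
  have "g z = b * z" for z
    using L[where \<xi> = z] by (simp add: b_def g_def)
  then have "z\<^sup>2 * F z = b" if "Im z \<noteq> 0" for z
  proof -
    have "z \<noteq> 0" using that by auto
    then have "z * (z\<^sup>2 * F z) = z * b"
      using \<open>g z = b * z\<close> that by (simp add: g_def Fe_def power2_eq_square power3_eq_cube mult_ac)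
    then show ?thesis using \<open>z \<noteq> 0\<close> by simp
  qed
  then show ?thesis by (rule that)
qed

text \<open>
  A function \<open>F(z) = \<langle>(T - z)\<^sup>-\<^sup>1 f - (T' - z)\<^sup>-\<^sup>1 f, h\<rangle>\<close> with \<open>T\<^sup>3 = T'\<^sup>3\<close> satisfies
  \<open>F(z) + \<omega> F(\<omega>z) + \<omega>\<^sup>2 F(\<omega>\<^sup>2z) = 0\<close>, which continues it across the real axis away from 0,
  and the resolvent bounds make \<open>z\<^sup>2 F(z)\<close> constant.
\<close>

theorem cube_root_unique:
  assumes T: "resolvent_operator l T" and T': "resolvent_operator l T'"
    and cube: "\<And>f. f \<in> H l \<Longrightarrow> eqH l (T (T (T f))) (T' (T' (T' f)))"
    and g: "g \<in> H l"
  shows "eqH l (T g) (T' g)"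
proof -
  interpret A: resolvent_operator l T by (rule T)
  interpret B: resolvent_operator l T' by (rule T')
  define X where "X = (\<lambda>f w. T f w - T' f w)"
  have X_H: "X f \<in> H l" if "f \<in> H l" for f
    unfolding X_def by (intro H_diff A.T_H B.T_H that)
  \<comment> \<open>The operator identity z^2 (R(z) - R'(z)) = - (T - T'), tested against h.\<close>
  have main: "z\<^sup>2 * (innerH l (A.R z f) h - innerH l (B.R z f) h) = - innerH l (X f) h"
    if f: "f \<in> H l" and h: "h \<in> H l" and z: "Im z \<noteq> 0" for f h z
  proof -
    define F where "F = (\<lambda>z. innerH l (A.R z f) h - innerH l (B.R z f) h)"
    have hol: "F holomorphic_on {z. Im z \<noteq> 0}"
      unfolding F_def by (intro holomorphic_intros A.R_holomorphic B.R_holomorphic f h)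
    \<comment> \<open>Both weighted resolvent sums solve T^3 s = z^3 s + 3 z^2 f, by equality of the
      cubes, and \<open>cube_inj\<close> makes the solution unique.\<close>
    have sum: "F z + \<omega> * F (\<omega> * z) + \<omega>\<^sup>2 * F (\<omega>\<^sup>2 * z) = 0"
      if z: "Im z \<noteq> 0" "Im (\<omega> * z) \<noteq> 0" "Im (\<omega>\<^sup>2 * z) \<noteq> 0" for z
    proof -
      define s where "s = A.Rsum z f"
      define s' where "s' = B.Rsum z f"
      note a = A.cube_sum[OF f z, folded s_def] and b = B.cube_sum[OF f z, folded s'_def]
      have "eqH l (T (T (T (\<lambda>w. s w - s' w)))) (\<lambda>w. z ^ 3 *s (s w - s' w))"
        using a(2) b(2) cube[OF b(1)] unfolding eqH_def
      proof eventually_elim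
        fix w assume *: "T (T (T s)) w = z ^ 3 *s s w + (3 * z\<^sup>2) *s f w"
          "T' (T' (T' s')) w = z ^ 3 *s s' w + (3 * z\<^sup>2) *s f w"
          "T (T (T s')) w = T' (T' (T' s')) w"
        have "T (T (T (\<lambda>w. s w - s' w))) w = T (T (T s)) w - T (T (T s')) w"
          by (simp only: A.T_diff A.T_H a(1) b(1))
        then show "T (T (T (\<lambda>w. s w - s' w))) w = z ^ 3 *s (s w - s' w)"
          unfolding * by (simp add: vector_ssub_ldistrib)
      qed
      then have "eqH l (\<lambda>w. s w - s' w) (\<lambda>w. 0)" by (rule A.cube_inj[OF H_diff[OF a(1) b(1)] z])
      then have "eqH l s s'" by (simp add: eqH_diff_iff)
      then have "innerH l s h = innerH l s' h" by (rule innerH_cong[OF a(1) b(1) h h _ eqH_refl])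
      then show ?thesis
        unfolding s_def s'_def F_def A.Rsum_def B.Rsum_def
        by (simp only: innerH_add_left innerH_smult_left H_add H_smult h
            A.R_H[OF f z(1)] A.R_H[OF f z(2)] A.R_H[OF f z(3)] B.R_H[OF f z(1)] B.R_H[OF f z(2)] B.R_H[OF f z(3)])
          (simp add: algebra_simps)
    qed
    \<comment> \<open>In the sector |Im z| \<ge> |z| / 4 the resolvent bound is 4 / |z| + 16 /
      |z|^2. For |z| \<le> 1 this is multiplied by |z|^2, for |z| > 1 it is used as it stands on the
      remainder of the expansion; in both cases 4 + 16 = 20 suffices.\<close>
    define C where "C = 20 * (A.Cb * normH l f * normH l h + B.Cb * normH l f * normH l h)"
    define C' where "C' = 20 * (A.Cb * normH l (T (T f)) * normH l h + B.Cb * normH l (T' (T' f)) * normH l h)"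
    have F_expand: "z\<^sup>2 * F z = innerH l (A.R z (T (T f))) h - innerH l (B.R z (T' (T' f))) h - innerH l (X f) h"
      if z: "Im z \<noteq> 0" for z
      unfolding F_def X_def innerH_diff_left[OF A.T_H[OF f] B.T_H[OF f] h] right_diff_distrib
        A.R_expand[OF f h z] B.R_expand[OF f h z] by simp
    have bnd: "norm (z\<^sup>2 * F z) \<le> C + C' + norm (innerH l (X f) h)"
      if z: "z \<noteq> 0" and sec: "norm z / 4 \<le> \<bar>Im z\<bar>" for z
    proof -
      have y: "0 < norm z / 4" using z by simp
      have Im: "Im z \<noteq> 0" using sec y by auto
      have pos: "0 \<le> A.Cb * normH l k * normH l h" "0 \<le> B.Cb * normH l k * normH l h" for k :: "'a hfun"
        using A.Cb(1) B.Cb(1) by simp_all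
      have C0: "0 \<le> C" "0 \<le> C'" unfolding C_def C'_def using pos by simp_all
      let ?m = "1 / (norm z / 4) + 1 / (norm z / 4)\<^sup>2"
      have m: "?m = 4 / norm z + 16 / (norm z)\<^sup>2" by (simp add: power_divide)
      show ?thesis
      proof (cases "norm z \<le> 1")
        case True
        have "norm (z\<^sup>2 * F z) \<le> (norm z)\<^sup>2 * (norm (innerH l (A.R z f) h) + norm (innerH l (B.R z f) h))"
          unfolding F_def norm_mult norm_power by (intro mult_left_mono norm_triangle_ineq4) simp
        also have "\<dots> \<le> (norm z)\<^sup>2 * (A.Cb * ?m * normH l f * normH l h + B.Cb * ?m * normH l f * normH l h)"
          by (intro mult_left_mono add_mono A.R_inner_bound B.R_inner_bound f h y sec) simp
        also have "\<dots> = ((norm z)\<^sup>2 * ?m) * (A.Cb * normH l f * normH l h + B.Cb * normH l f * normH l h)"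
          by (simp add: algebra_simps)
        also have "\<dots> \<le> 20 * (A.Cb * normH l f * normH l h + B.Cb * normH l f * normH l h)"
        proof (rule mult_right_mono)
          have "(norm z)\<^sup>2 * ?m = 4 * norm z + 16"
            unfolding m using z by (simp add: distrib_left power2_eq_square)
          then show "(norm z)\<^sup>2 * ?m \<le> 20" using True by simp
        qed (use pos[of f] in simp)
        finally show ?thesis using C0 norm_ge_zero[of "innerH l (X f) h"] unfolding C_def by linarith
      next
        case False
        have m20: "?m \<le> 20"
        proof -
          have "4 / norm z \<le> 4" "16 / (norm z)\<^sup>2 \<le> 16"
            using False one_le_power[of "norm z" 2] by (simp_all add: divide_le_eq)
          then show ?thesis unfolding m by linarith
        qed
        have "norm (z\<^sup>2 * F z) \<le> norm (innerH l (A.R z (T (T f))) h) + norm (innerH l (B.R z (T' (T' f))) h) + norm (innerH l (X f) h)"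
          unfolding F_expand[OF Im] by (meson add_right_mono norm_triangle_ineq4 order_trans)
        moreover have "norm (innerH l (A.R z (T (T f))) h) \<le> 20 * (A.Cb * normH l (T (T f)) * normH l h)"
        proof (rule order_trans)
          show "norm (innerH l (A.R z (T (T f))) h) \<le> A.Cb * ?m * normH l (T (T f)) * normH l h"
            by (intro A.R_inner_bound A.T_H f h y sec)
          show "A.Cb * ?m * normH l (T (T f)) * normH l h \<le> 20 * (A.Cb * normH l (T (T f)) * normH l h)"
            using mult_right_mono[OF m20 pos(1)[of "T (T f)"]] by (simp only: mult_ac)
        qed
        moreover have "norm (innerH l (B.R z (T' (T' f))) h) \<le> 20 * (B.Cb * normH l (T' (T' f)) * normH l h)"
        proof (rule order_trans)
          show "norm (innerH l (B.R z (T' (T' f))) h) \<le> B.Cb * ?m * normH l (T' (T' f)) * normH l h"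
            by (intro B.R_inner_bound B.T_H f h y sec)
          show "B.Cb * ?m * normH l (T' (T' f)) * normH l h \<le> 20 * (B.Cb * normH l (T' (T' f)) * normH l h)"
            using mult_right_mono[OF m20 pos(2)[of "T' (T' f)"]] by (simp only: mult_ac)
        qed
        ultimately show ?thesis using C0(1) unfolding C'_def distrib_left by linarith
      qed
    qed
    obtain b where b: "\<And>z. Im z \<noteq> 0 \<Longrightarrow> z\<^sup>2 * F z = b"
      using bounded_on_sectors_const[OF hol sum bnd] by blast
    have "b = - innerH l (X f) h"
    proof -
      define c where "c = A.Cb * normH l (T (T f)) * normH l h + B.Cb * normH l (T' (T' f)) * normH l h"
      \<comment> \<open>The constant is identified along z = i y as y tends to infinity, where the
        two remainders of the expansion tend to 0.\<close>
      have le: "norm (b + innerH l (X f) h) \<le> (1 / y + 1 / y\<^sup>2) * c" if y: "0 < y" for y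
      proof -
        let ?z = "Complex 0 y"
        have Im: "Im ?z \<noteq> 0" and yz: "y \<le> \<bar>Im ?z\<bar>" using y by simp_all
        have eq: "b + innerH l (X f) h = innerH l (A.R ?z (T (T f))) h - innerH l (B.R ?z (T' (T' f))) h"
          using F_expand[OF Im] b[OF Im] by simp
        have "norm (b + innerH l (X f) h) \<le> norm (innerH l (A.R ?z (T (T f))) h) + norm (innerH l (B.R ?z (T' (T' f))) h)"
          unfolding eq by (rule norm_triangle_ineq4)
        also have "\<dots> \<le> A.Cb * (1 / y + 1 / y\<^sup>2) * normH l (T (T f)) * normH l h
            + B.Cb * (1 / y + 1 / y\<^sup>2) * normH l (T' (T' f)) * normH l h"
          by (rule add_mono[OF A.R_inner_bound[OF A.T_H[OF A.T_H[OF f]] h y yz]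
                B.R_inner_bound[OF B.T_H[OF B.T_H[OF f]] h y yz]])
        also have "\<dots> = (1 / y + 1 / y\<^sup>2) * c" by (simp only: c_def algebra_simps)
        finally show ?thesis .
      qed
      have i: "((\<lambda>y :: real. inverse y) \<longlongrightarrow> 0) at_top"
        by (rule tendsto_inverse_0_at_top[OF filterlim_ident])
      have lim: "((\<lambda>y :: real. (inverse y + inverse y * inverse y) * c) \<longlongrightarrow> (0 + 0 * 0) * c) at_top"
        by (rule tendsto_mult[OF tendsto_add[OF i tendsto_mult[OF i i]] tendsto_const])
      have "\<forall>\<^sub>F y in at_top. norm (b + innerH l (X f) h) \<le> (inverse y + inverse y * inverse y) * c"
        using eventually_gt_at_top[of 0]
      proof eventually_elim
        fix y :: real assume "0 < y"
        from le[OF this] show "norm (b + innerH l (X f) h) \<le> (inverse y + inverse y * inverse y) * c"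
          by (simp add: divide_inverse power2_eq_square)
      qed
      then have "norm (b + innerH l (X f) h) \<le> (0 + 0 * 0) * c"
        by (rule tendsto_lowerbound[OF lim]) simp
      then show ?thesis by (simp add: eq_neg_iff_add_eq_0)
    qed
    then show ?thesis using b[OF z] by (simp add: F_def)
  qed
  \<comment> \<open>Apply \<open>main\<close> to f = (T' - z) g, for which R'(z) f = g, and then
    apply T - z. The terms z^2 X g on the two sides cancel, and what is left is an identity linear
    in z.\<close>
  have step: "eqH l (T (X (T' g))) (\<lambda>w. z *s (T (X g) w + X (T' g) w))" if z: "Im z \<noteq> 0" for z
  proof -
    let ?f = "\<lambda>w. T' g w - z *s g w"
    have f: "?f \<in> H l" by (intro H_diff B.T_H H_smult g)
    note r = A.R[OF f z]
    have br: "eqH l (B.R z ?f) g" by (rule B.R_unique[OF g f z eqH_refl])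
    let ?a = "\<lambda>w. z\<^sup>2 *s (A.R z ?f w - g w)" and ?b = "\<lambda>w. (-1) *s X ?f w"
    have ab: "?a \<in> H l" "?b \<in> H l" by (intro H_smult H_diff r(1) g X_H f)+
    have "eqH l ?a ?b"
    proof (rule eqH_if_innerH[OF ab])
      fix h :: "'a hfun" assume h: "h \<in> H l"
      have "innerH l (B.R z ?f) h = innerH l g h"
        by (rule innerH_cong[OF B.R_H[OF f z] g h h br eqH_refl])
      then show "innerH l ?a h = innerH l ?b h"
        using main[OF f h z] by (simp only: innerH_smult_left innerH_diff_left[OF r(1) g h] mult_minus_left mult_1_left)
    qed
    then have "eqH l (T ?a) (T ?b)" by (rule A.T_cong[OF ab])
    moreover have "T ?a = (\<lambda>w. z\<^sup>2 *s (T (A.R z ?f) w - T g w))"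
      by (simp only: A.T_smult A.T_diff H_diff r(1) g)
    moreover have Xf: "X ?f = (\<lambda>w. X (T' g) w - z *s X g w)"
      unfolding X_def
      by (simp only: A.T_smult A.T_diff B.T_smult B.T_diff H_smult B.T_H g) (simp add: vec_eq_iff fun_eq_iff algebra_simps)
    moreover have "T (X ?f) = (\<lambda>w. T (X (T' g)) w - z *s T (X g) w)"
      unfolding Xf by (simp only: A.T_smult A.T_diff H_smult X_H B.T_H g)
    moreover have "T ?b = (\<lambda>w. (-1) *s T (X ?f) w)" by (rule A.T_smult[OF X_H[OF f]])
    ultimately have *: "eqH l (\<lambda>w. z\<^sup>2 *s (T (A.R z ?f) w - T g w)) (\<lambda>w. (-1) *s (T (X (T' g)) w - z *s T (X g) w))"
      "eqH l (\<lambda>w. z\<^sup>2 *s (A.R z ?f w - g w)) (\<lambda>w. (-1) *s (X (T' g) w - z *s X g w))"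
      using \<open>eqH l ?a ?b\<close> by simp_all
    show ?thesis
      using * r(2) unfolding eqH_def
    proof eventually_elim
      fix w
      assume 1: "z\<^sup>2 *s (T (A.R z ?f) w - T g w) = (-1) *s (T (X (T' g)) w - z *s T (X g) w)"
        and 2: "z\<^sup>2 *s (A.R z ?f w - g w) = (-1) *s (X (T' g) w - z *s X g w)"
        and 3: "T (A.R z ?f) w - z *s A.R z ?f w = T' g w - z *s g w"
      have "z\<^sup>2 *s (T (A.R z ?f) w - T g w) - z *s (z\<^sup>2 *s (A.R z ?f w - g w))
          = z\<^sup>2 *s ((T (A.R z ?f) w - z *s A.R z ?f w) - (T g w - z *s g w))"
        by (simp add: vec_eq_iff algebra_simps)
      also have "\<dots> = - (z\<^sup>2 *s X g w)" unfolding 3 by (simp add: X_def vec_eq_iff algebra_simps)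
      finally have "(-1) *s (T (X (T' g)) w - z *s T (X g) w) - z *s ((-1) *s (X (T' g) w - z *s X g w)) = - (z\<^sup>2 *s X g w)"
        unfolding 1 2 .
      then show "T (X (T' g)) w = z *s (T (X g) w + X (T' g) w)"
        by (simp add: vec_eq_iff algebra_simps power2_eq_square)
    qed
  qed
  have XT: "X (T' g) \<in> H l" "X g \<in> H l" by (intro X_H B.T_H g)+
  \<comment> \<open>The left side does not depend on z, so comparing z = i with z = - i makes both
    sides vanish.\<close>
  have 1: "eqH l (T (X (T' g))) (\<lambda>w. 0)" and 2: "eqH l (\<lambda>w. T (X g) w + X (T' g) w) (\<lambda>w. 0)"
  proof -
    have i: "Im \<i> \<noteq> 0" "Im (- \<i>) \<noteq> 0" by simp_all
    have "AE w in \<Delta> l. T (X (T' g)) w = 0 \<and> T (X g) w + X (T' g) w = 0"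
      using step[OF i(1)] step[OF i(2)] unfolding eqH_def
    proof eventually_elim
      fix w assume a: "T (X (T' g)) w = \<i> *s (T (X g) w + X (T' g) w)"
        and b: "T (X (T' g)) w = - \<i> *s (T (X g) w + X (T' g) w)"
      define x where "x = T (X g) w + X (T' g) w"
      have "\<i> *s x = - \<i> *s x" using a b by (simp only: x_def)
      then have "x = 0" by (simp add: vec_eq_iff)
      then show "T (X (T' g)) w = 0 \<and> T (X g) w + X (T' g) w = 0" using a by (simp add: x_def)
    qed
    then show "eqH l (T (X (T' g))) (\<lambda>w. 0)" "eqH l (\<lambda>w. T (X g) w + X (T' g) w) (\<lambda>w. 0)"
      unfolding eqH_def by (auto elim: eventually_mono)
  qed
  \<comment> \<open>T (X T' g) = 0 gives X T' g = 0, then T X g = 0 and X g = 0: injectivity is used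
    twice, and this is the point at which nilpotent differences are ruled out.\<close>
  have "eqH l (X (T' g)) (\<lambda>w. 0)" by (rule A.T_inj[OF XT(1) 1])
  with 2 have "eqH l (T (X g)) (\<lambda>w. 0)"
    unfolding eqH_def by eventually_elim simp
  then have "eqH l (X g) (\<lambda>w. 0)" by (rule A.T_inj[OF XT(2)])
  then show ?thesis unfolding X_def by (simp add: eqH_diff_iff)
qed

section \<open>The model family\<close>

sublocale model \<subseteq> resolvent_operator l Bop
proof
  show "\<exists>C\<ge>0. \<forall>f\<in>H l. \<forall>g\<in>H l. \<forall>z. Im z \<noteq> 0 \<longrightarrow> eqH l (\<lambda>w. Bop f w - z *s f w) g \<longrightarrow>
      normH l f \<le> C * (1 / \<bar>Im z\<bar> + 1 / \<bar>Im z\<bar>\<^sup>2) * normH l g"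
    by (rule resolvent_bound) blast
  show "\<exists>f\<in>H l. eqH l (\<lambda>w. Bop f w - z *s f w) g" if "g \<in> H l" "Im z \<noteq> 0" for g z
    using resolvent_exists[OF that] by blast
qed (fact Bop_H Bop_lin Bop_cong Bop_injective)+

section \<open>The concrete block matrices and the adjoints of the model\<close>

lemma matrix_eqI:
  fixes M N :: "complex ^ 'n ^ 'm"
  shows "(\<And>i j. M $ i $ j = N $ i $ j) \<Longrightarrow> M = N"
  by (simp add: vec_eq_iff)

lemma sum_if_delta: "(\<Sum>k\<in>(UNIV::'a::finite set). g k * (if k = j \<and> Q j k then 1 else 0)) = (if Q j j then g j else (0::complex))"
proof -
  have "g k * (if k = j \<and> Q j k then 1 else 0) = (if k = j then (if Q j j then g j else 0) else 0)" for k
    by auto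
  then show ?thesis by simp
qed

lemma mult_J1:
  fixes M :: "('m::{finite,linorder}) cmat"
  shows "(M ** J1 r) $ i $ j = (if pos j < r then M $ i $ j else 0)"
  using sum_if_delta[of "\<lambda>k. M $ i $ k" j "\<lambda>j k. pos k < r"]
  by (simp add: matrix_matrix_mult_def J1_def)

lemma mult_J2:
  fixes M :: "('m::{finite,linorder}) cmat"
  shows "(M ** J2 r) $ i $ j = (if r \<le> pos j then M $ i $ j else 0)"
  using sum_if_delta[of "\<lambda>k. M $ i $ k" j "\<lambda>j k. r \<le> pos k"]
  by (simp add: matrix_matrix_mult_def J2_def)

lemma J1_mult:
  fixes M :: "('m::{finite,linorder}) cmat"
  shows "(J1 r ** M) $ i $ j = (if pos i < r then M $ i $ j else 0)"
proof -
  have "(if i = k \<and> pos i < r then 1 else 0) * M $ k $ j = (if k = i then (if pos i < r then M $ i $ j else 0) else 0)" for k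
    by auto
  then show ?thesis by (simp add: matrix_matrix_mult_def J1_def)
qed

lemma J2_mult:
  fixes M :: "('m::{finite,linorder}) cmat"
  shows "(J2 r ** M) $ i $ j = (if r \<le> pos i then M $ i $ j else 0)"
proof -
  have "(if i = k \<and> r \<le> pos i then 1 else 0) * M $ k $ j = (if k = i then (if r \<le> pos i then M $ i $ j else 0) else 0)" for k
    by auto
  then show ?thesis by (simp add: matrix_matrix_mult_def J2_def)
qed

lemma J1_nth: "J1 r $ i $ j = (if i = j \<and> pos i < r then 1 else 0)"
  and J2_nth: "J2 r $ i $ j = (if i = j \<and> r \<le> pos i then 1 else 0)"
  by (simp_all add: J1_def J2_def)

lemma matrix_mult_diff_left: "(A - B) ** (C :: complex ^ 'c ^ 'b) = A ** C - B ** C"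
  by (vector matrix_matrix_mult_def sum_subtractf left_diff_distrib)

lemma matrix_mult_diff_right: "(C :: complex ^ 'b ^ 'c) ** (A - B) = C ** A - C ** B"
  by (vector matrix_matrix_mult_def sum_subtractf right_diff_distrib)

lemma model_of_kernel:
  fixes P :: "real \<Rightarrow> complex ^ ('m::{finite,linorder}) ^ ('p::finite)"
  assumes l: "0 < l" and K: "model_kernel l r P" and S0: "lower_left_block r S0"
  shows "model l P (J1 r - J2 r) (J2 r) S0"
proof
  fix w assume w: "w \<in> {-l..l}"
  show "trace (hconj (P w) ** P w) = 1" using K w by (simp add: model_kernel_def)
  have c: "hconj (P w) ** P w ** J1 r = J1 r ** (hconj (P w) ** P w)" using K w by (simp add: model_kernel_def)
  then have e: "(hconj (P w) ** P w ** J1 r) $ i $ j = (J1 r ** (hconj (P w) ** P w)) $ i $ j" for i j by simp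
  \<comment> \<open>Commuting with J_1 kills the entries of \<Pi>^*\<Pi> between the two blocks, and
    this is equally the condition for commuting with J_2.\<close>
  show E: "hconj (P w) ** P w ** J2 r = J2 r ** (hconj (P w) ** P w)"
  proof (rule matrix_eqI)
    fix i j
    show "(hconj (P w) ** P w ** J2 r) $ i $ j = (J2 r ** (hconj (P w) ** P w)) $ i $ j"
      using e[of i j] unfolding mult_J1 mult_J2 J1_mult J2_mult by (auto split: if_splits)
  qed
  show "hconj (P w) ** P w ** (J1 r - J2 r) = (J1 r - J2 r) ** (hconj (P w) ** P w)"
    by (simp only: matrix_mult_diff_left matrix_mult_diff_right c E)
next
  have z: "S0 $ i $ j = 0" if "\<not> (r \<le> pos i \<and> pos j < r)" for i j
    using S0 that by (simp add: lower_left_block_def)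
  show "J2 r ** S0 = S0" by (rule matrix_eqI) (auto simp: J2_mult z)
  show "S0 ** (J1 r - J2 r) = S0"
    unfolding matrix_mult_diff_right by (rule matrix_eqI) (auto simp: mult_J1 mult_J2 z)
  show "S0 ** J2 r = 0" by (rule matrix_eqI) (auto simp: mult_J2 z)
  show "hconj (J1 r - J2 r) = J1 r - J2 r" by (rule matrix_eqI) (auto simp: J1_nth J2_nth)
  show "(J1 r - J2 r) ** (J1 r - J2 r) = mat 1"
    unfolding matrix_mult_diff_right
    by (rule matrix_eqI) (auto simp: mult_J1 mult_J2 J1_nth J2_nth mat_def)
  show "J2 r ** (J1 r - J2 r) = (J1 r - J2 r) ** J2 r"
    unfolding matrix_mult_diff_right
    by (rule matrix_eqI) (auto simp: mult_J1 mult_J2 J1_nth J2_nth)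
  fix x :: "complex ^ ('m::{finite,linorder})"
  have "(x v* J2 r) $ j = (if r \<le> pos j then x $ j else 0)" for j
    using sum_if_delta[of "\<lambda>k. x $ k" j "\<lambda>j k. r \<le> pos k"]
    by (simp add: vector_matrix_mult_def J2_def)
  then show "norm (x v* J2 r) \<le> norm x"
    by (intro norm_le_componentwise_cart) simp
qed (use l K in \<open>simp_all add: model_kernel_def\<close>)

text \<open>The adjoint is a choice, so any map with the adjoint property transfers that property to
  the chosen one. The witness and the chosen map need agree only up to null sets.\<close>

lemma adjHC_works:
  assumes "\<And>u. S u \<in> H l" "\<And>f u. f \<in> H l \<Longrightarrow> cdot (T f) u = innerH l f (S u)"
  shows "adjHC l T u \<in> H l" "f \<in> H l \<Longrightarrow> cdot (T f) u = innerH l f (adjHC l T u)"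
proof -
  have "\<exists>S. (\<forall>u. S u \<in> H l) \<and> (\<forall>f\<in>H l. \<forall>u. cdot (T f) u = innerH l f (S u))"
    using assms by blast
  from someI_ex[OF this] show "adjHC l T u \<in> H l" "f \<in> H l \<Longrightarrow> cdot (T f) u = innerH l f (adjHC l T u)"
    unfolding adjHC_def by blast+
qed

lemma adjH_works:
  assumes "\<And>g. g \<in> H l \<Longrightarrow> S g \<in> H l" "\<And>f g. f \<in> H l \<Longrightarrow> g \<in> H l \<Longrightarrow> innerH l (T f) g = innerH l f (S g)"
  shows "g \<in> H l \<Longrightarrow> adjH l T g \<in> H l"
    "f \<in> H l \<Longrightarrow> g \<in> H l \<Longrightarrow> innerH l (T f) g = innerH l f (adjH l T g)"
proof -
  have "\<exists>S. (\<forall>g\<in>H l. S g \<in> H l) \<and> (\<forall>f\<in>H l. \<forall>g\<in>H l. innerH l (T f) g = innerH l f (S g))"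
    using assms by blast
  from someI_ex[OF this] show "g \<in> H l \<Longrightarrow> adjH l T g \<in> H l"
    "f \<in> H l \<Longrightarrow> g \<in> H l \<Longrightarrow> innerH l (T f) g = innerH l f (adjH l T g)"
    unfolding adjH_def by blast+
qed

lemma eqH_if_innerH_right:
  fixes f g :: "('p::finite) hfun"
  assumes "f \<in> H l" "g \<in> H l" "\<And>h. h \<in> H l \<Longrightarrow> innerH l h f = innerH l h g"
  shows "eqH l f g"
proof (rule eqH_if_innerH[OF assms(1,2)])
  fix h :: "'p hfun" assume "h \<in> H l"
  then show "innerH l f h = innerH l g h"
    using assms(3)[of h] innerH_commute[of l f h] innerH_commute[of l g h] by simp
qed

text \<open>The two one-sided integrals of the model, in terms of the indefinite integral and the
  total. The tail from w and the complement of the initial piece overlap only in the point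
  w.\<close>

lemma set_integral_vmult:
  fixes f :: "real \<Rightarrow> complex ^ 'p" and M :: "complex ^ 'q ^ 'm"
  assumes "integrable (\<Delta> l) (\<lambda>\<xi>. f \<xi> v* P \<xi>)"
  shows "w \<in> {-l..l} \<Longrightarrow> (LINT \<xi>:{-l..w}|lebesgue. f \<xi> v* (P \<xi> ** M)) = cum l (\<lambda>\<xi>. f \<xi> v* P \<xi>) w v* M"
    and "w \<in> {-l..l} \<Longrightarrow> (LINT \<xi>:{w..l}|lebesgue. f \<xi> v* (P \<xi> ** M))
      = ((LINT \<xi>|\<Delta> l. f \<xi> v* P \<xi>) - cum l (\<lambda>\<xi>. f \<xi> v* P \<xi>) w) v* M"
proof -
  let ?h = "\<lambda>\<xi>. f \<xi> v* P \<xi>"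
  have i: "integrable (\<Delta> l) (\<lambda>\<xi>. f \<xi> v* (P \<xi> ** M))"
    using integrable_bounded_linear[OF bounded_linear_vector_matrix_mult assms, of M]
    by (simp add: vector_matrix_mul_assoc)
  have c: "cum l (\<lambda>\<xi>. f \<xi> v* (P \<xi> ** M)) w = cum l ?h w v* M" for w
    using cum_bounded_linear[OF bounded_linear_vector_matrix_mult assms, of M w]
    by (simp add: vector_matrix_mul_assoc)
  have t: "(LINT \<xi>|\<Delta> l. f \<xi> v* (P \<xi> ** M)) = (LINT \<xi>|\<Delta> l. ?h \<xi>) v* M"
    using integral_bounded_linear[OF bounded_linear_vector_matrix_mult assms, of M]
    by (simp add: vector_matrix_mul_assoc)
  { assume w: "w \<in> {-l..l}"
    have "(LINT \<xi>:{-l..w}|lebesgue. f \<xi> v* (P \<xi> ** M)) = cum l (\<lambda>\<xi>. f \<xi> v* (P \<xi> ** M)) w"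
      unfolding cum_def set_lebesgue_integral_def integral_restrict_space[OF Icc_sets_lebesgue]
      by (rule Bochner_Integration.integral_cong[OF refl]) (use w in \<open>auto simp: indicator_def\<close>)
    then show "(LINT \<xi>:{-l..w}|lebesgue. f \<xi> v* (P \<xi> ** M)) = cum l ?h w v* M" by (simp only: c) }
  { assume w: "w \<in> {-l..l}"
    have "(LINT \<xi>:{w..l}|lebesgue. f \<xi> v* (P \<xi> ** M)) = (LINT \<xi>|\<Delta> l. indicator {w..} \<xi> *\<^sub>R (f \<xi> v* (P \<xi> ** M)))"
      unfolding set_lebesgue_integral_def integral_restrict_space[OF Icc_sets_lebesgue]
      by (rule Bochner_Integration.integral_cong[OF refl]) (use w in \<open>auto simp: indicator_def\<close>)
    also have "\<dots> = (LINT \<xi>|\<Delta> l. f \<xi> v* (P \<xi> ** M) - indicator {..w} \<xi> *\<^sub>R (f \<xi> v* (P \<xi> ** M)))"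
    proof (rule integral_cong_AE)
      show "AE \<xi> in \<Delta> l. indicator {w..} \<xi> *\<^sub>R (f \<xi> v* (P \<xi> ** M))
          = f \<xi> v* (P \<xi> ** M) - indicator {..w} \<xi> *\<^sub>R (f \<xi> v* (P \<xi> ** M))"
        using AE_\<Delta>_neq[where l = l and w = w] by eventually_elim (auto simp: indicator_def)
      have "(indicator {w..} :: real \<Rightarrow> real) \<in> borel_measurable (\<Delta> l)"
        by (intro measurable_restrict_space1 measurable_completion) simp
      then show "(\<lambda>\<xi>. indicator {w..} \<xi> *\<^sub>R (f \<xi> v* (P \<xi> ** M))) \<in> borel_measurable (\<Delta> l)"
        by (rule borel_measurable_scaleR[OF _ borel_measurable_integrable[OF i]])
      show "(\<lambda>\<xi>. f \<xi> v* (P \<xi> ** M) - indicator {..w} \<xi> *\<^sub>R (f \<xi> v* (P \<xi> ** M))) \<in> borel_measurable (\<Delta> l)"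
        by (intro borel_measurable_integrable Bochner_Integration.integrable_diff i integrable_indicator_cut)
    qed
    also have "\<dots> = (LINT \<xi>|\<Delta> l. f \<xi> v* (P \<xi> ** M)) - cum l (\<lambda>\<xi>. f \<xi> v* (P \<xi> ** M)) w"
      unfolding cum_def by (intro Bochner_Integration.integral_diff i integrable_indicator_cut)
    finally show "(LINT \<xi>:{w..l}|lebesgue. f \<xi> v* (P \<xi> ** M))
      = ((LINT \<xi>|\<Delta> l. ?h \<xi>) - cum l ?h w) v* M"
      unfolding c t by (simp only: vector_matrix_mult_diff_distrib) }
qed

lemma (in model) model_B_eq:
  assumes f: "f \<in> H l" and w: "w \<in> {-l..l}" and L: "L = J + S0 + hconj S0"
  shows "model_B l L S0 P f w = Bop f w"
proof -
  note i = set_integral_vmult[OF fP_integrable[OF f] w]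
  have "model_B l L S0 P f w = complex_of_real w *s f w
     - \<i> *s (G f w v* (hconj S0 ** hconj (P w)))
     + \<i> *s ((Phi f - G f w) v* (S0 ** hconj (P w)))
     + \<i> *s (G f w v* (L ** hconj (P w)))"
    unfolding model_B_def G_def Phi_def by (simp only: i matrix_mul_assoc[symmetric])
  also have "\<dots> = Bop f w"
    unfolding Bop_def L vector_matrix_mul_assoc[symmetric]
    by (simp add: vector_matrix_left_distrib vector_matrix_mult_diff_distrib vector_matrix_mult_add_rdistrib
      vec_eq_iff algebra_simps)
  finally show ?thesis .
qed

lemma (in model) model_Phi_eq: "model_Phi l P f = Phi f"
  unfolding model_Phi_def Phi_def set_lebesgue_integral_def integral_restrict_space[OF Icc_sets_lebesgue] ..

locale model_family =
  fixes l b x0 x1 :: real and r :: nat and L S0 :: "('m::{finite,linorder}) cmat"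
    and P :: "real \<Rightarrow> real \<Rightarrow> complex ^ ('m::{finite,linorder}) ^ ('p::finite)"
  assumes x01: "x0 < x1" and l_pos: "0 < l" and b_nz: "b \<noteq> 0"
    and mat: "model_matrix r L S0"
    and ker: "x \<in> {x0..x1} \<Longrightarrow> model_kernel l r (P x)"
begin

abbreviation "X \<equiv> {x0..x1}"
abbreviation "B x \<equiv> model_B l L S0 (P x)"
abbreviation "A x \<equiv> model_A b l L S0 (P x)"
abbreviation "\<Phi> x \<equiv> model_Phit l L S0 (P x)"
abbreviation "K x \<equiv> model_Phi l (P x)"
abbreviation "Bs x \<equiv> adjH l (B x)"
abbreviation "As x \<equiv> adjH l (A x)"
abbreviation "\<Phi>s x \<equiv> adjHC l (\<Phi> x)"
abbreviation "T x \<equiv> model.Bop l (P x) (J1 r - J2 r) S0"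

text \<open>An explicit representative of the adjoint of \<open>K x\<close>.\<close>

definition "Ks x c = (\<lambda>w. c v* hconj (P x w))"

lemma L_inv: "invertible L" and L_herm: "hconj L = L"
  using mat unfolding model_matrix_def by blast+

lemma L_decomp: "L = J1 r - J2 r + S0 + hconj S0"
  using mat unfolding model_matrix_def by blast

lemma model_at: "x \<in> X \<Longrightarrow> model l (P x) (J1 r - J2 r) (J2 r) S0"
  using mat by (intro model_of_kernel l_pos ker) (simp_all add: model_matrix_def)

lemma B_pointwise: "x \<in> X \<Longrightarrow> f \<in> H l \<Longrightarrow> w \<in> {-l..l} \<Longrightarrow> B x f w = T x f w"
  by (rule model.model_B_eq[OF model_at _ _ L_decomp])

lemma B_eqH: "x \<in> X \<Longrightarrow> f \<in> H l \<Longrightarrow> eqH l (B x f) (T x f)"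
  by (intro eqH_pointwise B_pointwise)

lemma T_H: "x \<in> X \<Longrightarrow> f \<in> H l \<Longrightarrow> T x f \<in> H l"
  by (rule model.Bop_H[OF model_at])

lemma T_op: "x \<in> X \<Longrightarrow> resolvent_operator l (T x)"
proof -
  assume "x \<in> X"
  interpret model l "P x" "J1 r - J2 r" "J2 r" S0 by (rule model_at[OF \<open>x \<in> X\<close>])
  show ?thesis by unfold_locales
qed

lemma B_H: "x \<in> X \<Longrightarrow> f \<in> H l \<Longrightarrow> B x f \<in> H l"
  by (rule H_cong[OF T_H]) (simp_all add: B_pointwise)

lemma B_cong: "x \<in> X \<Longrightarrow> f \<in> H l \<Longrightarrow> g \<in> H l \<Longrightarrow> eqH l f g \<Longrightarrow> eqH l (B x f) (B x g)"
  by (meson B_eqH eqH_sym eqH_trans T_op resolvent_operator.T_cong)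

lemma B_lin:
  assumes "x \<in> X" "f \<in> H l" "g \<in> H l"
  shows "eqH l (B x (\<lambda>w. c *s f w + d *s g w)) (\<lambda>w. c *s B x f w + d *s B x g w)"
proof -
  have "eqH l (B x (\<lambda>w. c *s f w + d *s g w)) (T x (\<lambda>w. c *s f w + d *s g w))"
    by (intro B_eqH assms H_lin)
  also have "T x (\<lambda>w. c *s f w + d *s g w) = (\<lambda>w. c *s T x f w + d *s T x g w)"
    by (rule resolvent_operator.T_lin[OF T_op[OF assms(1)] assms(2,3)])
  finally show ?thesis
    by (rule eqH_trans) (intro eqH_lin eqH_sym[OF B_eqH] assms)
qed

lemma B_smult: "x \<in> X \<Longrightarrow> f \<in> H l \<Longrightarrow> eqH l (B x (\<lambda>w. c *s f w)) (\<lambda>w. c *s B x f w)"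
  using B_lin[of x f f c 0] by simp

lemma Bs:
  assumes "x \<in> X"
  shows Bs_H: "g \<in> H l \<Longrightarrow> Bs x g \<in> H l"
    and Bs_adj: "f \<in> H l \<Longrightarrow> g \<in> H l \<Longrightarrow> innerH l (B x f) g = innerH l f (Bs x g)"
proof -
  interpret model l "P x" "J1 r - J2 r" "J2 r" S0 by (rule model_at[OF assms])
  have "innerH l (B x f) g = innerH l f (Bad g)" if "f \<in> H l" "g \<in> H l" for f g
    using innerH_cong[OF B_H[OF assms that(1)] T_H[OF that(1)] that(2,2) B_eqH[OF assms that(1)] eqH_refl]
      Bop_adj[OF that] by simp
  note adjH_works[OF Bad_H this]
  then show "g \<in> H l \<Longrightarrow> Bs x g \<in> H l"
    "f \<in> H l \<Longrightarrow> g \<in> H l \<Longrightarrow> innerH l (B x f) g = innerH l f (Bs x g)" by blast+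
qed

lemma Bs_adj': "x \<in> X \<Longrightarrow> f \<in> H l \<Longrightarrow> g \<in> H l \<Longrightarrow> innerH l (Bs x f) g = innerH l f (B x g)"
  using Bs_adj[of x g f] innerH_commute[of l "Bs x f" g] innerH_commute[of l f "B x g"] by simp

lemma K_adj: "x \<in> X \<Longrightarrow> f \<in> H l \<Longrightarrow> cdot (K x f) c = innerH l f (Ks x c)"
  unfolding Ks_def by (simp add: model.model_Phi_eq[OF model_at] model.Phi_adj[OF model_at])

lemma Ks_H: "x \<in> X \<Longrightarrow> Ks x c \<in> H l"
  unfolding Ks_def by (intro model.multP_H[OF model_at] continuous_intros)

lemma K_cong: "x \<in> X \<Longrightarrow> f \<in> H l \<Longrightarrow> g \<in> H l \<Longrightarrow> eqH l f g \<Longrightarrow> K x f = K x g"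
  unfolding model.model_Phi_eq[OF model_at] by (rule model.Phi_cong[OF model_at])

lemma K_lin: "x \<in> X \<Longrightarrow> f \<in> H l \<Longrightarrow> g \<in> H l \<Longrightarrow> K x (\<lambda>w. c *s f w + d *s g w) = c *s K x f + d *s K x g"
  by (simp add: model.model_Phi_eq[OF model_at] model.Phi_lin[OF model_at])

lemma A_eq: "A x f = (\<lambda>w. complex_of_real b *s B x (B x (B x f)) w)"
  by (simp add: model_A_def numeral_3_eq_3)

lemma A_H: "x \<in> X \<Longrightarrow> f \<in> H l \<Longrightarrow> A x f \<in> H l"
  unfolding A_eq by (intro H_smult B_H)

lemma As:
  assumes x: "x \<in> X"
  shows As_H: "g \<in> H l \<Longrightarrow> As x g \<in> H l"
    and As_adj: "f \<in> H l \<Longrightarrow> g \<in> H l \<Longrightarrow> innerH l (A x f) g = innerH l f (As x g)"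
    and As_eq: "g \<in> H l \<Longrightarrow> eqH l (As x g) (\<lambda>w. complex_of_real b *s Bs x (Bs x (Bs x g)) w)"
proof -
  let ?S = "\<lambda>g w. complex_of_real b *s Bs x (Bs x (Bs x g)) w"
  have S: "?S g \<in> H l" if "g \<in> H l" for g by (intro H_smult Bs_H x that)
  have adj: "innerH l (A x f) g = innerH l f (?S g)" if "f \<in> H l" "g \<in> H l" for f g
    using that by (simp add: A_eq innerH_smult_left innerH_smult_right Bs_adj[OF x] B_H[OF x] Bs_H[OF x])
  note w = adjH_works[OF S adj]
  show 1: "g \<in> H l \<Longrightarrow> As x g \<in> H l" for g by (rule w(1))
  show 2: "f \<in> H l \<Longrightarrow> g \<in> H l \<Longrightarrow> innerH l (A x f) g = innerH l f (As x g)" for f g by (rule w(2))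
  show "eqH l (As x g) (?S g)" if g: "g \<in> H l"
    by (rule eqH_if_innerH_right[OF 1[OF g] S[OF g]]) (simp add: 2[symmetric] adj g)
qed

lemma Phi_eq: "\<Phi> x f = triple (K x f) (K x (Bs x f)) (K x (Bs x (Bs x f)))"
  by (simp add: model_Phit_def Let_def)

end

section \<open>Block rows\<close>

lemma comp3_nth: "comp3 k u $ i = u $ (k, i)"
  by (simp add: comp3_def)

lemma comp3_triple:
  "comp3 1 (triple a b c) = a" "comp3 2 (triple a b c) = b" "comp3 3 (triple a b c) = c"
  unfolding triple_def vec_eq_iff comp3_nth
  by (simp_all only: vec_lambda_beta fst_conv snd_conv vector_3 simp_thms)

lemma comp3_add: "comp3 k (u + v) = comp3 k u + comp3 k v"
  and comp3_diff: "comp3 k (u - v) = comp3 k u - comp3 k v"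
  and comp3_smult: "comp3 k (c *s u) = c *s comp3 k u"
  by (simp_all add: vec_eq_iff comp3_nth)

lemma bounded_linear_comp3: "bounded_linear (comp3 k :: complex ^ (3 \<times> 'm::finite) \<Rightarrow> _)"
  unfolding linear_conv_bounded_linear[symmetric] linear_iff by (simp add: vec_eq_iff comp3_nth)

lemma comp3_eqI:
  assumes "comp3 1 u = comp3 1 v" "comp3 2 u = comp3 2 v" "comp3 3 u = comp3 3 v"
  shows "u = v"
proof -
  have "\<forall>k. comp3 k u = comp3 k v" unfolding forall_3 using assms by blast
  then have "u $ (k, i) = v $ (k, i)" for k i by (simp only: comp3_nth[symmetric])
  then show ?thesis unfolding vec_eq_iff by auto
qed

lemma sum_UNIV_pair: "(\<Sum>q\<in>(UNIV :: ('a::finite \<times> 'b::finite) set). g q) = (\<Sum>i\<in>UNIV. \<Sum>j\<in>UNIV. g (i, j))"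
  unfolding UNIV_Times_UNIV[symmetric] sum.cartesian_product by (simp add: case_prod_unfold)

lemma comp3_vmult:
  "comp3 k (u v* block3 K) = comp3 1 u v* (K $ 1 $ k) + comp3 2 u v* (K $ 2 $ k) + comp3 3 u v* (K $ 3 $ k)"
proof -
  have "comp3 k (u v* block3 K) = (\<Sum>j\<in>UNIV. comp3 j u v* (K $ j $ k))"
    unfolding vec_eq_iff comp3_nth vector_matrix_mult_def sum_component
    by (simp add: sum_UNIV_pair block3_def comp3_nth)
  then show ?thesis by (simp only: sum_3)
qed

lemma cdot_comp3:
  "cdot u v = cdot (comp3 1 u) (comp3 1 v) + cdot (comp3 2 u) (comp3 2 v) + cdot (comp3 3 u) (comp3 3 v)"
proof -
  have "cdot u v = (\<Sum>k\<in>UNIV. cdot (comp3 k u) (comp3 k v))"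
    unfolding cdot_def sum_UNIV_pair by (simp add: comp3_nth)
  then show ?thesis by (simp only: sum_3)
qed

lemma sigma_A_rows:
  "comp3 1 (u v* sigma_A b L) = complex_of_real b *s (comp3 3 u v* L)"
  "comp3 2 (u v* sigma_A b L) = complex_of_real b *s (comp3 2 u v* L)"
  "comp3 3 (u v* sigma_A b L) = complex_of_real b *s (comp3 1 u v* L)"
  unfolding sigma_A_def Let_def comp3_vmult vector_3
  by (simp_all only: vector_matrix_mult_0_right add_0_left add_0_right vmult_cscale)

lemma sigma_B_rows:
  "comp3 1 (u v* sigma_B L) = comp3 1 u v* L"
  "comp3 2 (u v* sigma_B L) = 0"
  "comp3 3 (u v* sigma_B L) = 0"
  unfolding sigma_B_def comp3_vmult vector_3
  by (simp_all only: vector_matrix_mult_0_right add_0_left add_0_right)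

lemma psi_rows:
  "comp3 1 (u v* psi_block b L p11 p12 p13) = complex_of_real b *s (comp3 1 u v* L v* p11 v* L)
    + (- \<i> * complex_of_real b) *s (comp3 2 u v* L v* hconj p12 v* L)
    + (- \<i> * complex_of_real b) *s (comp3 3 u v* L v* p13 v* L)"
  "comp3 2 (u v* psi_block b L p11 p12 p13) = (\<i> * complex_of_real b) *s (comp3 1 u v* L v* p12 v* L)
    + complex_of_real b *s (comp3 3 u v* L)"
  "comp3 3 (u v* psi_block b L p11 p12 p13) = (\<i> * complex_of_real b) *s (comp3 1 u v* L v* p13 v* L)
    + complex_of_real b *s (comp3 2 u v* L)"
  unfolding psi_block_def Let_def comp3_vmult vector_3
  by (simp_all only: vector_matrix_mult_0_right add_0_left add_0_right vmult_cscale
      vector_matrix_mul_assoc[symmetric] vmult_smult)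

lemma invertible_vmult_inj:
  assumes "invertible (L :: complex ^ 'm ^ 'm)" "x v* L = y v* L" shows "x = y"
proof -
  obtain L' where "L ** L' = mat 1" using assms(1) unfolding invertible_def by blast
  then have "z v* L v* L' = z" for z :: "complex ^ 'm" by (simp add: vector_matrix_mul_assoc)
  then show ?thesis using assms(2) by metis
qed

lemma invertible_vmult_surj:
  assumes "invertible (L :: complex ^ 'm ^ 'm)" obtains x where "x v* L = y"
proof -
  obtain L' where "L' ** L = mat 1" using assms unfolding invertible_def by blast
  then have "y v* L' v* L = y" by (simp add: vector_matrix_mul_assoc)
  then show ?thesis by (rule that)
qed

lemma smult_cancel: "(c :: complex) \<noteq> 0 \<Longrightarrow> c *s x = c *s y \<Longrightarrow> x = (y :: complex ^ 'm)"
  by (simp add: vec_eq_iff)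

lemma scaleR_smult: "a *\<^sub>R (x :: complex ^ 'm) = complex_of_real a *s x"
  by (simp add: vec_eq_iff scaleR_conv_of_real[where 'a = complex])

lemma cdot_minus_right: "cdot a (- b) = - cdot a b"
  by (simp add: cdot_def sum_negf)

lemma smult_ii_cancel:
  assumes "(1 / \<i>) *s x = \<i> *s y" shows "x = - (y :: complex ^ 'm)"
proof -
  have "\<i> *s ((1 / \<i>) *s x) = \<i> *s (\<i> *s y)" unfolding assms ..
  then show ?thesis unfolding vector_smult_assoc by simp
qed

text \<open>Cauchy-Schwarz applied to the difference quotient. Through this lemma all
  differentiation in x and t is reduced to scalar functions of a real variable, where uniqueness of
  derivatives and constancy are available.\<close>

lemma has_derivH_innerH:
  fixes F :: "real \<Rightarrow> ('p::finite) hfun"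
  assumes d: "has_derivH l S F D x" and g: "g \<in> H l" and x: "x \<in> S"
  shows "((\<lambda>y. innerH l (F y) g) has_vector_derivative innerH l D g) (at x within S)"
  unfolding has_vector_derivative_def has_derivative_iff_norm
proof
  show "bounded_linear (\<lambda>h. h *\<^sub>R innerH l D g)" by (rule bounded_linear_scaleR_left)
  let ?q = "\<lambda>y w. (1 / (y - x)) *\<^sub>R (F y w - F x w) - D w"
  have FH: "F y \<in> H l" if "y \<in> S" for y using d that by (simp add: has_derivH_def)
  have DH: "D \<in> H l" using d by (simp add: has_derivH_def)
  have q: "?q y = (\<lambda>w. complex_of_real (1 / (y - x)) *s (F y w - F x w) - D w)" for y
    by (rule ext) (simp only: scaleR_smult)
  have lim: "((\<lambda>y. normH l (?q y)) \<longlongrightarrow> 0) (at x within S)" using d by (simp add: has_derivH_def)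
  show "((\<lambda>y. norm (innerH l (F y) g - innerH l (F x) g - (y - x) *\<^sub>R innerH l D g) / norm (y - x)) \<longlongrightarrow> 0) (at x within S)"
  proof (rule tendsto_0_le[OF lim])
    show "\<forall>\<^sub>F y in at x within S. norm (norm (innerH l (F y) g - innerH l (F x) g - (y - x) *\<^sub>R innerH l D g) / norm (y - x))
        \<le> norm (normH l (?q y)) * normH l g"
      unfolding eventually_at_filter
    proof (intro always_eventually allI impI)
      fix y assume y: "y \<noteq> x" "y \<in> S"
      have qH: "?q y \<in> H l" unfolding q by (intro H_diff H_smult FH y x DH)
      have "innerH l (?q y) g = complex_of_real (1 / (y - x)) * (innerH l (F y) g - innerH l (F x) g) - innerH l D g"
        unfolding q by (simp only: innerH_diff_left innerH_smult_left H_diff H_smult FH y(2) x DH g)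
      then have "innerH l (F y) g - innerH l (F x) g - (y - x) *\<^sub>R innerH l D g = complex_of_real (y - x) * innerH l (?q y) g"
        using y(1) by (simp add: scaleR_conv_of_real field_simps)
      then have "norm (innerH l (F y) g - innerH l (F x) g - (y - x) *\<^sub>R innerH l D g) / norm (y - x) = norm (innerH l (?q y) g)"
        using y(1) by (simp add: norm_mult flip: of_real_diff)
      then show "norm (norm (innerH l (F y) g - innerH l (F x) g - (y - x) *\<^sub>R innerH l D g) / norm (y - x))
        \<le> norm (normH l (?q y)) * normH l g"
        using norm_innerH_le[OF qH g] by simp
    qed
  qed
qed

section \<open>Consequences of the colligation relations\<close>

locale model_colligation = model_family l b x0 x1 r L S0 P
  for l b x0 x1 :: real and r :: nat and L S0 :: "('m::{finite,linorder}) cmat"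
    and P :: "real \<Rightarrow> real \<Rightarrow> complex ^ ('m::{finite,linorder}) ^ ('p::finite)" +
  fixes \<psi> \<psi>t :: "real \<Rightarrow> (3 \<times> 'm::{finite,linorder}) cmat"
    and p11 p12 p13 t11 t12 t13 :: "real \<Rightarrow> ('m::{finite,linorder}) cmat"
  assumes coll: "colligation l X A B \<Phi> (sigma_A b L) (sigma_B L) \<psi> \<psi>t"
    and strict: "strict_colligation l X \<Phi> (sigma_A b L) (sigma_B L)"
    and psi: "x \<in> X \<Longrightarrow> \<psi> x = psi_block b L (p11 x) (p12 x) (p13 x)"
    and herm: "x \<in> X \<Longrightarrow> hconj (p11 x) = p11 x \<and> hconj (p13 x) = p13 x"
    and psit: "x \<in> X \<Longrightarrow> \<psi>t x = psi_block b L (t11 x) (t12 x) (t13 x)"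
begin

abbreviation "\<sigma>A \<equiv> sigma_A b L"
abbreviation "\<sigma>B \<equiv> sigma_B L"
abbreviation "\<beta> \<equiv> complex_of_real b"

lemma beta_nz: "\<beta> \<noteq> 0" using b_nz by simp

lemma colligationD:
  assumes "x \<in> X"
  shows "hconj (\<psi> x) = \<psi> x"
    "f \<in> H l \<Longrightarrow> eqH l (\<lambda>w. (1 / \<i>) *s (B x f w - Bs x f w)) (\<Phi>s x (\<Phi> x f v* \<sigma>B))"
    "f \<in> H l \<Longrightarrow> \<exists>d. ((\<lambda>y. \<Phi> y f) has_vector_derivative d) (at x within X) \<and>
        (1 / \<i>) *s (d v* \<sigma>A) + \<Phi> x (Bs x f) v* \<sigma>A - \<Phi> x (As x f) v* \<sigma>B = \<Phi> x f v* \<psi> x \<and>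
        (1 / \<i>) *s (d v* \<sigma>A) + \<Phi> x (B x f) v* \<sigma>A - \<Phi> x (A x f) v* \<sigma>B = \<Phi> x f v* \<psi>t x"
    "u v* \<psi>t x = u v* \<psi> x + \<i> *s (\<Phi> x (\<Phi>s x (u v* \<sigma>B)) v* \<sigma>A - \<Phi> x (\<Phi>s x (u v* \<sigma>A)) v* \<sigma>B)"
    "f \<in> H l \<Longrightarrow> \<exists>D. has_derivH l X (\<lambda>y. A y f) D x \<and> eqH l (\<lambda>w. \<i> *s D w) (\<lambda>w. A x (B x f) w - B x (A x f) w)"
proof -
  note c = bspec[OF coll[unfolded colligation_def] assms]
  note d1 = c[THEN conjunct1] and c = c[THEN conjunct2, THEN conjunct2, THEN conjunct2]
  note d2 = c[THEN conjunct1] and c = c[THEN conjunct2]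
  note d3 = c[THEN conjunct1] and c = c[THEN conjunct2]
  note d4 = c[THEN conjunct1] and d5 = c[THEN conjunct2]
  show "hconj (\<psi> x) = \<psi> x" by (rule d1)
  show "f \<in> H l \<Longrightarrow> eqH l (\<lambda>w. (1 / \<i>) *s (B x f w - Bs x f w)) (\<Phi>s x (\<Phi> x f v* \<sigma>B))"
    by (rule bspec[OF d2])
  show "f \<in> H l \<Longrightarrow> \<exists>d. ((\<lambda>y. \<Phi> y f) has_vector_derivative d) (at x within X) \<and>
        (1 / \<i>) *s (d v* \<sigma>A) + \<Phi> x (Bs x f) v* \<sigma>A - \<Phi> x (As x f) v* \<sigma>B = \<Phi> x f v* \<psi> x \<and>
        (1 / \<i>) *s (d v* \<sigma>A) + \<Phi> x (B x f) v* \<sigma>A - \<Phi> x (A x f) v* \<sigma>B = \<Phi> x f v* \<psi>t x"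
    by (rule bspec[OF d3])
  show "u v* \<psi>t x = u v* \<psi> x + \<i> *s (\<Phi> x (\<Phi>s x (u v* \<sigma>B)) v* \<sigma>A - \<Phi> x (\<Phi>s x (u v* \<sigma>A)) v* \<sigma>B)"
    by (rule spec[OF d4])
  show "f \<in> H l \<Longrightarrow> \<exists>D. has_derivH l X (\<lambda>y. A y f) D x \<and> eqH l (\<lambda>w. \<i> *s D w) (\<lambda>w. A x (B x f) w - B x (A x f) w)"
    by (rule bspec[OF d5])
qed

lemma Phi_surj: "x \<in> X \<Longrightarrow> \<exists>f\<in>H l. \<Phi> x f = c"
  using strict unfolding strict_colligation_def by (metis UNIV_I imageE)

lemma K_surj: "x \<in> X \<Longrightarrow> \<exists>f\<in>H l. K x f = c"
proof -
  assume "x \<in> X"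
  then obtain f where f: "f \<in> H l" "\<Phi> x f = triple c 0 0" using Phi_surj by blast
  then have "comp3 1 (\<Phi> x f) = c" by (simp only: comp3_triple)
  then show ?thesis using f(1) unfolding Phi_eq comp3_triple by blast
qed

lemma x0_in: "x0 \<in> X" using x01 by simp

lemma const_on_X:
  assumes "\<And>x. x \<in> X \<Longrightarrow> (h has_vector_derivative 0) (at x within X)" "x \<in> X" "y \<in> X"
  shows "h x = h y"
proof -
  obtain c where "\<And>x. x \<in> X \<Longrightarrow> h x = c"
    using has_vector_derivative_zero_constant[OF convex_real_interval(5) assms(1)] by blast
  then show ?thesis using assms(2,3) by simp
qed

lemma derivative_unique:
  assumes "(h has_vector_derivative d) (at x within X)" "(h has_vector_derivative d') (at x within X)" "x \<in> X"
  shows "d = d'"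
  using vector_derivative_unique_within_closed_interval[of x0 x1 x h d d'] x01 assms by simp

lemma A_const:
  assumes f: "f \<in> H l" and x: "x \<in> X" and y: "y \<in> X"
  shows "eqH l (A x f) (A y f)"
proof (rule eqH_if_innerH[OF A_H[OF x f] A_H[OF y f]])
  fix g :: "'p hfun" assume g: "g \<in> H l"
  show "innerH l (A x f) g = innerH l (A y f) g"
  proof (rule const_on_X[OF _ x y])
    fix x assume x: "x \<in> X"
    obtain D where D: "has_derivH l X (\<lambda>y. A y f) D x"
      and e: "eqH l (\<lambda>w. \<i> *s D w) (\<lambda>w. A x (B x f) w - B x (A x f) w)"
      using colligationD(5)[OF x f] by blast
    have DH: "D \<in> H l" using D by (simp add: has_derivH_def)
    have "eqH l (B x (A x f)) (A x (B x f))"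
      unfolding A_eq by (intro B_smult B_H x f)
    with e have "eqH l D (\<lambda>w. 0)"
      unfolding eqH_def by eventually_elim simp
    then have "innerH l D g = innerH l (\<lambda>w. 0) g"
      by (rule innerH_cong[OF DH H_zero g g _ eqH_refl])
    then have "innerH l D g = 0" by (simp add: innerH_def)
    then show "((\<lambda>y. innerH l (A y f) g) has_vector_derivative 0) (at x within X)"
      using has_derivH_innerH[OF D g x] by simp
  qed
qed

lemma T_cube: "x \<in> X \<Longrightarrow> f \<in> H l \<Longrightarrow> eqH l (B x (B x (B x f))) (T x (T x (T x f)))"
  by (meson B_H T_H B_eqH B_cong eqH_trans)

lemma B_const:
  assumes f: "f \<in> H l" and x: "x \<in> X" and y: "y \<in> X"
  shows "eqH l (B x f) (B y f)"
proof -
  have "eqH l (T x f) (T y f)"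
  proof (rule cube_root_unique[OF T_op[OF x] T_op[OF y] _ f])
    fix g :: "'p hfun" assume g: "g \<in> H l"
    have "eqH l (B x (B x (B x g))) (B y (B y (B y g)))"
      using A_const[OF g x y] unfolding A_eq eqH_def
      by eventually_elim (rule smult_cancel[OF beta_nz])
    then show "eqH l (T x (T x (T x g))) (T y (T y (T y g)))"
      by (meson T_cube[OF x g] T_cube[OF y g] eqH_sym eqH_trans)
  qed
  then show ?thesis by (meson B_eqH[OF x f] B_eqH[OF y f] eqH_sym eqH_trans)
qed

lemma Bs_const:
  assumes f: "f \<in> H l" and x: "x \<in> X" and y: "y \<in> X"
  shows "eqH l (Bs x f) (Bs y f)"
proof (rule eqH_if_innerH_right[OF Bs_H[OF x f] Bs_H[OF y f]])
  fix h :: "'p hfun" assume h: "h \<in> H l"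
  show "innerH l h (Bs x f) = innerH l h (Bs y f)"
    unfolding Bs_adj[OF x h f, symmetric] Bs_adj[OF y h f, symmetric]
    by (rule innerH_cong[OF B_H[OF x h] B_H[OF y h] f f B_const[OF h x y] eqH_refl])
qed

lemma Bs_cong:
  assumes x: "x \<in> X" and f: "f \<in> H l" and g: "g \<in> H l" and e: "eqH l f g"
  shows "eqH l (Bs x f) (Bs x g)"
proof (rule eqH_if_innerH_right[OF Bs_H[OF x f] Bs_H[OF x g]])
  fix h :: "'p hfun" assume h: "h \<in> H l"
  show "innerH l h (Bs x f) = innerH l h (Bs x g)"
    unfolding Bs_adj[OF x h f, symmetric] Bs_adj[OF x h g, symmetric]
    by (rule innerH_cong[OF B_H[OF x h] B_H[OF x h] f g eqH_refl e])
qed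

text \<open>The three components of \<Phi> are K, K B^*, K B^*^2, so K^* u_1 + B K^* u_2 + B^2 K^*
  u_3 is an adjoint and the chosen one has the same property.\<close>

lemma Phis:
  assumes x: "x \<in> X"
  shows Phis_H: "\<Phi>s x u \<in> H l"
    and Phis_adj: "f \<in> H l \<Longrightarrow> cdot (\<Phi> x f) u = innerH l f (\<Phi>s x u)"
proof -
  let ?S = "\<lambda>u w. Ks x (comp3 1 u) w + (B x (Ks x (comp3 2 u)) w + B x (B x (Ks x (comp3 3 u))) w)"
  have S: "?S u \<in> H l" for u by (intro H_add B_H Ks_H x)
  have a: "cdot (\<Phi> x f) u = innerH l f (?S u)" if f: "f \<in> H l" for f u
  proof -
    note fs = f Bs_H[OF x f] Bs_H[OF x Bs_H[OF x f]]
    note ks = Ks_H[OF x, of "comp3 1 u"] Ks_H[OF x, of "comp3 2 u"] Ks_H[OF x, of "comp3 3 u"]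
    have "cdot (\<Phi> x f) u = innerH l f (Ks x (comp3 1 u)) + innerH l f (B x (Ks x (comp3 2 u)))
        + innerH l f (B x (B x (Ks x (comp3 3 u))))"
      unfolding Phi_eq cdot_comp3[of _ u] comp3_triple K_adj[OF x fs(1)] K_adj[OF x fs(2)] K_adj[OF x fs(3)]
      by (simp only: Bs_adj'[OF x f ks(2)] Bs_adj'[OF x fs(2) ks(3)] Bs_adj'[OF x f B_H[OF x ks(3)]])
    also have "\<dots> = innerH l f (?S u)"
      using innerH_add_right[OF ks(1) H_add[OF B_H[OF x ks(2)] B_H[OF x B_H[OF x ks(3)]]] f]
        innerH_add_right[OF B_H[OF x ks(2)] B_H[OF x B_H[OF x ks(3)]] f] by simp
    finally show ?thesis .
  qed
  show "\<Phi>s x u \<in> H l" "f \<in> H l \<Longrightarrow> cdot (\<Phi> x f) u = innerH l f (\<Phi>s x u)"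
    by (rule adjHC_works[OF S a]; assumption)+
qed

lemma Phis_adj': "x \<in> X \<Longrightarrow> f \<in> H l \<Longrightarrow> innerH l (\<Phi>s x u) f = cdot u (\<Phi> x f)"
  using Phis_adj[of x f u] innerH_commute[of l "\<Phi>s x u" f] cdot_commute[of u "\<Phi> x f"] by simp

text \<open>\<open>sigma_B\<close> has L in its corner and nothing else, so the colligation relation
  for B involves only the first component K of \<Phi>.\<close>

lemma B_imag:
  assumes x: "x \<in> X" and f: "f \<in> H l" and g: "g \<in> H l"
  shows "innerH l (B x f) g - innerH l (Bs x f) g = \<i> * cdot (K x f v* L) (K x g)"
proof -
  let ?d = "\<lambda>w. (1 / \<i>) *s (B x f w - Bs x f w)"
  have "innerH l ?d g = innerH l (\<Phi>s x (\<Phi> x f v* \<sigma>B)) g"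
    by (rule innerH_cong[OF _ Phis_H[OF x] g g colligationD(2)[OF x f] eqH_refl])
       (intro H_smult H_diff B_H Bs_H x f)
  also have "\<dots> = cdot (K x f v* L) (K x g)"
    unfolding Phis_adj'[OF x g] cdot_comp3 sigma_B_rows Phi_eq comp3_triple by simp
  finally have "(1 / \<i>) * (innerH l (B x f) g - innerH l (Bs x f) g) = cdot (K x f v* L) (K x g)"
    unfolding innerH_smult_left innerH_diff_left[OF B_H[OF x f] Bs_H[OF x f] g] .
  then have "\<i> * ((1 / \<i>) * (innerH l (B x f) g - innerH l (Bs x f) g)) = \<i> * cdot (K x f v* L) (K x g)"
    by (rule arg_cong)
  then show ?thesis by simp
qed

text \<open>The third column of the colligation relation for \<psi>: \<open>sigma_B\<close>
  contributes nothing there, and the term with K B^* f on the left is cancelled by the entry b L of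
  \<psi>, so only \<psi>_13 drives K.\<close>

lemma K_derivative:
  assumes x: "x \<in> X" and f: "f \<in> H l"
  shows "((\<lambda>y. K y f) has_vector_derivative - (K x f v* L v* p13 x)) (at x within X)"
proof -
  obtain d where d: "((\<lambda>y. \<Phi> y f) has_vector_derivative d) (at x within X)"
    and e: "(1 / \<i>) *s (d v* \<sigma>A) + \<Phi> x (Bs x f) v* \<sigma>A - \<Phi> x (As x f) v* \<sigma>B = \<Phi> x f v* \<psi> x"
    using colligationD(3)[OF x f] by blast
  have "((\<lambda>y. comp3 1 (\<Phi> y f)) has_vector_derivative comp3 1 d) (at x within X)"
    by (rule bounded_linear.has_vector_derivative[OF bounded_linear_comp3 d])
  then have K: "((\<lambda>y. K y f) has_vector_derivative comp3 1 d) (at x within X)"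
    unfolding Phi_eq comp3_triple .
  have "comp3 3 ((1 / \<i>) *s (d v* \<sigma>A) + \<Phi> x (Bs x f) v* \<sigma>A - \<Phi> x (As x f) v* \<sigma>B) = comp3 3 (\<Phi> x f v* \<psi> x)"
    unfolding e ..
  then have "(1 / \<i>) *s (\<beta> *s (comp3 1 d v* L)) = \<i> *s (\<beta> *s (K x f v* L v* p13 x v* L))"
    unfolding vector_smult_assoc[of \<i>] comp3_add comp3_diff comp3_smult sigma_A_rows sigma_B_rows psi[OF x] psi_rows Phi_eq comp3_triple
    by simp
  from smult_ii_cancel[OF this]
  have "\<beta> *s (comp3 1 d v* L) = \<beta> *s ((- (K x f v* L v* p13 x)) v* L)"
    unfolding uminus_vmult by simp
  then have "comp3 1 d = - (K x f v* L v* p13 x)"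
    using smult_cancel[OF beta_nz] invertible_vmult_inj[OF L_inv] by blast
  then show ?thesis using K by simp
qed

lemma p13_zero:
  assumes x: "x \<in> X" shows "p13 x = 0"
proof -
  have *: "cdot (K x f v* L v* p13 x v* L) (K x g) = 0" if f: "f \<in> H l" and g: "g \<in> H l" for f g
  proof -
    let ?c = "\<lambda>y. cdot (K y f v* L) (K y g)"
    have "?c y = ?c x" if y: "y \<in> X" for y
    proof -
      have "innerH l (B y f) g = innerH l (B x f) g" "innerH l (Bs y f) g = innerH l (Bs x f) g"
        by (rule innerH_cong[OF B_H[OF y f] B_H[OF x f] g g B_const[OF f y x] eqH_refl],
            rule innerH_cong[OF Bs_H[OF y f] Bs_H[OF x f] g g Bs_const[OF f y x] eqH_refl])
      then have "\<i> * ?c y = \<i> * ?c x" using B_imag[OF y f g] B_imag[OF x f g] by simp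
      then show ?thesis by simp
    qed
    then have "(?c has_vector_derivative 0) (at x within X)"
      by (intro has_vector_derivative_transform[OF x _ has_vector_derivative_const[of "?c x"]]) simp
    \<comment> \<open>As L and \<psi>_13 are Hermitian, the two terms of the product rule are equal
      and do not cancel; their sum is -2 times the form of L \<psi>_13 L.\<close>
    moreover have "(?c has_vector_derivative (cdot (K x f v* L) (- (K x g v* L v* p13 x))
        + cdot ((- (K x f v* L v* p13 x)) v* L) (K x g))) (at x within X)"
      by (rule bounded_bilinear.has_vector_derivative[OF bounded_bilinear_cdot
            bounded_linear.has_vector_derivative[OF bounded_linear_vector_matrix_mult K_derivative[OF x f]] K_derivative[OF x g]])
    ultimately have "cdot (K x f v* L) (- (K x g v* L v* p13 x)) + cdot ((- (K x f v* L v* p13 x)) v* L) (K x g) = 0"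
      by (rule derivative_unique[OF _ _ x, symmetric])
    moreover have "cdot (K x f v* L) (- (K x g v* L v* p13 x)) = - cdot (K x f v* L v* p13 x v* L) (K x g)"
      unfolding cdot_minus_right cdot_vmult_right using herm[OF x] L_herm by simp
    ultimately show ?thesis by (simp add: uminus_vmult cdot_minus_left)
  qed
  have "c v* L v* p13 x v* L = 0" for c
  proof (rule cdot_cong_0)
    fix d
    obtain f g where "f \<in> H l" "K x f = c" "g \<in> H l" "K x g = d" using K_surj[OF x] by meson
    then show "cdot (c v* L v* p13 x v* L) d = 0" using *[of f g] by simp
  qed
  then have z: "c v* L v* p13 x = 0" for c
    using invertible_vmult_inj[OF L_inv, of "c v* L v* p13 x" 0] by simp
  show ?thesis
  proof (rule matrix_eqI_vmult)
    fix y :: "complex ^ ('m::{finite,linorder})"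
    obtain c where "c v* L = y" using invertible_vmult_surj[OF L_inv] .
    then show "y v* p13 x = y v* 0" using z[of c] by simp
  qed
qed

lemma K_const:
  assumes f: "f \<in> H l" and x: "x \<in> X" and y: "y \<in> X" shows "K x f = K y f"
proof (rule const_on_X[OF _ x y])
  fix x assume x: "x \<in> X"
  show "((\<lambda>y. K y f) has_vector_derivative 0) (at x within X)"
    using K_derivative[OF x f] unfolding p13_zero[OF x] by simp
qed

lemma Phi_const:
  assumes f: "f \<in> H l" and x: "x \<in> X" and y: "y \<in> X" shows "\<Phi> x f = \<Phi> y f"
proof -
  have 1: "eqH l (Bs x f) (Bs y f)" by (rule Bs_const[OF f x y])
  have 2: "eqH l (Bs x (Bs x f)) (Bs y (Bs y f))"
    by (rule eqH_trans[OF Bs_cong[OF x Bs_H[OF x f] Bs_H[OF y f] 1] Bs_const[OF Bs_H[OF y f] x y]])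
  have "K x (Bs x f) = K y (Bs y f)"
    using K_cong[OF x Bs_H[OF x f] Bs_H[OF y f] 1] K_const[OF Bs_H[OF y f] x y] by simp
  moreover have "K x (Bs x (Bs x f)) = K y (Bs y (Bs y f))"
    using K_cong[OF x Bs_H[OF x Bs_H[OF x f]] Bs_H[OF y Bs_H[OF y f]] 2]
      K_const[OF Bs_H[OF y Bs_H[OF y f]] x y] by simp
  ultimately show ?thesis unfolding Phi_eq using K_const[OF f x y] by simp
qed

text \<open>A constant \<Phi> has derivative 0, and the differential relations of the colligation
  become algebraic ones, from which all blocks are read off.\<close>

lemma psi_relations:
  assumes x: "x \<in> X" and f: "f \<in> H l"
  shows "\<Phi> x (Bs x f) v* \<sigma>A - \<Phi> x (As x f) v* \<sigma>B = \<Phi> x f v* \<psi> x"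
    "\<Phi> x (B x f) v* \<sigma>A - \<Phi> x (A x f) v* \<sigma>B = \<Phi> x f v* \<psi>t x"
proof -
  obtain d where d: "((\<lambda>y. \<Phi> y f) has_vector_derivative d) (at x within X)"
    and e: "(1 / \<i>) *s (d v* \<sigma>A) + \<Phi> x (Bs x f) v* \<sigma>A - \<Phi> x (As x f) v* \<sigma>B = \<Phi> x f v* \<psi> x"
      "(1 / \<i>) *s (d v* \<sigma>A) + \<Phi> x (B x f) v* \<sigma>A - \<Phi> x (A x f) v* \<sigma>B = \<Phi> x f v* \<psi>t x"
    using colligationD(3)[OF x f] by blast
  have "((\<lambda>y. \<Phi> y f) has_vector_derivative 0) (at x within X)"
    by (rule has_vector_derivative_transform[OF x _ has_vector_derivative_const[of "\<Phi> x f"]])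
       (simp add: Phi_const[OF f x])
  then have "d = 0" by (rule derivative_unique[OF d _ x])
  then show "\<Phi> x (Bs x f) v* \<sigma>A - \<Phi> x (As x f) v* \<sigma>B = \<Phi> x f v* \<psi> x"
    "\<Phi> x (B x f) v* \<sigma>A - \<Phi> x (A x f) v* \<sigma>B = \<Phi> x f v* \<psi>t x"
    using e by simp_all
qed

lemma K_As: "x \<in> X \<Longrightarrow> f \<in> H l \<Longrightarrow> K x (As x f) = \<beta> *s K x (Bs x (Bs x (Bs x f)))"
proof -
  assume x: "x \<in> X" and f: "f \<in> H l"
  have h: "Bs x (Bs x (Bs x f)) \<in> H l" by (intro Bs_H x f)
  have "K x (As x f) = K x (\<lambda>w. \<beta> *s Bs x (Bs x (Bs x f)) w)"
    by (rule K_cong[OF x As_H[OF x f] H_smult[OF h] As_eq[OF x f]])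
  then show ?thesis using K_lin[OF x h h, of \<beta> 0] by simp
qed

lemma zero_matrix_if:
  assumes "\<And>c. c v* L v* M v* L = 0" shows "M = 0"
proof (rule matrix_eqI_vmult)
  fix y :: "complex ^ ('m::{finite,linorder})"
  obtain c where c: "c v* L = y" using invertible_vmult_surj[OF L_inv] .
  have "(c v* L v* M) v* L = 0 v* L" using assms[of c] by simp
  then have "c v* L v* M = 0" by (rule invertible_vmult_inj[OF L_inv])
  then show "y v* M = y v* 0" using c by simp
qed

text \<open>In the second column both sides contain b K B^*^2 f L, on the left through
  \<open>sigma_A\<close> and on the right through the entry b L of \<psi>; only the term with
  \<psi>_12 is left over.\<close>

lemma p12_zero:
  assumes x: "x \<in> X" shows "p12 x = 0"
proof (rule zero_matrix_if)
  fix c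
  obtain f where f: "f \<in> H l" "K x f = c" using K_surj[OF x] by blast
  have "comp3 2 (\<Phi> x (Bs x f) v* \<sigma>A - \<Phi> x (As x f) v* \<sigma>B) = comp3 2 (\<Phi> x f v* \<psi> x)"
    unfolding psi_relations(1)[OF x f(1)] ..
  then show "c v* L v* p12 x v* L = 0"
    unfolding comp3_add comp3_diff comp3_smult sigma_A_rows sigma_B_rows psi[OF x] psi_rows Phi_eq comp3_triple
    using f(2) b_nz by simp
qed

text \<open>In the first column the left side is b K B^*^3 f L - K A^* f L, which vanishes because
  A^* = b B^*^3; on the right the terms with \<psi>_12 and \<psi>_13 are already known to be
  0.\<close>

lemma p11_zero:
  assumes x: "x \<in> X" shows "p11 x = 0"
proof (rule zero_matrix_if)
  fix c
  obtain f where f: "f \<in> H l" "K x f = c" using K_surj[OF x] by blast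
  have h0: "hconj (0 :: ('m::{finite,linorder}) cmat) = 0" by (simp add: vec_eq_iff)
  have "comp3 1 (\<Phi> x (Bs x f) v* \<sigma>A - \<Phi> x (As x f) v* \<sigma>B) = comp3 1 (\<Phi> x f v* \<psi> x)"
    unfolding psi_relations(1)[OF x f(1)] ..
  then show "c v* L v* p11 x v* L = 0"
    unfolding comp3_add comp3_diff comp3_smult sigma_A_rows sigma_B_rows psi[OF x] psi_rows Phi_eq comp3_triple
      K_As[OF x f(1)] p12_zero[OF x] p13_zero[OF x] h0 vmult_smult
    using f(2) b_nz by simp
qed

end

section \<open>The blocks of \<psi> with tilde and the identities between them\<close>

lemma cdot_eqI: "(\<And>c. cdot a c = cdot b c) \<Longrightarrow> a = b"
  using cdot_cong_0[of "a - b"] by (simp add: cdot_diff_left)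

context model_colligation
begin

lemma Phi_cong:
  assumes x: "x \<in> X" and f: "f \<in> H l" and g: "g \<in> H l" and e: "eqH l f g"
  shows "\<Phi> x f = \<Phi> x g"
proof -
  have 1: "eqH l (Bs x f) (Bs x g)" by (rule Bs_cong[OF x f g e])
  have 2: "eqH l (Bs x (Bs x f)) (Bs x (Bs x g))" by (rule Bs_cong[OF x Bs_H[OF x f] Bs_H[OF x g] 1])
  show ?thesis
    unfolding Phi_eq K_cong[OF x f g e] K_cong[OF x Bs_H[OF x f] Bs_H[OF x g] 1]
      K_cong[OF x Bs_H[OF x Bs_H[OF x f]] Bs_H[OF x Bs_H[OF x g]] 2] ..
qed

lemma Phi_lin:
  assumes x: "x \<in> X" and f: "f \<in> H l" and g: "g \<in> H l"
  shows "\<Phi> x (\<lambda>w. c *s f w + d *s g w) = c *s \<Phi> x f + d *s \<Phi> x g"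
proof (rule cdot_eqI)
  fix u
  show "cdot (\<Phi> x (\<lambda>w. c *s f w + d *s g w)) u = cdot (c *s \<Phi> x f + d *s \<Phi> x g) u"
    unfolding Phis_adj[OF x H_lin[OF f g]] cdot_add_left cdot_smult_left Phis_adj[OF x f] Phis_adj[OF x g]
    by (simp only: innerH_add_left innerH_smult_left H_smult f g Phis_H[OF x])
qed

lemma Phis_1:
  assumes x: "x \<in> X" and u: "comp3 2 u = 0" "comp3 3 u = 0"
  shows "eqH l (\<Phi>s x u) (Ks x (comp3 1 u))"
proof (rule eqH_if_innerH_right[OF Phis_H[OF x] Ks_H[OF x]])
  fix h :: "'p hfun" assume h: "h \<in> H l"
  show "innerH l h (\<Phi>s x u) = innerH l h (Ks x (comp3 1 u))"
    unfolding Phis_adj[OF x h, symmetric] K_adj[OF x h, symmetric] cdot_comp3[of _ u] u Phi_eq comp3_triple by simp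
qed

lemma Phis_3:
  assumes x: "x \<in> X" and u: "comp3 1 u = 0" "comp3 2 u = 0"
  shows "eqH l (\<Phi>s x u) (B x (B x (Ks x (comp3 3 u))))"
proof (rule eqH_if_innerH_right[OF Phis_H[OF x] B_H[OF x B_H[OF x Ks_H[OF x]]]])
  fix h :: "'p hfun" assume h: "h \<in> H l"
  note bh = Bs_H[OF x h]
  show "innerH l h (\<Phi>s x u) = innerH l h (B x (B x (Ks x (comp3 3 u))))"
    unfolding Phis_adj[OF x h, symmetric] Bs_adj'[OF x h B_H[OF x Ks_H[OF x]], symmetric]
      Bs_adj'[OF x bh Ks_H[OF x], symmetric] K_adj[OF x Bs_H[OF x bh], symmetric]
      cdot_comp3[of _ u] u Phi_eq comp3_triple by simp
qed

lemma Ks_smult: "Ks x (c *s y) = (\<lambda>w. c *s Ks x y w)"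
  by (simp add: Ks_def vmult_smult)

lemma BB_smult:
  assumes x: "x \<in> X" and f: "f \<in> H l"
  shows "eqH l (B x (B x (\<lambda>w. c *s f w))) (\<lambda>w. c *s B x (B x f) w)"
  by (rule eqH_trans[OF B_cong[OF x B_H[OF x H_smult[OF f]] H_smult[OF B_H[OF x f]] B_smult[OF x f]]
        B_smult[OF x B_H[OF x f]]])

lemma K_smult: "x \<in> X \<Longrightarrow> f \<in> H l \<Longrightarrow> K x (\<lambda>w. c *s f w) = c *s K x f"
  using K_lin[of x f f c 0] by simp

text \<open>The linkage relation is evaluated on a vector u of the first block with u_1 L = y. Then
  u \<sigma>_B has only a first component y and u \<sigma>_A only a third component b y, so the two
  products \<Phi>\<Phi>^* reduce to \<Phi> K^* y and b \<Phi> B^2 K^* y, and the three columns give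
  the three blocks.\<close>

lemma t_blocks:
  assumes x: "x \<in> X"
  shows t13: "y v* t13 x = K x (Ks x y)"
    and t12: "y v* t12 x = K x (Bs x (Ks x y))"
    and t11: "y v* t11 x = \<i> *s (K x (Bs x (Bs x (Ks x y))) - K x (B x (B x (Ks x y))))"
proof -
  obtain c where c: "c v* L = y" using invertible_vmult_surj[OF L_inv] .
  define u where "u = triple c 0 0"
  have uB: "comp3 1 (u v* \<sigma>B) = y" "comp3 2 (u v* \<sigma>B) = 0" "comp3 3 (u v* \<sigma>B) = 0"
    unfolding sigma_B_rows u_def comp3_triple c by simp_all
  have uA: "comp3 1 (u v* \<sigma>A) = 0" "comp3 2 (u v* \<sigma>A) = 0" "comp3 3 (u v* \<sigma>A) = \<beta> *s y"
    unfolding sigma_A_rows u_def comp3_triple c by simp_all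
  note kh = Ks_H[OF x, of y]
  have PB: "\<Phi> x (\<Phi>s x (u v* \<sigma>B)) = \<Phi> x (Ks x y)"
    using Phi_cong[OF x Phis_H[OF x] Ks_H[OF x] Phis_1[OF x uB(2,3)]] unfolding uB(1) .
  have "eqH l (\<Phi>s x (u v* \<sigma>A)) (\<lambda>w. \<beta> *s B x (B x (Ks x y)) w)"
    using eqH_trans[OF Phis_3[OF x uA(1,2), unfolded uA(3) Ks_smult] BB_smult[OF x kh]] .
  from K_cong[OF x Phis_H[OF x] H_smult[OF B_H[OF x B_H[OF x kh]]] this]
  have PA: "K x (\<Phi>s x (u v* \<sigma>A)) = \<beta> *s K x (B x (B x (Ks x y)))"
    unfolding K_smult[OF x B_H[OF x B_H[OF x kh]]] .
  have h0: "hconj (0 :: ('m::{finite,linorder}) cmat) = 0" by (simp add: vec_eq_iff)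
  have "u v* \<psi>t x = u v* \<psi> x + \<i> *s (\<Phi> x (\<Phi>s x (u v* \<sigma>B)) v* \<sigma>A - \<Phi> x (\<Phi>s x (u v* \<sigma>A)) v* \<sigma>B)"
    by (rule colligationD(4)[OF x])
  then have e: "comp3 k (u v* psi_block b L (t11 x) (t12 x) (t13 x))
      = comp3 k (u v* psi_block b L 0 0 0) + \<i> *s (comp3 k (\<Phi> x (Ks x y) v* \<sigma>A) - comp3 k (\<Phi> x (\<Phi>s x (u v* \<sigma>A)) v* \<sigma>B))" for k
    unfolding psit[OF x] psi[OF x] p11_zero[OF x] p12_zero[OF x] p13_zero[OF x] PB
    by (simp only: comp3_add comp3_diff comp3_smult)
  have u: "comp3 1 u v* L = y" "comp3 2 u = 0" "comp3 3 u = 0"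
    unfolding u_def comp3_triple c by simp_all
  have "(\<i> * \<beta>) *s (y v* t13 x v* L) = (\<i> * \<beta>) *s (K x (Ks x y) v* L)"
    using e[of 3] unfolding psi_rows u sigma_A_rows sigma_B_rows Phi_eq comp3_triple h0
    by (simp add: vector_smult_assoc)
  then show "y v* t13 x = K x (Ks x y)"
    using smult_cancel[of "\<i> * \<beta>"] beta_nz invertible_vmult_inj[OF L_inv] by simp
  have "(\<i> * \<beta>) *s (y v* t12 x v* L) = (\<i> * \<beta>) *s (K x (Bs x (Ks x y)) v* L)"
    using e[of 2] unfolding psi_rows u sigma_A_rows sigma_B_rows Phi_eq comp3_triple h0
    by (simp add: vector_smult_assoc)
  then show "y v* t12 x = K x (Bs x (Ks x y))"
    using smult_cancel[of "\<i> * \<beta>"] beta_nz invertible_vmult_inj[OF L_inv] by simp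
  have "\<beta> *s (y v* t11 x v* L)
      = \<i> *s (\<beta> *s (K x (Bs x (Bs x (Ks x y))) v* L) - (\<beta> *s K x (B x (B x (Ks x y)))) v* L)"
    using e[of 1] unfolding psi_rows u sigma_A_rows sigma_B_rows Phi_eq comp3_triple h0 PA by simp
  also have "\<dots> = \<beta> *s ((\<i> *s (K x (Bs x (Bs x (Ks x y))) - K x (B x (B x (Ks x y))))) v* L)"
    by (simp add: vmult_smult vector_matrix_mult_diff_distrib vec_eq_iff algebra_simps)
  finally show "y v* t11 x = \<i> *s (K x (Bs x (Bs x (Ks x y))) - K x (B x (B x (Ks x y))))"
    using smult_cancel[OF beta_nz] invertible_vmult_inj[OF L_inv] by blast
qed

lemma t12_star:
  assumes x: "x \<in> X" shows "y v* hconj (t12 x) = K x (B x (Ks x y))"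
proof (rule cdot_eqI)
  fix w
  note H' = Ks_H[OF x, of y] Ks_H[OF x, of w]
  have "cdot (y v* hconj (t12 x)) w = cdot y (K x (Bs x (Ks x w)))"
    unfolding t12[OF x, symmetric] by (rule cdot_vmult_right[symmetric])
  also have "\<dots> = cnj (innerH l (Bs x (Ks x w)) (Ks x y))"
    unfolding K_adj[OF x Bs_H[OF x H'(2)], symmetric] by (rule cdot_commute)
  also have "\<dots> = innerH l (Ks x y) (Bs x (Ks x w))" by (rule innerH_commute[symmetric])
  also have "\<dots> = cdot (K x (B x (Ks x y))) w"
    unfolding Bs_adj[OF x H', symmetric] K_adj[OF x B_H[OF x H'(1)]] ..
  finally show "cdot (y v* hconj (t12 x)) w = cdot (K x (B x (Ks x y))) w" .
qed

lemma B_minus_Bs: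
  assumes x: "x \<in> X" and f: "f \<in> H l"
  shows "eqH l (\<lambda>w. B x f w - Bs x f w) (\<lambda>w. \<i> *s Ks x (K x f v* L) w)"
proof (rule eqH_if_innerH[OF H_diff[OF B_H[OF x f] Bs_H[OF x f]] H_smult[OF Ks_H[OF x]]])
  fix g :: "'p hfun" assume g: "g \<in> H l"
  have "innerH l (Ks x (K x f v* L)) g = cdot (K x f v* L) (K x g)"
    using innerH_commute[of l "Ks x (K x f v* L)" g] K_adj[OF x g, of "K x f v* L"]
      cdot_commute[of "K x f v* L" "K x g"] by simp
  then show "innerH l (\<lambda>w. B x f w - Bs x f w) g = innerH l (\<lambda>w. \<i> *s Ks x (K x f v* L) w) g"
    unfolding innerH_diff_left[OF B_H[OF x f] Bs_H[OF x f] g] B_imag[OF x f g] innerH_smult_left by simp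
qed

lemma K_diff: "x \<in> X \<Longrightarrow> f \<in> H l \<Longrightarrow> g \<in> H l \<Longrightarrow> K x (\<lambda>w. f w - g w) = K x f - K x g"
  using K_lin[of x f g 1 "-1"] by (simp add: vector_sneg_minus1[symmetric])

lemma K_B_minus_Bs:
  assumes x: "x \<in> X" and f: "f \<in> H l"
  shows "K x (B x f) - K x (Bs x f) = \<i> *s (K x f v* L v* t13 x)"
  using K_cong[OF x H_diff[OF B_H[OF x f] Bs_H[OF x f]] H_smult[OF Ks_H[OF x]] B_minus_Bs[OF x f]]
  unfolding K_diff[OF x B_H[OF x f] Bs_H[OF x f]] K_smult[OF x Ks_H[OF x]] t13[OF x] .

lemma KBs_adj:
  assumes x: "x \<in> X" and f: "f \<in> H l"
  shows "cdot (K x (Bs x f)) c = innerH l f (B x (Ks x c))"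
  unfolding K_adj[OF x Bs_H[OF x f]] by (rule Bs_adj'[OF x f Ks_H[OF x]])

lemma KBs_B_minus_Bs:
  assumes x: "x \<in> X" and f: "f \<in> H l"
  shows "K x (Bs x (B x f)) - K x (Bs x (Bs x f)) = \<i> *s (K x f v* L v* t12 x)"
proof (rule cdot_eqI)
  fix c
  note H' = B_H[OF x f] Bs_H[OF x f] B_H[OF x Ks_H[OF x, of c]]
  have "cdot (K x (Bs x (B x f)) - K x (Bs x (Bs x f))) c = innerH l (\<lambda>w. B x f w - Bs x f w) (B x (Ks x c))"
    unfolding cdot_diff_left KBs_adj[OF x H'(1)] KBs_adj[OF x H'(2)] innerH_diff_left[OF H'] ..
  also have "\<dots> = innerH l (\<lambda>w. \<i> *s Ks x (K x f v* L) w) (B x (Ks x c))"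
    by (rule innerH_cong[OF H_diff[OF H'(1,2)] H_smult[OF Ks_H[OF x]] H'(3,3) B_minus_Bs[OF x f] eqH_refl])
  also have "\<dots> = cdot (\<i> *s (K x f v* L v* t12 x)) c"
    unfolding innerH_smult_left t12[OF x] cdot_smult_left KBs_adj[OF x Ks_H[OF x]] ..
  finally show "cdot (K x (Bs x (B x f)) - K x (Bs x (Bs x f))) c = cdot (\<i> *s (K x f v* L v* t12 x)) c" .
qed

text \<open>The first identity is B - B^* = i K^* L K between K and K^*. The second comes from
  writing B^2 - B^*^2 as the difference B - B^* after B, plus B^* after the same difference, and
  replacing both differences.\<close>

lemma t_relations:
  assumes x: "x \<in> X"
  shows "y v* hconj (t12 x) = y v* t12 x + \<i> *s (y v* t13 x v* L v* t13 x)"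
    and "y v* t11 x = y v* hconj (t12 x) v* L v* t13 x + y v* t13 x v* L v* t12 x"
proof -
  note h = Ks_H[OF x, of y]
  show "y v* hconj (t12 x) = y v* t12 x + \<i> *s (y v* t13 x v* L v* t13 x)"
    using K_B_minus_Bs[OF x h] unfolding t12_star[OF x] t12[OF x] t13[OF x, of y]
    by (simp add: algebra_simps)
  have "K x (B x (B x (Ks x y))) - K x (Bs x (B x (Ks x y))) = \<i> *s (y v* hconj (t12 x) v* L v* t13 x)"
    using K_B_minus_Bs[OF x B_H[OF x h]] unfolding t12_star[OF x] .
  moreover have "K x (Bs x (B x (Ks x y))) - K x (Bs x (Bs x (Ks x y))) = \<i> *s (y v* t13 x v* L v* t12 x)"
    using KBs_B_minus_Bs[OF x h] unfolding t13[OF x, of y] .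
  moreover have "y v* t11 x = - (\<i> *s ((K x (B x (B x (Ks x y))) - K x (Bs x (B x (Ks x y))))
      + (K x (Bs x (B x (Ks x y))) - K x (Bs x (Bs x (Ks x y))))))"
    unfolding t11[OF x] by (simp add: vec_eq_iff algebra_simps)
  ultimately have "y v* t11 x = - (\<i> *s (\<i> *s (y v* hconj (t12 x) v* L v* t13 x) + \<i> *s (y v* t13 x v* L v* t12 x)))"
    by simp
  then show "y v* t11 x = y v* hconj (t12 x) v* L v* t13 x + y v* t13 x v* L v* t12 x"
    by (simp add: vector_add_ldistrib vector_smult_assoc)
qed

text \<open>By the algebraic colligation relation, \<psi> with tilde is determined on the range of
  \<Phi> by \<Phi>, A and B, all of which are constant, and \<Phi> is onto.\<close>

lemma psit_const:
  assumes x: "x \<in> X" and y: "y \<in> X" shows "u v* \<psi>t x = u v* \<psi>t y"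
proof -
  obtain f where f: "f \<in> H l" "\<Phi> x f = u" using Phi_surj[OF x] by blast
  have "\<Phi> x (B x f) = \<Phi> y (B y f)"
    using Phi_cong[OF x B_H[OF x f(1)] B_H[OF y f(1)] B_const[OF f(1) x y]] Phi_const[OF B_H[OF y f(1)] x y] by simp
  moreover have "\<Phi> x (A x f) = \<Phi> y (A y f)"
    using Phi_cong[OF x A_H[OF x f(1)] A_H[OF y f(1)] A_const[OF f(1) x y]] Phi_const[OF A_H[OF y f(1)] x y] by simp
  moreover have "\<Phi> x f = \<Phi> y f" by (rule Phi_const[OF f(1) x y])
  ultimately show ?thesis
    using psi_relations(2)[OF x f(1)] psi_relations(2)[OF y f(1)] f(2) by simp
qed

lemma eq_matrix_if:
  assumes "\<And>c. c v* L v* M v* L = c v* L v* N v* L" shows "M = N"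
  using zero_matrix_if[of "M - N"] assms
  by (simp add: vector_matrix_mult_diff_rdistrib vector_matrix_mult_diff_distrib)

lemma t_const:
  assumes x: "x \<in> X" and y: "y \<in> X"
  shows "t11 x = t11 y" "t12 x = t12 y" "t13 x = t13 y"
proof -
  have e: "comp3 k (triple c 0 0 v* psi_block b L (t11 x) (t12 x) (t13 x))
     = comp3 k (triple c 0 0 v* psi_block b L (t11 y) (t12 y) (t13 y))" for c k
    using psit_const[OF x y] unfolding psit[OF x] psit[OF y] by simp
  show "t11 x = t11 y"
    by (rule eq_matrix_if) (use e[of 1] b_nz in \<open>simp add: psi_rows comp3_triple\<close>)
  show "t12 x = t12 y"
    by (rule eq_matrix_if) (use e[of 2] b_nz in \<open>simp add: psi_rows comp3_triple\<close>)
  show "t13 x = t13 y"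
    by (rule eq_matrix_if) (use e[of 3] b_nz in \<open>simp add: psi_rows comp3_triple\<close>)
qed

end

section \<open>Third-order equations with constant coefficients\<close>

lemma deriv_on_transform:
  assumes ab: "a < b" and f: "\<And>x. x \<in> {a..b} \<Longrightarrow> (f has_vector_derivative d x) (at x within {a..b})"
    and g: "\<And>x. x \<in> {a..b} \<Longrightarrow> g x = f x" and x: "x \<in> {a..b}"
  shows "(g has_vector_derivative d x) (at x within {a..b})" "deriv_on {a..b} g x = d x"
proof -
  show 1: "(g has_vector_derivative d x) (at x within {a..b})"
    by (rule has_vector_derivative_transform[OF x _ f[OF x]]) (simp add: g)
  show "deriv_on {a..b} g x = d x"
    unfolding deriv_on_def using vector_derivative_within_cbox[OF ab, of x g "d x"] x 1 by simp
qed

lemma deriv_on_const: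
  assumes "a < b" "\<And>x. x \<in> {a..b} \<Longrightarrow> g x = c" "x \<in> {a..b}"
  shows "deriv_on {a..b} g x = 0"
  using deriv_on_transform(2)[OF assms(1) has_vector_derivative_const assms(2,3)] .

text \<open>Once the derivatives are gone, each p_k is L times a multiple of the identity
  \<open>r2\<close>. The coefficients q_2 and q_3 are i L times the identity \<open>r1\<close>, and
  q_1 becomes so after \<open>r2\<close> has moved the star from one factor \<theta>_12 to the
  other.\<close>

lemma coefficients_vanish:
  assumes ab: "a < b" and x: "x \<in> {a..b}"
    and c: "\<And>x. x \<in> {a..b} \<Longrightarrow> \<theta>11 x = M1" "\<And>x. x \<in> {a..b} \<Longrightarrow> \<theta>12 x = M2" "\<And>x. x \<in> {a..b} \<Longrightarrow> \<theta>13 x = M3"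
    and r2: "\<And>y. y v* hconj M2 = y v* M2 + \<i> *s (y v* M3 v* L v* M3)"
    and r1: "\<And>y. y v* M1 = y v* hconj M2 v* L v* M3 + y v* M3 v* L v* M2"
  shows "p_coef {a..b} L \<theta>11 \<theta>12 \<theta>13 k x = 0" "q_coef {a..b} L \<theta>11 \<theta>12 \<theta>13 k x = 0"
proof -
  have d: "deriv_on {a..b} \<theta>12 x = 0" "deriv_on {a..b} \<theta>13 x = 0" "deriv_on {a..b} (\<lambda>y. hconj (\<theta>12 y)) x = 0"
    by (rule deriv_on_const[OF ab _ x], simp add: c)+
  have d2: "deriv_on {a..b} (deriv_on {a..b} \<theta>13) x = 0"
    by (rule deriv_on_const[OF ab _ x], rule deriv_on_const[OF ab c(3)])
  note vm = vector_matrix_mult_diff_rdistrib vector_matrix_mult_add_rdistrib vector_matrix_mul_assoc[symmetric]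
    vmult_cscale vmult_smult vector_matrix_left_distrib vector_matrix_mult_diff_distrib vmult_uminus
    vector_matrix_mult_0_right times0_right
  show "p_coef {a..b} L \<theta>11 \<theta>12 \<theta>13 k x = 0"
  proof (rule matrix_eqI_vmult)
    fix y
    show "y v* p_coef {a..b} L \<theta>11 \<theta>12 \<theta>13 k x = y v* 0"
      unfolding p_coef_def Let_def d c[OF x] by (simp add: vm r2 vec_eq_iff algebra_simps)
  qed
  show "q_coef {a..b} L \<theta>11 \<theta>12 \<theta>13 k x = 0"
  proof (rule matrix_eqI_vmult)
    fix y
    show "y v* q_coef {a..b} L \<theta>11 \<theta>12 \<theta>13 k x = y v* 0"
      unfolding q_coef_def Let_def d d2 c[OF x] by (simp add: vm r1 r2 vec_eq_iff algebra_simps)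
  qed
qed

text \<open>The inverse is antidiagonal as well: it is \<open>sigma_A\<close> with 1/b in place of b
  and the inverse of L in place of L.\<close>

lemma sigma_A_inv:
  assumes "invertible (L :: ('m::finite) cmat)" "b \<noteq> 0"
  shows "sigma_A b L ** matrix_inv (sigma_A b L) = mat 1" "matrix_inv (sigma_A b L) ** sigma_A b L = mat 1"
proof -
  obtain L' where L': "L ** L' = mat 1" "L' ** L = mat 1" using assms(1) unfolding invertible_def by blast
  then have LL: "z v* L v* L' = z" "z v* L' v* L = z" for z by (simp_all add: vector_matrix_mul_assoc)
  have "sigma_A b L ** sigma_A (1/b) L' = mat 1"
    by (rule matrix_eqI_vmult, rule comp3_eqI)
       (simp_all only: vector_matrix_mul_assoc[symmetric] sigma_A_rows vmult_smult vmult_mat_1,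
        simp_all add: vector_smult_assoc LL assms(2))
  moreover have "sigma_A (1/b) L' ** sigma_A b L = mat 1"
    by (rule matrix_eqI_vmult, rule comp3_eqI)
       (simp_all only: vector_matrix_mul_assoc[symmetric] sigma_A_rows vmult_smult vmult_mat_1,
        simp_all add: vector_smult_assoc LL assms(2))
  ultimately have "\<exists>M. sigma_A b L ** M = mat 1 \<and> M ** sigma_A b L = mat 1" by blast
  from someI_ex[OF this]
  show "sigma_A b L ** matrix_inv (sigma_A b L) = mat 1" "matrix_inv (sigma_A b L) ** sigma_A b L = mat 1"
    unfolding matrix_inv_def by blast+
qed

text \<open>The generator of a compatibility condition, so that the conditions for input and output
  are both of the form y' = N y, with M the respective \<psi>.\<close>

definition flow :: "real \<Rightarrow> ('m::finite) cmat \<Rightarrow> complex \<Rightarrow> (3 \<times> 'm) cmat \<Rightarrow> complex ^ (3 \<times> 'm) \<Rightarrow> complex ^ (3 \<times> 'm)" where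
  "flow b L lam M u = \<i> *s ((u v* (lam *\<^sub>m sigma_B L + M)) v* matrix_inv (sigma_A b L))"

text \<open>Multiplying by \<open>sigma_A\<close> removes its inverse, after which b and L cancel in
  each column. Since \<open>sigma_A\<close> is antidiagonal, the third column determines the first
  component and conversely.\<close>

lemma flow_rows:
  fixes L M1 M2 M3 :: "('m::finite) cmat" and lam :: complex
  assumes L: "invertible L" and b: "b \<noteq> 0"
  defines "N \<equiv> flow b L lam (psi_block b L M1 M2 M3)"
  shows "comp3 1 (N u) = - (comp3 1 u v* L v* M3) + \<i> *s comp3 2 u"
    "comp3 2 (N u) = - (comp3 1 u v* L v* M2) + \<i> *s comp3 3 u"
    "comp3 3 (N u) = (\<i> * (lam / complex_of_real b)) *s comp3 1 u + \<i> *s (comp3 1 u v* L v* M1)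
      + comp3 2 u v* L v* hconj M2 + comp3 3 u v* L v* M3"
proof -
  let ?\<beta> = "complex_of_real b"
  have \<beta>: "?\<beta> \<noteq> 0" using b by simp
  have "N u v* sigma_A b L = \<i> *s (u v* (lam *\<^sub>m sigma_B L + psi_block b L M1 M2 M3))"
    unfolding N_def flow_def vmult_smult
    by (simp add: vector_matrix_mul_assoc matrix_mul_assoc[symmetric] sigma_A_inv[OF L b])
  then have e: "comp3 k (N u v* sigma_A b L) = \<i> *s (lam *s comp3 k (u v* sigma_B L) + comp3 k (u v* psi_block b L M1 M2 M3))" for k
    by (simp only: comp3_smult comp3_add vector_matrix_mult_add_rdistrib vmult_cscale)
  have cancel: "x = y" if "?\<beta> *s (x v* L) = ?\<beta> *s (y v* L)" for x y
    using smult_cancel[OF \<beta> that] invertible_vmult_inj[OF L] by blast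
  show "comp3 1 (N u) = - (comp3 1 u v* L v* M3) + \<i> *s comp3 2 u"
    by (rule cancel)
      (use e[of 3] in \<open>simp add: sigma_A_rows sigma_B_rows psi_rows vector_matrix_left_distrib uminus_vmult vmult_smult vec_eq_iff algebra_simps\<close>)
  show "comp3 2 (N u) = - (comp3 1 u v* L v* M2) + \<i> *s comp3 3 u"
    by (rule cancel)
      (use e[of 2] in \<open>simp add: sigma_A_rows sigma_B_rows psi_rows vector_matrix_left_distrib uminus_vmult vmult_smult vec_eq_iff algebra_simps\<close>)
  show "comp3 3 (N u) = (\<i> * (lam / ?\<beta>)) *s comp3 1 u + \<i> *s (comp3 1 u v* L v* M1)
      + comp3 2 u v* L v* hconj M2 + comp3 3 u v* L v* M3"
    by (rule cancel)
      (use e[of 1] \<beta> in \<open>simp add: sigma_A_rows sigma_B_rows psi_rows vector_matrix_left_distrib uminus_vmult vmult_smult vec_eq_iff algebra_simps\<close>)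
qed

lemma comp3_minus: "comp3 k (- u) = - comp3 k u"
  by (simp add: vec_eq_iff comp3_nth)

text \<open>For vanishing blocks, N is i times a cyclic shift of the three components with weight
  \<lambda>/b in one place, so its cube is i^3 \<lambda>/b. In general, \<open>r1\<close> and
  \<open>r2\<close> cancel every further term of the cube.\<close>

lemma flow_cube:
  fixes L M1 M2 M3 :: "('m::finite) cmat" and lam :: complex
  assumes L: "invertible L" and b: "b \<noteq> 0"
    and r2: "\<And>y. y v* hconj M2 = y v* M2 + \<i> *s (y v* M3 v* L v* M3)"
    and r1: "\<And>y. y v* M1 = y v* hconj M2 v* L v* M3 + y v* M3 v* L v* M2"
  defines "N \<equiv> flow b L lam (psi_block b L M1 M2 M3)"
  shows "N (N (N u)) = (- (\<i> * lam / complex_of_real b)) *s u"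
proof -
  note rows = flow_rows[OF L b, of lam M1 M2 M3, folded N_def]
  show ?thesis
    by (rule comp3_eqI)
      (simp_all add: comp3_smult comp3_minus rows r1 r2 vector_matrix_left_distrib vector_matrix_mult_diff_distrib
        uminus_vmult vmult_smult vec_eq_iff algebra_simps)
qed

lemma bounded_linear_flow: "bounded_linear (flow b L lam M)"
proof -
  have s: "bounded_linear (\<lambda>x :: complex ^ (3 \<times> 'a). \<i> *s x)"
    by (rule bounded_bilinear.bounded_linear_right[OF bounded_bilinear_smult])
  show ?thesis
    unfolding flow_def[abs_def]
    by (intro bounded_linear_compose[OF s] bounded_linear_compose[OF bounded_linear_vector_matrix_mult]
        bounded_linear_vector_matrix_mult)
qed

text \<open>Each component satisfies y''' = N^3 y, and the coefficients p_k and q_k contribute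
  nothing.\<close>

lemma flow_solves_third_order:
  fixes L :: "('m::finite) cmat" and y :: "real \<Rightarrow> complex ^ (3 \<times> 'm)"
  assumes L: "invertible L" and b: "b \<noteq> 0" and a01: "a0 < a1"
    and c: "\<And>x. x \<in> {a0..a1} \<Longrightarrow> \<theta>11 x = M1" "\<And>x. x \<in> {a0..a1} \<Longrightarrow> \<theta>12 x = M2" "\<And>x. x \<in> {a0..a1} \<Longrightarrow> \<theta>13 x = M3"
    and r2: "\<And>y. y v* hconj M2 = y v* M2 + \<i> *s (y v* M3 v* L v* M3)"
    and r1: "\<And>y. y v* M1 = y v* hconj M2 v* L v* M3 + y v* M3 v* L v* M2"
    and y: "\<And>x. x \<in> {a0..a1} \<Longrightarrow> (y has_vector_derivative flow b L lam (psi_block b L M1 M2 M3) (y x)) (at x within {a0..a1})"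
  shows "solves_third_order {a0..a1} (p_coef {a0..a1} L \<theta>11 \<theta>12 \<theta>13 k) (q_coef {a0..a1} L \<theta>11 \<theta>12 \<theta>13 k)
    (- (\<i> * lam / complex_of_real b)) (\<lambda>x. comp3 k (y x))"
proof -
  let ?X = "{a0..a1}"
  define N where "N = flow b L lam (psi_block b L M1 M2 M3)"
  define D where "D = deriv_on ?X (\<lambda>x. comp3 k (y x))"
  define D2 where "D2 = deriv_on ?X D"
  define D3 where "D3 = deriv_on ?X D2"
  have bN: "bounded_linear N" unfolding N_def by (rule bounded_linear_flow)
  have y0: "(y has_vector_derivative N (y x)) (at x within ?X)" if "x \<in> ?X" for x
    using y[OF that] unfolding N_def .
  have y1: "((\<lambda>x. N (y x)) has_vector_derivative N (N (y x))) (at x within ?X)" if "x \<in> ?X" for x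
    by (rule bounded_linear.has_vector_derivative[OF bN y0[OF that]])
  have y2: "((\<lambda>x. N (N (y x))) has_vector_derivative N (N (N (y x)))) (at x within ?X)" if "x \<in> ?X" for x
    by (rule bounded_linear.has_vector_derivative[OF bN y1[OF that]])
  note cd = bounded_linear.has_vector_derivative[OF bounded_linear_comp3]
  have c0: "((\<lambda>x. comp3 k (y x)) has_vector_derivative comp3 k (N (y x))) (at x within ?X)"
    and e1: "D x = comp3 k (N (y x))" if "x \<in> ?X" for x
    unfolding D_def using deriv_on_transform[OF a01 cd[OF y0] refl that] by blast+
  have c1: "(D has_vector_derivative comp3 k (N (N (y x)))) (at x within ?X)"
    and e2: "D2 x = comp3 k (N (N (y x)))" if "x \<in> ?X" for x
    unfolding D2_def using deriv_on_transform[OF a01 cd[OF y1] e1 that] by blast+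
  have c2: "(D2 has_vector_derivative comp3 k (N (N (N (y x))))) (at x within ?X)"
    and e3: "D3 x = comp3 k (N (N (N (y x))))" if "x \<in> ?X" for x
    unfolding D3_def using deriv_on_transform[OF a01 cd[OF y2] e2 that] by blast+
  have dif: "h differentiable_on ?X" if "\<And>x. x \<in> ?X \<Longrightarrow> (h has_vector_derivative d x) (at x within ?X)"
    for h :: "real \<Rightarrow> complex ^ 'm" and d
    unfolding differentiable_on_def differentiable_def
    using that unfolding has_vector_derivative_def by blast
  have "(deriv_on ?X ^^ j) (\<lambda>x. comp3 k (y x)) differentiable_on ?X" if "j < 3" for j
  proof -
    have "j = 0 \<or> j = 1 \<or> j = 2" using that by auto
    moreover have "(deriv_on ?X ^^ 0) (\<lambda>x. comp3 k (y x)) differentiable_on ?X" using dif[OF c0] by simp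
    moreover have "(deriv_on ?X ^^ 1) (\<lambda>x. comp3 k (y x)) differentiable_on ?X" using dif[OF c1] by (simp add: D_def)
    moreover have "(deriv_on ?X ^^ 2) (\<lambda>x. comp3 k (y x)) differentiable_on ?X"
      using dif[OF c2] by (simp add: D_def D2_def numeral_2_eq_2)
    ultimately show ?thesis by blast
  qed
  moreover have "(deriv_on ?X ^^ 3) (\<lambda>x. comp3 k (y x)) x = (- (\<i> * lam / complex_of_real b)) *s comp3 k (y x)"
    if x: "x \<in> ?X" for x
  proof -
    have "(deriv_on ?X ^^ 3) (\<lambda>x. comp3 k (y x)) x = D3 x"
      by (simp add: D_def D2_def D3_def numeral_3_eq_3)
    also have "\<dots> = comp3 k (N (N (N (y x))))" by (rule e3[OF x])
    also have "N (N (N (y x))) = (- (\<i> * lam / complex_of_real b)) *s y x"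
      unfolding N_def by (rule flow_cube[OF L b r2 r1])
    finally show ?thesis by (simp only: comp3_smult)
  qed
  moreover have "p_coef ?X L \<theta>11 \<theta>12 \<theta>13 k x = 0" "q_coef ?X L \<theta>11 \<theta>12 \<theta>13 k x = 0" if x: "x \<in> ?X" for x
    by (rule coefficients_vanish[OF a01 x c r2 r1]; assumption)+
  ultimately show ?thesis
    unfolding solves_third_order_def times_differentiable_on_def
    by (intro conjI allI impI ballI) (simp_all only: vector_matrix_mult_0_right add_0_right)
qed


section \<open>The open system\<close>

lemma has_vector_derivative_cdotI:
  fixes h :: "real \<Rightarrow> complex ^ 'n"
  assumes "\<And>c. ((\<lambda>y. cdot (h y) c) has_vector_derivative cdot d c) F"
  shows "(h has_vector_derivative d) F"
proof -
  have comp: "cdot z (axis i 1) = z $ i" for z :: "complex ^ 'n" and i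
    by (simp add: cdot_def axis_def if_distrib[of cnj] if_distrib[of "\<lambda>x. _ * x"] cong: if_cong)
  have rep: "(\<Sum>i\<in>UNIV. cdot z (axis i 1) *s axis i 1) = z" for z :: "complex ^ 'n"
    unfolding comp vec_eq_iff by (simp add: axis_def if_distrib[of "\<lambda>x. _ * x"] cong: if_cong)
  have "((\<lambda>y. \<Sum>i\<in>UNIV. cdot (h y) (axis i 1) *s axis i 1) has_vector_derivative
      (\<Sum>i\<in>UNIV. cdot d (axis i 1) *s (axis i 1 :: complex ^ 'n))) F"
    by (intro has_vector_derivative_sum bounded_linear.has_vector_derivative[OF
          bounded_bilinear.bounded_linear_left[OF bounded_bilinear_smult] assms])
  then show ?thesis unfolding rep .
qed

lemma cdot_sigma_A: "hconj L = L \<Longrightarrow> cdot (u v* sigma_A b L) w = cdot u (w v* sigma_A b L)"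
  and cdot_sigma_B: "hconj L = L \<Longrightarrow> cdot (u v* sigma_B L) w = cdot u (w v* sigma_B L)"
  unfolding cdot_comp3 sigma_A_rows sigma_B_rows
  by (simp_all add: cdot_smult_left cdot_smult_right cdot_vmult)

locale model_system = model_colligation l b x0 x1 r L S0 P \<psi> \<psi>t p11 p12 p13 t11 t12 t13
  for l b x0 x1 :: real and r :: nat and L S0 :: "('m::{finite,linorder}) cmat"
    and P :: "real \<Rightarrow> real \<Rightarrow> complex ^ ('m::{finite,linorder}) ^ ('p::finite)"
    and \<psi> \<psi>t :: "real \<Rightarrow> (3 \<times> 'm::{finite,linorder}) cmat"
    and p11 p12 p13 t11 t12 t13 :: "real \<Rightarrow> ('m::{finite,linorder}) cmat" +
  fixes lam :: complex and u v :: "real \<Rightarrow> complex ^ (3 \<times> 'm::{finite,linorder})" and f :: "real \<Rightarrow> 'p hfun"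
  assumes not_spec: "x \<in> X \<Longrightarrow> lam \<notin> spectrumH l (A x)"
    and u_diff: "u differentiable_on X"
    and sys: "open_system l X A B \<Phi> (sigma_A b L) (sigma_B L)
           (\<lambda>x t. exp (\<i> * lam * complex_of_real t) *s u x)
           (\<lambda>x t w. exp (\<i> * lam * complex_of_real t) *s f x w)
           (\<lambda>x t. exp (\<i> * lam * complex_of_real t) *s v x)"
begin

text \<open>At t = 0 the exponential factor is 1, so the relations of the system become relations
  between the profiles u, f and v in x alone.\<close>

lemma system_at_0:
  assumes x: "x \<in> X"
  shows "\<exists>ft. has_derivH l UNIV (\<lambda>s w. exp (\<i> * lam * complex_of_real s) *s f x w) ft 0 \<and>
        eqH l (\<lambda>w. \<i> *s ft w + A x (f x) w) (\<Phi>s x (u x v* \<sigma>A))"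
    "\<exists>fx. has_derivH l X f fx x \<and> eqH l (\<lambda>w. \<i> *s fx w + B x (f x) w) (\<Phi>s x (u x v* \<sigma>B))"
    "v x = u x - \<i> *s \<Phi> x (f x)"
proof -
  have e: "exp (\<i> * lam * complex_of_real 0) = 1" by simp
  note s = spec[OF bspec[OF sys[unfolded open_system_def] x], of 0, unfolded e vector_smult_lid]
  show "\<exists>ft. has_derivH l UNIV (\<lambda>s w. exp (\<i> * lam * complex_of_real s) *s f x w) ft 0 \<and>
        eqH l (\<lambda>w. \<i> *s ft w + A x (f x) w) (\<Phi>s x (u x v* \<sigma>A))"
    by (rule s[THEN conjunct1])
  show "\<exists>fx. has_derivH l X f fx x \<and> eqH l (\<lambda>w. \<i> *s fx w + B x (f x) w) (\<Phi>s x (u x v* \<sigma>B))"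
    by (rule s[THEN conjunct2, THEN conjunct1])
  show "v x = u x - \<i> *s \<Phi> x (f x)"
    by (rule s[THEN conjunct2, THEN conjunct2])
qed

lemma f_H: "x \<in> X \<Longrightarrow> f x \<in> H l"
  using system_at_0(2)[of x] unfolding has_derivH_def by blast

text \<open>The time derivative of the state at t = 0 is i \<lambda> f, identified by testing
  against every g; the first equation of the system then reads (A - \<lambda>) f = \<Phi>^*
  \<sigma>_A u, with \<sigma>_A acting first.\<close>

lemma state_equation:
  assumes x: "x \<in> X"
  shows "eqH l (A x (f x)) (\<lambda>w. lam *s f x w + \<Phi>s x (u x v* \<sigma>A) w)"
proof -
  let ?E = "\<lambda>s. exp (\<i> * lam * complex_of_real s)"
  obtain ft where ft: "has_derivH l UNIV (\<lambda>s w. ?E s *s f x w) ft 0"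
    and e: "eqH l (\<lambda>w. \<i> *s ft w + A x (f x) w) (\<Phi>s x (u x v* \<sigma>A))"
    using system_at_0(1)[OF x] by blast
  have ftH: "ft \<in> H l" using ft by (simp add: has_derivH_def)
  have "eqH l ft (\<lambda>w. (\<i> * lam) *s f x w)"
  proof (rule eqH_if_innerH[OF ftH H_smult[OF f_H[OF x]]])
    fix g :: "'p hfun" assume g: "g \<in> H l"
    have "((\<lambda>z. exp (\<i> * lam * z)) has_field_derivative \<i> * lam) (at (complex_of_real 0))"
      by (rule derivative_eq_intros refl | simp)+
    then have E: "(?E has_vector_derivative \<i> * lam) (at 0)"
      by (rule has_vector_derivative_real_field)
    have "((\<lambda>s. ?E s * innerH l (f x) g) has_vector_derivative innerH l ft g) (at 0)"
      using has_derivH_innerH[OF ft g UNIV_I] unfolding innerH_smult_left .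
    moreover have "((\<lambda>s. ?E s * innerH l (f x) g) has_vector_derivative (\<i> * lam) * innerH l (f x) g) (at 0)"
      by (rule has_vector_derivative_mult_left[OF E])
    ultimately show "innerH l ft g = innerH l (\<lambda>w. (\<i> * lam) *s f x w) g"
      unfolding innerH_smult_left by (rule vector_derivative_unique_at)
  qed
  with e show ?thesis
    unfolding eqH_def
  proof eventually_elim
    fix w assume "\<i> *s ft w + A x (f x) w = \<Phi>s x (u x v* \<sigma>A) w" and "ft w = (\<i> * lam) *s f x w"
    then have "A x (f x) w = \<Phi>s x (u x v* \<sigma>A) w - \<i> *s ((\<i> * lam) *s f x w)" by (metis add_diff_cancel_left')
    then show "A x (f x) w = lam *s f x w + \<Phi>s x (u x v* \<sigma>A) w"
      by (simp add: vector_smult_assoc mult.assoc[symmetric] vec_eq_iff)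
  qed
qed

text \<open>The state is the resolvent of A applied to \<Phi>^* \<sigma>_A u, by the state equation;
  inserting this in v = u - i \<Phi> f gives the characteristic function.\<close>

lemma v_char_fun:
  assumes x: "x \<in> X" shows "v x = char_fun l (A x) (\<Phi> x) \<sigma>A lam (u x)"
proof -
  define R where "R = resolventH l (A x) lam"
  have "\<exists>R. inverse_shift l (A x) lam R" using not_spec[OF x] by (simp add: spectrumH_def)
  then have "inverse_shift l (A x) lam R" unfolding R_def resolventH_def by (rule someI_ex)
  then have bR: "bounded_opH l R"
    and inv: "\<And>g. g \<in> H l \<Longrightarrow> eqH l (R (\<lambda>w. A x g w - lam *s g w)) g"
    by (simp_all add: inverse_shift_def)
  let ?k = "\<Phi>s x (u x v* \<sigma>A)" and ?k' = "\<lambda>w. A x (f x) w - lam *s f x w"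
  have H': "?k \<in> H l" "?k' \<in> H l" by (intro Phis_H H_diff A_H H_smult f_H x)+
  have RH: "R ?k \<in> H l" "R ?k' \<in> H l" using bR H' unfolding bounded_opH_def by blast+
  \<comment> \<open>The resolvent acts on representatives. That it sends arguments equal almost
    everywhere to values equal almost everywhere follows from its norm bound on their difference,
    which has norm 0.\<close>
  have "eqH l (\<lambda>w. 1 *s ?k w + (-1) *s ?k' w) (\<lambda>w. 0)"
    using state_equation[OF x] unfolding eqH_def
    by eventually_elim (simp add: vector_sneg_minus1[symmetric])
  then have n0: "normH l (\<lambda>w. 1 *s ?k w + (-1) *s ?k' w) = 0"
    by (rule normH_eq_0_iff[OF H_lin[OF H'], THEN iffD2])
  obtain C where C: "\<And>g. g \<in> H l \<Longrightarrow> normH l (R g) \<le> C * normH l g"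
    using bR unfolding bounded_opH_def by blast
  have "normH l (R (\<lambda>w. 1 *s ?k w + (-1) *s ?k' w)) \<le> 0"
    using C[OF H_lin[OF H', of 1 "-1"]] unfolding n0 by simp
  then have r0: "normH l (R (\<lambda>w. 1 *s ?k w + (-1) *s ?k' w)) = 0"
    by (rule order_antisym) simp
  have R_H: "R g \<in> H l" if "g \<in> H l" for g
    using bR that unfolding bounded_opH_def by blast
  have z: "eqH l (R (\<lambda>w. 1 *s ?k w + (-1) *s ?k' w)) (\<lambda>w. 0)"
    by (rule normH_eq_0_iff[OF R_H[OF H_lin[OF H']], THEN iffD1, OF r0])
  have lin: "eqH l (R (\<lambda>w. 1 *s ?k w + (-1) *s ?k' w)) (\<lambda>w. 1 *s R ?k w + (-1) *s R ?k' w)"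
    by (rule bR[unfolded bounded_opH_def, THEN conjunct2, THEN conjunct1, rule_format, OF H'])
  have "eqH l (R ?k) (f x)"
    using z lin inv[OF f_H[OF x]] unfolding eqH_def
    by eventually_elim (simp add: vector_sneg_minus1[symmetric])
  then have "\<Phi> x (R ?k) = \<Phi> x (f x)" by (rule Phi_cong[OF x RH(1) f_H[OF x]])
  then show ?thesis unfolding char_fun_def system_at_0(3)[OF x] R_def by simp
qed

text \<open>The condition is tested against c = \<Phi> g, which is arbitrary because \<Phi> is onto.
  The pairing of u \<sigma>_A with \<Phi> g equals the pairing of f with a fixed vector, so the
  second equation of the system gives its derivative without any product rule.\<close>

lemma u_equation:
  assumes x: "x \<in> X"
  shows "(u has_vector_derivative flow b L lam (\<psi> x) (u x)) (at x within X)"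
proof -
  have "u differentiable (at x within X)" using u_diff x by (simp add: differentiable_on_def)
  then obtain u' where u': "(u has_vector_derivative u') (at x within X)"
    using vector_derivative_works by blast
  obtain fx where fx: "has_derivH l X f fx x"
    and fe: "eqH l (\<lambda>w. \<i> *s fx w + B x (f x) w) (\<Phi>s x (u x v* \<sigma>B))"
    using system_at_0(2)[OF x] by blast
  have fxH: "fx \<in> H l" using fx by (simp add: has_derivH_def)
  note fH = f_H[OF x]
  have main: "\<i> *s (u' v* \<sigma>A) = - (lam *s (u x v* \<sigma>B) + u x v* \<psi> x)"
  proof (rule cdot_eqI)
    fix c
    obtain g where g: "g \<in> H l" and gc: "\<Phi> x g = c" using Phi_surj[OF x] by blast
    \<comment> \<open>This is (A^* - conj \<lambda>) g, so that <f, g'> = <(A - \<lambda>) f, g> =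
      <u \<sigma>_A, \<Phi> g>. As A and \<Phi> are constant, the same g' serves for all x.\<close>
    define g' where "g' = (\<lambda>w. As x g w - cnj lam *s g w)"
    have g'H: "g' \<in> H l" unfolding g'_def by (intro H_diff As_H H_smult x g)
    have ip: "innerH l h g' = innerH l h (As x g) - lam * innerH l h g" if "h \<in> H l" for h
      unfolding g'_def innerH_diff_right[OF As_H[OF x g] H_smult[OF g] that] innerH_smult_right by simp
    have "innerH l (f y) g' = cdot (u y v* \<sigma>A) (\<Phi> x g)" if y: "y \<in> X" for y
    proof -
      note fy = f_H[OF y]
      have "innerH l (f y) g' = innerH l (A x (f y)) g - lam * innerH l (f y) g"
        unfolding ip[OF fy] As_adj[OF x fy g] ..
      also have "innerH l (A x (f y)) g = innerH l (A y (f y)) g"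
        by (rule innerH_cong[OF A_H[OF x fy] A_H[OF y fy] g g A_const[OF fy x y] eqH_refl])
      also have "innerH l (A y (f y)) g = innerH l (\<lambda>w. lam *s f y w + \<Phi>s y (u y v* \<sigma>A) w) g"
        by (rule innerH_cong[OF A_H[OF y fy] H_add[OF H_smult[OF fy] Phis_H[OF y]] g g state_equation[OF y] eqH_refl])
      also have "\<dots> = lam * innerH l (f y) g + cdot (u y v* \<sigma>A) (\<Phi> y g)"
        unfolding innerH_add_left[OF H_smult[OF fy] Phis_H[OF y] g] innerH_smult_left Phis_adj'[OF y g] ..
      finally show ?thesis unfolding Phi_const[OF g y x] by simp
    qed
    then have "((\<lambda>y. cdot (u y v* \<sigma>A) (\<Phi> x g)) has_vector_derivative innerH l fx g') (at x within X)"
      by (intro has_vector_derivative_transform[OF x _ has_derivH_innerH[OF fx g'H x]]) simp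
    moreover have "((\<lambda>y. cdot (u y v* \<sigma>A) (\<Phi> x g)) has_vector_derivative cdot (u' v* \<sigma>A) (\<Phi> x g)) (at x within X)"
      by (rule bounded_linear.has_vector_derivative[OF bounded_bilinear.bounded_linear_left[OF bounded_bilinear_cdot]
            bounded_linear.has_vector_derivative[OF bounded_linear_vector_matrix_mult u']])
    ultimately have d: "cdot (u' v* \<sigma>A) (\<Phi> x g) = innerH l fx g'"
      by (rule derivative_unique[OF _ _ x, symmetric])
    have "\<i> * innerH l fx g' + innerH l (B x (f x)) g' = innerH l (\<Phi>s x (u x v* \<sigma>B)) g'"
      using innerH_cong[OF H_add[OF H_smult[OF fxH] B_H[OF x fH]] Phis_H[OF x] g'H g'H fe eqH_refl]
      unfolding innerH_add_left[OF H_smult[OF fxH] B_H[OF x fH] g'H] innerH_smult_left .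
    moreover have "innerH l (\<Phi>s x (u x v* \<sigma>B)) g' = cdot (u x v* \<sigma>B) (\<Phi> x (As x g)) - lam * cdot (u x v* \<sigma>B) (\<Phi> x g)"
      unfolding ip[OF Phis_H[OF x]] Phis_adj'[OF x g] Phis_adj'[OF x As_H[OF x g]] ..
    moreover have "innerH l (B x (f x)) g' = cdot (u x v* \<sigma>A) (\<Phi> x (Bs x g))"
    proof -
      note BfH = B_H[OF x fH]
      \<comment> \<open>A and B commute, which lets A - \<lambda> pass through B and reach f, where
        the state equation applies.\<close>
      have comm: "eqH l (A x (B x (f x))) (B x (A x (f x)))"
        unfolding A_eq by (rule eqH_sym[OF B_smult[OF x B_H[OF x B_H[OF x BfH]]]])
      have "innerH l (B x (f x)) g' = innerH l (A x (B x (f x))) g - lam * innerH l (B x (f x)) g"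
        unfolding ip[OF BfH] As_adj[OF x BfH g] ..
      also have "innerH l (A x (B x (f x))) g = innerH l (B x (A x (f x))) g"
        by (rule innerH_cong[OF A_H[OF x BfH] B_H[OF x A_H[OF x fH]] g g comm eqH_refl])
      also have "innerH l (B x (A x (f x))) g = innerH l (A x (f x)) (Bs x g)"
        by (rule Bs_adj[OF x A_H[OF x fH] g])
      also have "innerH l (A x (f x)) (Bs x g) = innerH l (\<lambda>w. lam *s f x w + \<Phi>s x (u x v* \<sigma>A) w) (Bs x g)"
        by (rule innerH_cong[OF A_H[OF x fH] H_add[OF H_smult[OF fH] Phis_H[OF x]] Bs_H[OF x g] Bs_H[OF x g]
              state_equation[OF x] eqH_refl])
      also have "\<dots> = lam * innerH l (f x) (Bs x g) + cdot (u x v* \<sigma>A) (\<Phi> x (Bs x g))"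
        unfolding innerH_add_left[OF H_smult[OF fH] Phis_H[OF x] Bs_H[OF x g]] innerH_smult_left
          Phis_adj'[OF x Bs_H[OF x g]] ..
      finally show ?thesis unfolding Bs_adj[OF x fH g] by simp
    qed
    ultimately have "\<i> * cdot (u' v* \<sigma>A) (\<Phi> x g) = cdot (u x v* \<sigma>B) (\<Phi> x (As x g))
        - lam * cdot (u x v* \<sigma>B) (\<Phi> x g) - cdot (u x v* \<sigma>A) (\<Phi> x (Bs x g))"
      unfolding d by (simp add: algebra_simps)
    moreover have "cdot (u x v* \<sigma>A) (\<Phi> x (Bs x g)) - cdot (u x v* \<sigma>B) (\<Phi> x (As x g)) = cdot (u x v* \<psi> x) (\<Phi> x g)"
      unfolding cdot_sigma_A[OF L_herm] cdot_sigma_B[OF L_herm] cdot_diff_right[symmetric] psi_relations(1)[OF x g]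
      unfolding cdot_vmult_right colligationD(1)[OF x] ..
    ultimately have "\<i> * cdot (u' v* \<sigma>A) (\<Phi> x g) = - (lam * cdot (u x v* \<sigma>B) (\<Phi> x g) + cdot (u x v* \<psi> x) (\<Phi> x g))"
      by (simp add: diff_eq_eq)
    then show "cdot (\<i> *s (u' v* \<sigma>A)) c = cdot (- (lam *s (u x v* \<sigma>B) + u x v* \<psi> x)) c"
      unfolding gc cdot_smult_left cdot_minus_left cdot_add_left .
  qed
  have "u' v* \<sigma>A = \<i> *s (u x v* (lam *\<^sub>m \<sigma>B + \<psi> x))"
  proof -
    have "u' v* \<sigma>A = - \<i> *s (\<i> *s (u' v* \<sigma>A))" unfolding vector_smult_assoc by simp
    then show ?thesis
      unfolding main vector_matrix_mult_add_rdistrib vmult_cscale by (simp add: vec_eq_iff)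
  qed
  then have "u' v* \<sigma>A v* matrix_inv \<sigma>A = flow b L lam (\<psi> x) (u x)"
    unfolding flow_def by (simp only: vmult_smult)
  then have "u' = flow b L lam (\<psi> x) (u x)"
    by (simp add: vector_matrix_mul_assoc sigma_A_inv[OF L_inv b_nz])
  then show ?thesis using u' by simp
qed

text \<open>Since \<Phi> is constant, v' = u' - i \<Phi> f_x, and f_x is eliminated by the second
  equation of the system. After multiplication by \<sigma>_A the terms with \<Phi>\<Phi>^* are
  cancelled by the linkage relation, which exchanges \<psi> for its counterpart with tilde.\<close>

lemma v_equation:
  assumes x: "x \<in> X"
  shows "(v has_vector_derivative flow b L lam (\<psi>t x) (v x)) (at x within X)"
proof -
  define u' where "u' = flow b L lam (\<psi> x) (u x)"
  have u': "(u has_vector_derivative u') (at x within X)" unfolding u'_def by (rule u_equation[OF x])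
  obtain fx where fx: "has_derivH l X f fx x"
    and fe: "eqH l (\<lambda>w. \<i> *s fx w + B x (f x) w) (\<Phi>s x (u x v* \<sigma>B))"
    using system_at_0(2)[OF x] by blast
  have fxH: "fx \<in> H l" using fx by (simp add: has_derivH_def)
  note fH = f_H[OF x]
  have dPhi: "((\<lambda>y. \<Phi> x (f y)) has_vector_derivative \<Phi> x fx) (at x within X)"
  proof (rule has_vector_derivative_cdotI)
    fix c
    show "((\<lambda>y. cdot (\<Phi> x (f y)) c) has_vector_derivative cdot (\<Phi> x fx) c) (at x within X)"
      unfolding Phis_adj[OF x fxH]
      by (rule has_vector_derivative_transform[OF x _ has_derivH_innerH[OF fx Phis_H[OF x] x]])
         (simp add: Phis_adj[OF x f_H])
  qed
  have s: "bounded_linear (\<lambda>z :: complex ^ (3 \<times> 'm::{finite,linorder}). \<i> *s z)"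
    by (rule bounded_bilinear.bounded_linear_right[OF bounded_bilinear_smult])
  have v': "(v has_vector_derivative u' - \<i> *s \<Phi> x fx) (at x within X)"
  proof (rule has_vector_derivative_transform[OF x])
    show "((\<lambda>y. u y - \<i> *s \<Phi> x (f y)) has_vector_derivative u' - \<i> *s \<Phi> x fx) (at x within X)"
      by (rule has_vector_derivative_diff[OF u' bounded_linear.has_vector_derivative[OF s dPhi]])
    show "v y = u y - \<i> *s \<Phi> x (f y)" if y: "y \<in> X" for y
      unfolding system_at_0(3)[OF y] Phi_const[OF f_H[OF y] x y] ..
  qed
  have Phi_fx: "\<i> *s \<Phi> x fx = \<Phi> x (\<Phi>s x (u x v* \<sigma>B)) - \<Phi> x (B x (f x))"
  proof -
    have "\<Phi> x (\<lambda>w. \<i> *s fx w + 1 *s B x (f x) w) = \<Phi> x (\<Phi>s x (u x v* \<sigma>B))"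
      by (rule Phi_cong[OF x H_lin[OF fxH B_H[OF x fH]] Phis_H[OF x]]) (use fe in simp)
    then show ?thesis unfolding Phi_lin[OF x fxH B_H[OF x fH]] by (simp add: algebra_simps)
  qed
  have Phi_A: "\<Phi> x (A x (f x)) = lam *s \<Phi> x (f x) + \<Phi> x (\<Phi>s x (u x v* \<sigma>A))"
  proof -
    have "\<Phi> x (A x (f x)) = \<Phi> x (\<lambda>w. lam *s f x w + 1 *s \<Phi>s x (u x v* \<sigma>A) w)"
      by (rule Phi_cong[OF x A_H[OF x fH] H_lin[OF fH Phis_H[OF x]]]) (use state_equation[OF x] in simp)
    then show ?thesis unfolding Phi_lin[OF x fH Phis_H[OF x]] by simp
  qed
  have u'A: "u' v* \<sigma>A = \<i> *s (lam *s (u x v* \<sigma>B) + u x v* \<psi> x)"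
    unfolding u'_def flow_def vmult_smult
    by (simp add: vector_matrix_mul_assoc matrix_mul_assoc[symmetric] sigma_A_inv[OF L_inv b_nz]
        vector_matrix_mult_add_rdistrib vmult_cscale)
  have BA: "\<Phi> x (B x (f x)) v* \<sigma>A = \<Phi> x (A x (f x)) v* \<sigma>B + \<Phi> x (f x) v* \<psi>t x"
    using psi_relations(2)[OF x fH] by (simp add: algebra_simps)
  have psi_t: "\<i> *s (u x v* \<psi> x) = \<i> *s (u x v* \<psi>t x) + (\<Phi> x (\<Phi>s x (u x v* \<sigma>B)) v* \<sigma>A - \<Phi> x (\<Phi>s x (u x v* \<sigma>A)) v* \<sigma>B)"
    unfolding colligationD(4)[OF x, of "u x"] by (simp add: vec_eq_iff algebra_simps)
  have "(u' - \<i> *s \<Phi> x fx) v* \<sigma>A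
      = \<i> *s (lam *s (u x v* \<sigma>B)) + \<i> *s (u x v* \<psi> x) - \<Phi> x (\<Phi>s x (u x v* \<sigma>B)) v* \<sigma>A + \<Phi> x (B x (f x)) v* \<sigma>A"
    unfolding Phi_fx vector_matrix_mult_diff_distrib u'A by (simp add: vec_eq_iff algebra_simps)
  also have "\<dots> = \<i> *s (lam *s (u x v* \<sigma>B) + u x v* \<psi>t x) + lam *s (\<Phi> x (f x) v* \<sigma>B) + \<Phi> x (f x) v* \<psi>t x"
    unfolding psi_t BA Phi_A by (simp add: vector_matrix_left_distrib vmult_smult vec_eq_iff algebra_simps)
  also have "\<dots> = \<i> *s (v x v* (lam *\<^sub>m \<sigma>B + \<psi>t x))"
    unfolding system_at_0(3)[OF x] vector_matrix_mult_add_rdistrib vmult_cscale vector_matrix_mult_diff_distrib vmult_smult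
    by (simp add: vec_eq_iff algebra_simps)
  finally have "(u' - \<i> *s \<Phi> x fx) v* \<sigma>A v* matrix_inv \<sigma>A = flow b L lam (\<psi>t x) (v x)"
    unfolding flow_def by (simp only: vmult_smult)
  then have "u' - \<i> *s \<Phi> x fx = flow b L lam (\<psi>t x) (v x)"
    by (simp add: vector_matrix_mul_assoc sigma_A_inv[OF L_inv b_nz])
  then show ?thesis using v' by simp
qed

lemma solves_u:
  "solves_third_order X (p_coef X L p11 p12 p13 k) (q_coef X L p11 p12 p13 k)
    (- (\<i> * lam / complex_of_real b)) (\<lambda>x. comp3 k (u x))"
proof (rule flow_solves_third_order[OF L_inv b_nz x01 p11_zero p12_zero p13_zero])
  show "(u has_vector_derivative flow b L lam (psi_block b L 0 0 0) (u x)) (at x within X)" if x: "x \<in> X" for x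
    using u_equation[OF x] unfolding psi[OF x] p11_zero[OF x] p12_zero[OF x] p13_zero[OF x] .
qed (simp_all add: hconj_def vec_eq_iff vector_matrix_mult_def)

text \<open>The constant blocks are frozen at x_0, where the identities between them are
  available.\<close>

lemma solves_v:
  "solves_third_order X (p_coef X L t11 t12 t13 k) (q_coef X L t11 t12 t13 k)
    (- (\<i> * lam / complex_of_real b)) (\<lambda>x. comp3 k (v x))"
proof (rule flow_solves_third_order[OF L_inv b_nz x01 t_const(1)[OF _ x0_in] t_const(2)[OF _ x0_in] t_const(3)[OF _ x0_in]])
  show "(v has_vector_derivative flow b L lam (psi_block b L (t11 x0) (t12 x0) (t13 x0)) (v x)) (at x within X)" if x: "x \<in> X" for x
    using v_equation[OF x] unfolding psit[OF x] t_const[OF x x0_in] .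
qed (assumption | rule t_relations[OF x0_in])+

end

theorem theorem9p1:
  fixes l b x0 x1 :: real and r :: nat and lam :: complex
    and L S0 :: "('m::{finite,linorder}) cmat"
    and P :: "real \<Rightarrow> real \<Rightarrow> complex ^ ('m::{finite,linorder}) ^ ('p::finite)"
    and A B :: "real \<Rightarrow> 'p hfun \<Rightarrow> 'p hfun"
    and \<Phi> :: "real \<Rightarrow> 'p hfun \<Rightarrow> complex ^ (3 \<times> 'm)"
    and \<sigma>A \<sigma>B :: "(3 \<times> 'm) cmat"
    and \<psi> \<psi>t :: "real \<Rightarrow> (3 \<times> 'm) cmat"
    and \<psi>11 \<psi>12 \<psi>13 \<psi>t11 \<psi>t12 \<psi>t13 :: "real \<Rightarrow> 'm cmat"
    and u v :: "real \<Rightarrow> complex ^ (3 \<times> 'm)"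
    and f :: "real \<Rightarrow> 'p hfun"
    and S :: "real set"
  assumes "x0 < x1" and S: "S = {x0..x1}" and "0 < l" and "b \<noteq> 0"
    and "CARD('p) \<le> CARD('m)"
    and "model_matrix r L S0"
    and "\<And>x. x \<in> S \<Longrightarrow> model_kernel l r (P x)"
    and B: "B = (\<lambda>x. model_B l L S0 (P x))"
    and A: "A = (\<lambda>x. model_A b l L S0 (P x))"
    and \<Phi>: "\<Phi> = (\<lambda>x. model_Phit l L S0 (P x))"
    and \<sigma>A: "\<sigma>A = sigma_A b L" and \<sigma>B: "\<sigma>B = sigma_B L"
    and "colligation l S A B \<Phi> \<sigma>A \<sigma>B \<psi> \<psi>t"
    and "strict_colligation l S \<Phi> \<sigma>A \<sigma>B"
    and "\<And>x. x \<in> S \<Longrightarrow> \<psi> x = psi_block b L (\<psi>11 x) (\<psi>12 x) (\<psi>13 x)"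
    and "\<And>x. x \<in> S \<Longrightarrow> hconj (\<psi>11 x) = \<psi>11 x \<and> hconj (\<psi>13 x) = \<psi>13 x"
    and "\<And>x. x \<in> S \<Longrightarrow> \<psi>t x = psi_block b L (\<psi>t11 x) (\<psi>t12 x) (\<psi>t13 x)"
    and "\<And>x. x \<in> S \<Longrightarrow> hconj (\<psi>t11 x) = \<psi>t11 x \<and> hconj (\<psi>t13 x) = \<psi>t13 x"
    and "times_differentiable_on 2 S \<psi>11" "times_differentiable_on 2 S \<psi>12"
        "times_differentiable_on 2 S \<psi>13"
    and "times_differentiable_on 2 S \<psi>t11" "times_differentiable_on 2 S \<psi>t12"
        "times_differentiable_on 2 S \<psi>t13"
    and "extra_conditions S L \<psi>11 \<psi>12 \<psi>13"
    and "extra_conditions S L \<psi>t11 \<psi>t12 \<psi>t13"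
    and "\<And>x. x \<in> S \<Longrightarrow> lam \<notin> spectrumH l (A x)"
    and "u differentiable_on S"
    and "open_system l S A B \<Phi> \<sigma>A \<sigma>B
           (\<lambda>x t. exp (\<i> * lam * complex_of_real t) *s u x)
           (\<lambda>x t w. exp (\<i> * lam * complex_of_real t) *s f x w)
           (\<lambda>x t. exp (\<i> * lam * complex_of_real t) *s v x)"
  shows "(u differentiable_on S \<and> v differentiable_on S) \<and>
    (\<forall>x\<in>S. deriv_on S u x - \<i> *s ((u x v* (lam *\<^sub>m \<sigma>B + \<psi> x)) v* matrix_inv \<sigma>A) = 0) \<and>
    (\<forall>x\<in>S. deriv_on S v x - \<i> *s ((v x v* (lam *\<^sub>m \<sigma>B + \<psi>t x)) v* matrix_inv \<sigma>A) = 0) \<and>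
    (\<forall>k. solves_third_order S (p_coef S L \<psi>11 \<psi>12 \<psi>13 k) (q_coef S L \<psi>11 \<psi>12 \<psi>13 k)
           (- (\<i> * lam / complex_of_real b)) (\<lambda>x. comp3 k (u x))) \<and>
    (\<forall>x\<in>S. v x = char_fun l (A x) (\<Phi> x) \<sigma>A lam (u x)) \<and>
    (\<forall>k. solves_third_order S (p_coef S L \<psi>t11 \<psi>t12 \<psi>t13 k) (q_coef S L \<psi>t11 \<psi>t12 \<psi>t13 k)
           (- (\<i> * lam / complex_of_real b)) (\<lambda>x. comp3 k (v x)))"
proof -
  interpret model_system l b x0 x1 r L S0 P \<psi> \<psi>t \<psi>11 \<psi>12 \<psi>13 \<psi>t11 \<psi>t12 \<psi>t13 lam u v f
    using assms by unfold_locales simp_all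
  have flow: "deriv_on S y x = flow b L lam M (y x)"
    if "(y has_vector_derivative flow b L lam M (y x)) (at x within X)" "x \<in> S" for y M x
    using vector_derivative_within_cbox[of x0 x1 x y] that assms(1) unfolding S deriv_on_def by simp
  have dif: "y differentiable_on S"
    if "\<And>x. x \<in> X \<Longrightarrow> (y has_vector_derivative d x) (at x within X)"
    for y :: "real \<Rightarrow> complex ^ (3 \<times> 'm)" and d
    unfolding differentiable_on_def differentiable_def S
    using that unfolding has_vector_derivative_def by blast
  show ?thesis
  proof (intro conjI ballI allI)
    show "u differentiable_on S" "v differentiable_on S"
      by (rule dif[OF u_equation] dif[OF v_equation]; assumption)+
    fix x assume x: "x \<in> S"
    then have x': "x \<in> X" by (simp add: S)
    show "deriv_on S u x - \<i> *s ((u x v* (lam *\<^sub>m \<sigma>B + \<psi> x)) v* matrix_inv \<sigma>A) = 0"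
      unfolding flow[OF u_equation[OF x'] x] \<sigma>A \<sigma>B by (simp add: flow_def)
    show "deriv_on S v x - \<i> *s ((v x v* (lam *\<^sub>m \<sigma>B + \<psi>t x)) v* matrix_inv \<sigma>A) = 0"
      unfolding flow[OF v_equation[OF x'] x] \<sigma>A \<sigma>B by (simp add: flow_def)
    show "v x = char_fun l (A x) (\<Phi> x) \<sigma>A lam (u x)"
      unfolding \<sigma>A A \<Phi> by (rule v_char_fun[OF x'])
  next
    fix k
    show "solves_third_order S (p_coef S L \<psi>11 \<psi>12 \<psi>13 k) (q_coef S L \<psi>11 \<psi>12 \<psi>13 k)
           (- (\<i> * lam / complex_of_real b)) (\<lambda>x. comp3 k (u x))"
      unfolding S by (rule solves_u)
    show "solves_third_order S (p_coef S L \<psi>t11 \<psi>t12 \<psi>t13 k) (q_coef S L \<psi>t11 \<psi>t12 \<psi>t13 k)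
           (- (\<i> * lam / complex_of_real b)) (\<lambda>x. comp3 k (v x))"
      unfolding S by (rule solves_v)
  qed
qed

end
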